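(* Let $A$ be a complex Banach algebra with identity $\mathbf 1$, let $a,b\in A$, and let $f$ be holomorphic on an open set $U\subseteq\mathbb C$ containing $\sigma(a)\cup\sigma(b)$, with $f(a),f(b)$ defined by the holomorphic functional calculus. Then \[\rho(f(a),f(b))\leq\sup_{\omega\in\sigma(b)}\max\left\{\sup_{\lambda\in\sigma(a),\ \lambda\neq\omega}\left|\frac{f(\lambda)-f(\omega)}{\lambda-\omega}\right|,\ |f'(\omega)|\right\}\cdot\rho(a,b),\] and the supremum on the right-hand side is finite. In particular, if $d_\rho(a,b)=0$ (so that $\sigma(a)=\sigma(b)$) and $f$ is holomorphic on an open set containing $\sigma(a)$, then $d_\rho(f(a),f(b))=0$.
   Context: For $a,b\in A$ and $n\geq 0$ put $C_{a,b}^n\mathbf 1=\sum_{k=0}^n(-1)^k\binom{n}{k}a^{n-k}b^k$ (with $a^0=b^0=\mathbf 1$); this is $(L_a-R_b)^n$ applied to $\mathbf 1$, where $L_ax=ax$, $R_bx=xb$. Define $\rho(a,b)=\limsup_{n\to\infty}\|C_{a,b}^n\mathbf 1\|^{1/n}$ and $d_\rho(a,b)=\max\{\rho(a,b),\rho(b,a)\}$. $\sigma(x)$ denotes the spectrum of $x$. *)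

theory Defs
  imports "HOL-Complex_Analysis.Complex_Analysis" "HOL-Library.Liminf_Limsup"
begin

class complex_banach_algebra = banach + real_normed_algebra_1 +
  fixes cscale :: "complex \<Rightarrow> 'a \<Rightarrow> 'a"
  assumes cscale_add_right: "cscale c (x + y) = cscale c x + cscale c y"
    and cscale_add_left: "cscale (c + d) x = cscale c x + cscale d x"
    and cscale_cscale: "cscale c (cscale d x) = cscale (c * d) x"
    and cscale_of_real: "cscale (of_real r) x = scaleR r x"
    and norm_cscale: "norm (cscale c x) = norm c * norm x"
    and cscale_mult_left: "cscale c x * y = cscale c (x * y)"
    and cscale_mult_right: "x * cscale c y = cscale c (x * y)"

definition ba_invertible :: "'a::complex_banach_algebra \<Rightarrow> bool" where
  "ba_invertible x \<longleftrightarrow> (\<exists>y. x * y = 1 \<and> y * x = 1)"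

definition ba_inv :: "'a::complex_banach_algebra \<Rightarrow> 'a" where
  "ba_inv x = (THE y. x * y = 1 \<and> y * x = 1)"

definition spec :: "'a::complex_banach_algebra \<Rightarrow> complex set" where
  "spec x = {z. \<not> ba_invertible (cscale z 1 - x)}"

definition alg_contour_integral ::
    "(complex \<Rightarrow> 'a::complex_banach_algebra) \<Rightarrow> (real \<Rightarrow> complex) \<Rightarrow> 'a" where
  "alg_contour_integral F g =
     integral {0..1} (\<lambda>t. cscale (vector_derivative g (at t within {0..1})) (F (g t)))"

definition admissible_cycle :: "complex set \<Rightarrow> complex set \<Rightarrow> (real \<Rightarrow> complex) list \<Rightarrow> bool" where
  "admissible_cycle U K \<Gamma> \<longleftrightarrow>
     (\<forall>\<gamma>\<in>set \<Gamma>. valid_path \<gamma> \<and> pathfinish \<gamma> = pathstart \<gamma> \<and> path_image \<gamma> \<subseteq> U - K) \<and>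
     (\<forall>z\<in>K. (\<Sum>\<gamma>\<leftarrow>\<Gamma>. winding_number \<gamma> z) = 1) \<and>
     (\<forall>z. z \<notin> U \<longrightarrow> (\<Sum>\<gamma>\<leftarrow>\<Gamma>. winding_number \<gamma> z) = 0)"

definition hfc :: "complex set \<Rightarrow> (complex \<Rightarrow> complex) \<Rightarrow> 'a::complex_banach_algebra \<Rightarrow> 'a" where
  "hfc U f a = (SOME c. \<exists>\<Gamma>. admissible_cycle U (spec a) \<Gamma> \<and>
      c = cscale (1 / (2 * pi * \<i>))
            (\<Sum>\<gamma>\<leftarrow>\<Gamma>. alg_contour_integral (\<lambda>z. cscale (f z) (ba_inv (cscale z 1 - a))) \<gamma>))"

definition Cpow :: "'a::complex_banach_algebra \<Rightarrow> 'a \<Rightarrow> nat \<Rightarrow> 'a" where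
  "Cpow a b n = (\<Sum>k\<le>n. (-1) ^ k * of_nat (n choose k) * a ^ (n - k) * b ^ k)"

definition rho :: "'a::complex_banach_algebra \<Rightarrow> 'a \<Rightarrow> ereal" where
  "rho a b = limsup (\<lambda>n. ereal (root n (norm (Cpow a b n))))"

definition d_rho :: "'a::complex_banach_algebra \<Rightarrow> 'a \<Rightarrow> ereal" where
  "d_rho a b = max (rho a b) (rho b a)"

end

theory Submission
  imports Defs "HOL-Library.Multiset"
begin

text \<open>
  With \<open>g(z, w) = (f z - f w) / (z - w)\<close> and \<open>R\<^sub>a\<close>, \<open>R\<^sub>b\<close> the resolvents, multiplicativity of
  the functional calculus turns \<open>C\<^sup>n 1\<close> for the pair \<open>f a\<close>, \<open>f b\<close> into a multiple of the double integral of
  \<open>(f z - f w)\<^sup>n R\<^sub>a z R\<^sub>b w = g(z, w)\<^sup>n (z - w)\<^sup>n R\<^sub>a z R\<^sub>b w\<close>. Up to terms that depend on one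
  variable only through the scalar factor, and so integrate to zero by Cauchy's theorem, \<open>(z - w) R\<^sub>a x R\<^sub>b\<close> equals \<open>R\<^sub>a (a x - x b) R\<^sub>b\<close>, so the integral is that of
  \<open>g(z, w)\<^sup>n R\<^sub>a z C\<^sup>n R\<^sub>b w\<close>, where now \<open>C\<^sup>n\<close> belongs to the pair \<open>a\<close>, \<open>b\<close>. On contours close to the
  spectra \<open>|g|\<close> is at most the supremum plus \<open>\<epsilon>\<close>, and taking \<open>n\<close>-th roots gives the bound.

  Grid contours, the boundaries of unions of squares of a fine grid, can be taken close to the spectra.
  An admissible cycle need not be rectifiable; local primitives replace it by a polygon, and the
  resolvent identity together with the scalar Cauchy formula then moves the integral to a grid contour.
\<close>

section \<open>Resolvents and vector-valued primitives\<close>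

text \<open>The choice in \<open>hfc\<close> may fall on any admissible cycle, about which only
  scalar data are given, the winding numbers, while the integrand takes values in the algebra. The
  resolvent identity bridges this gap. For disjoint chains it splits
  \<open>f \<zeta> / (\<zeta> - z)\<close> times the resolvent at \<open>z\<close> into a scalar
  kernel times the resolvent at \<open>\<zeta>\<close> and a product of two resolvents. Scalar
  Cauchy formulas for the kernels then settle every comparison, apart from one algebra-valued
  quantity, the integral of the resolvent itself. That integral is computed on a grid chain:
  Cauchy's theorem on single squares moves it out to a large box, where the resolvent differs from
  \<open>1 / z\<close> by a term of order \<open>1 / |z|^2\<close>.

  The kernel \<open>1 / (\<zeta> - z)\<close> forces the two chains to be disjoint, and its
  integrals take the right values only if the chains are nested. Hence the open sets
  \<open>W\<close> with compact closure in \<open>U\<close> around each spectrum, and hence a given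
  cycle is compared with one chain nearer to the spectrum and another one farther out.\<close>

lemma cscale_scaleR_left: "cscale (r *\<^sub>R c) x = r *\<^sub>R cscale c (x::'a::complex_banach_algebra)"
  by (metis cscale_cscale cscale_of_real scaleR_conv_of_real)

lemma cscale_scaleR_right: "cscale c (r *\<^sub>R x) = r *\<^sub>R cscale c (x::'a::complex_banach_algebra)"
  by (metis cscale_cscale cscale_of_real mult.commute)

text \<open>Source of the continuity, derivative and integration rules for \<open>cscale\<close>
  used throughout.\<close>

interpretation cscale: bounded_bilinear "cscale :: complex \<Rightarrow> 'a \<Rightarrow> 'a::complex_banach_algebra"
proof
  show "\<exists>K. \<forall>a b. norm (cscale a (b::'a)) \<le> norm a * norm b * K"
    by (rule exI[of _ 1]) (simp add: norm_cscale)
qed (simp_all add: cscale_add_left cscale_add_right cscale_scaleR_left cscale_scaleR_right)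

declare cscale.continuous_on [continuous_intros]

lemma cscale_one [simp]: "cscale 1 x = (x::'a::complex_banach_algebra)"
  using cscale_of_real[of 1 x] by simp

lemma cscale_commute: "cscale c (cscale d x) = cscale d (cscale c (x::'a::complex_banach_algebra))"
  by (simp add: cscale_cscale mult.commute)

lemma cscale_1_mult: "cscale c 1 * x = cscale c (x::'a::complex_banach_algebra)"
  by (simp add: cscale_mult_left)

lemma mult_cscale_1: "x * cscale c 1 = cscale c (x::'a::complex_banach_algebra)"
  by (simp add: cscale_mult_right)

lemma cscale_left_inject:
  assumes "c \<noteq> 0" "cscale c x = cscale c (y::'a::complex_banach_algebra)"
  shows "x = y"
proof -
  have "cscale (inverse c) (cscale c x) = cscale (inverse c) (cscale c y)"
    using assms by simp
  then show ?thesis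
    using assms(1) by (simp add: cscale_cscale)
qed

lemma cscale_1_inject: "cscale c (1::'a::complex_banach_algebra) = cscale d 1 \<longleftrightarrow> c = d"
proof
  assume "cscale c (1::'a) = cscale d 1"
  then have "norm (cscale (c - d) (1::'a)) = 0"
    by (simp add: cscale.diff_left)
  then show "c = d" by (simp add: norm_cscale)
qed simp

lemma ba_inv_unique:
  fixes x :: "'a::complex_banach_algebra"
  assumes "x * y = 1" "y * x = 1"
  shows "ba_inv x = y"
  unfolding ba_inv_def
proof (rule the_equality)
  fix z assume "x * z = 1 \<and> z * x = 1"
  then show "z = y"
    using assms by (metis mult.assoc mult.left_neutral mult.right_neutral)
qed (use assms in auto)

lemma ba_invertibleI:
  fixes x :: "'a::complex_banach_algebra"
  assumes "x * y = 1" "z * x = 1"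
  shows "ba_invertible x"
proof -
  have "z = y" using assms by (metis mult.assoc mult.left_neutral mult.right_neutral)
  then show ?thesis using assms unfolding ba_invertible_def by blast
qed

lemma
  fixes x :: "'a::complex_banach_algebra"
  assumes "ba_invertible x"
  shows ba_inv_right: "x * ba_inv x = 1" and ba_inv_left: "ba_inv x * x = 1"
proof -
  obtain y where "x * y = 1" "y * x = 1"
    using assms unfolding ba_invertible_def by blast
  then show "x * ba_inv x = 1" "ba_inv x * x = 1"
    using ba_inv_unique[of x y] by auto
qed

lemma ba_invertible_mult:
  fixes x y :: "'a::complex_banach_algebra"
  assumes "ba_invertible x" "ba_invertible y"
  shows "ba_invertible (x * y)"
proof (rule ba_invertibleI)
  show "x * y * (ba_inv y * ba_inv x) = 1"
    by (metis assms ba_inv_right mult.assoc mult.right_neutral)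
  show "ba_inv y * ba_inv x * (x * y) = 1"
    by (metis assms ba_inv_left mult.assoc mult.right_neutral)
qed

lemma ba_invertible_1_minus:
  fixes y :: "'a::complex_banach_algebra"
  assumes "norm y < 1"
  shows "ba_invertible (1 - y)"
proof -
  have s: "summable (\<lambda>n. y ^ n)"
    using complete_algebra_summable_geometric[OF assms] .
  have eq: "(\<Sum>n. y ^ n) = 1 + (\<Sum>n. y ^ Suc n)"
    using suminf_split_initial_segment[OF s, of 1] by simp
  have "(\<Sum>n. y ^ Suc n) = y * (\<Sum>n. y ^ n)"
    using suminf_mult[OF s, of y] by simp
  moreover have "(\<Sum>n. y ^ Suc n) = (\<Sum>n. y ^ n) * y"
    using suminf_mult2[OF s, of y] by (simp add: power_commutes)
  ultimately show ?thesis
    using eq by (intro ba_invertibleI[of _ "\<Sum>n. y ^ n" "\<Sum>n. y ^ n"]) (simp_all add: algebra_simps)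
qed

definition resolvent :: "'a::complex_banach_algebra \<Rightarrow> complex \<Rightarrow> 'a" where
  "resolvent a z = ba_inv (cscale z 1 - a)"

lemma
  assumes "z \<notin> spec a"
  shows resolvent_right: "(cscale z 1 - a) * resolvent a z = 1"
    and resolvent_left: "resolvent a z * (cscale z 1 - a) = 1"
  using assms ba_inv_right ba_inv_left unfolding spec_def resolvent_def by auto

lemma resolvent_mult:
  assumes "z \<notin> spec a"
  shows "a * resolvent a z = cscale z (resolvent a z) - 1"
    and "resolvent a z * a = cscale z (resolvent a z) - 1"
  using resolvent_right[OF assms] resolvent_left[OF assms]
  by (auto simp: algebra_simps cscale_1_mult mult_cscale_1)

lemma resolvent_identity:
  assumes "z \<notin> spec a" "w \<notin> spec a"
  shows "resolvent a z - resolvent a w = cscale (w - z) (resolvent a z * resolvent a w)"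
proof -
  have "resolvent a z * (cscale w 1 - cscale z 1) * resolvent a w
      = resolvent a z * ((cscale w 1 - a) - (cscale z 1 - a)) * resolvent a w"
    by simp
  also have "\<dots> = resolvent a z * ((cscale w 1 - a) * resolvent a w) - (resolvent a z * (cscale z 1 - a)) * resolvent a w"
    by (simp only: left_diff_distrib right_diff_distrib mult.assoc)
  also have "\<dots> = resolvent a z - resolvent a w"
    using resolvent_right[OF assms(2)] resolvent_left[OF assms(1)] by simp
  finally show ?thesis
    by (simp add: cscale.diff_left algebra_simps cscale_mult_left cscale_mult_right)
qed

lemma spec_norm_le:
  assumes "z \<in> spec a"
  shows "norm z \<le> norm a"
proof (rule ccontr)
  assume less: "\<not> norm z \<le> norm a"
  then have "z \<noteq> 0" by auto
  have "norm (cscale (1/z) a) < 1"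
    using less by (simp add: norm_cscale norm_divide divide_simps split: if_splits)
  then have "ba_invertible (1 - cscale (1/z) a)"
    by (rule ba_invertible_1_minus)
  moreover have "ba_invertible (cscale z 1 :: 'a)"
    by (rule ba_invertibleI[of _ "cscale (1/z) 1" "cscale (1/z) 1"])
      (use \<open>z \<noteq> 0\<close> in \<open>simp_all add: cscale_mult_left cscale_cscale\<close>)
  ultimately have "ba_invertible (cscale z 1 * (1 - cscale (1/z) a))"
    by (intro ba_invertible_mult)
  moreover have "cscale z 1 * (1 - cscale (1/z) a) = cscale z 1 - a"
    using \<open>z \<noteq> 0\<close> by (simp add: cscale_1_mult cscale.diff_right cscale_cscale)
  ultimately show False using assms by (simp add: spec_def)
qed

text \<open>The factorisation \<open>z - a = (w - a) (1 + (z - w) R w)\<close>, with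
  \<open>R\<close> the resolvent of \<open>a\<close>, reduces the claim to the Neumann
  series.\<close>

lemma notin_spec_ball:
  assumes "w \<notin> spec a" "norm (z - w) * norm (resolvent a w) < 1"
  shows "z \<notin> spec a"
proof -
  have "norm (- cscale (z - w) (resolvent a w)) < 1"
    using assms(2) by (simp add: norm_cscale)
  then have "ba_invertible (1 + cscale (z - w) (resolvent a w))"
    using ba_invertible_1_minus by fastforce
  moreover have "ba_invertible (cscale w 1 - a)"
    using assms(1) by (simp add: spec_def)
  ultimately have "ba_invertible ((cscale w 1 - a) * (1 + cscale (z - w) (resolvent a w)))"
    by (intro ba_invertible_mult)
  also have "(cscale w 1 - a) * (1 + cscale (z - w) (resolvent a w)) = cscale z 1 - a"
    by (simp only: distrib_left cscale_mult_right resolvent_right[OF assms(1)] mult_1_right)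
      (simp add: cscale.diff_left)
  finally show ?thesis by (simp add: spec_def)
qed

lemma closed_spec: "closed (spec a)"
proof -
  have "open (- spec a)"
    unfolding open_contains_ball
  proof
    fix w assume w: "w \<in> - spec a"
    \<comment> \<open>The summand 1 keeps the denominator positive whatever the resolvent
      is.\<close>
    define e where "e = 1 / (norm (resolvent a w) + 1)"
    have e: "e > 0" by (simp add: e_def add_nonneg_pos)
    have "z \<notin> spec a" if "dist w z < e" for z
    proof (rule notin_spec_ball)
      have "norm (z - w) * norm (resolvent a w) \<le> norm (z - w) * (norm (resolvent a w) + 1)"
        by (simp add: mult_left_mono)
      also have "\<dots> < e * (norm (resolvent a w) + 1)"
        using that by (intro mult_strict_right_mono) (simp_all add: dist_norm norm_minus_commute add_nonneg_pos)
      also have "\<dots> = 1"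
        using add_nonneg_pos[OF norm_ge_zero zero_less_one, of "resolvent a w"] by (simp add: e_def)
      finally show "norm (z - w) * norm (resolvent a w) < 1" .
    qed (use w in auto)
    then show "\<exists>e>0. ball w e \<subseteq> - spec a" using e by force
  qed
  then show ?thesis by (simp add: closed_def)
qed

lemma compact_spec: "compact (spec a)"
  unfolding compact_eq_bounded_closed bounded_iff using closed_spec spec_norm_le by blast

lemma resolvent_continuous_on: "continuous_on (- spec a) (resolvent a)"
  and resolvent_has_derivative:
    "z \<notin> spec a \<Longrightarrow>
      (resolvent a has_derivative (\<lambda>h. cscale h (- (resolvent a z * resolvent a z)))) (at z)"
proof -
  \<comment> \<open>A bound that improves itself: once \<open>|w - z|\<close> times the norm at
    \<open>z\<close> is below 1/2, the resolvent identity bounds the norm at \<open>w\<close> by the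
    norm at \<open>z\<close> plus half of itself.\<close>
  have bound: "\<forall>\<^sub>F w in nhds z. w \<notin> spec a \<and> norm (resolvent a w) \<le> 2 * norm (resolvent a z)"
    if z: "z \<notin> spec a" for z
  proof -
    have "\<forall>\<^sub>F w in nhds z. w \<in> - spec a"
      using z closed_spec[of a] by (intro eventually_nhds_in_open) auto
    moreover have "((\<lambda>w. norm (w - z) * norm (resolvent a z)) \<longlongrightarrow> norm (z - z) * norm (resolvent a z)) (nhds z)"
      by (intro tendsto_intros filterlim_ident)
    then have "\<forall>\<^sub>F w in nhds z. norm (w - z) * norm (resolvent a z) < 1/2"
      by (rule order_tendstoD) simp
    ultimately show ?thesis
    proof eventually_elim
      case (elim w)
      have "resolvent a w = resolvent a z + cscale (z - w) (resolvent a w * resolvent a z)"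
        using resolvent_identity[of w a z] elim z by (simp add: diff_eq_eq add.commute)
      then have "norm (resolvent a w) \<le> norm (resolvent a z) + norm (cscale (z - w) (resolvent a w * resolvent a z))"
        by (metis norm_triangle_ineq)
      also have "norm (cscale (z - w) (resolvent a w * resolvent a z)) \<le> norm (z - w) * (norm (resolvent a w) * norm (resolvent a z))"
        unfolding norm_cscale by (intro mult_left_mono norm_mult_ineq) simp
      also have "\<dots> = norm (resolvent a w) * (norm (w - z) * norm (resolvent a z))"
        by (simp add: norm_minus_commute)
      also have "\<dots> \<le> norm (resolvent a w) * (1/2)"
        using elim by (intro mult_left_mono) auto
      finally show ?case using elim by simp
    qed
  qed
  have cont: "isCont (resolvent a) z" if z: "z \<notin> spec a" for z
  proof -
    have "((\<lambda>w. norm (z - w) * (2 * norm (resolvent a z) * norm (resolvent a z))) \<longlongrightarrow>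
        norm (z - z) * (2 * norm (resolvent a z) * norm (resolvent a z))) (at z)"
      by (intro tendsto_intros)
    then have lim: "((\<lambda>w. norm (z - w) * (2 * norm (resolvent a z) * norm (resolvent a z))) \<longlongrightarrow> 0) (at z)"
      by simp
    have "\<forall>\<^sub>F w in at z. norm (resolvent a w - resolvent a z)
        \<le> norm (z - w) * (2 * norm (resolvent a z) * norm (resolvent a z))"
      using bound[OF z] unfolding eventually_at_filter
    proof eventually_elim
      case (elim w)
      have "norm (resolvent a w - resolvent a z) = norm (z - w) * norm (resolvent a w * resolvent a z)"
        using resolvent_identity[of w a z] elim z by (simp add: norm_cscale)
      also have "norm (resolvent a w * resolvent a z) \<le> norm (resolvent a w) * norm (resolvent a z)"
        by (rule norm_mult_ineq)
      also have "norm (resolvent a w) * norm (resolvent a z) \<le> 2 * norm (resolvent a z) * norm (resolvent a z)"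
        using elim by (intro mult_right_mono) auto
      finally show ?case by (simp add: mult_left_mono)
    qed
    from Lim_null_comparison[OF this lim] show ?thesis
      unfolding isCont_def using LIM_zero_cancel by blast
  qed
  then show "continuous_on (- spec a) (resolvent a)"
    by (simp add: continuous_at_imp_continuous_on)
  show "(resolvent a has_derivative (\<lambda>h. cscale h (- (resolvent a z * resolvent a z)))) (at z)"
    if z: "z \<notin> spec a" for z
  proof (rule has_derivativeI)
    show "bounded_linear (\<lambda>h. cscale h (- (resolvent a z * resolvent a z)))"
      by (rule cscale.bounded_linear_left)
    have "isCont (\<lambda>w. norm ((resolvent a w - resolvent a z) * resolvent a z)) z"
      using cont[OF z] by (intro continuous_intros)
    then have lim: "((\<lambda>w. norm ((resolvent a w - resolvent a z) * resolvent a z)) \<longlongrightarrow> 0) (at z)"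
      by (simp add: isCont_def)
    have "\<forall>\<^sub>F w in at z. (resolvent a w - resolvent a z - cscale (w - z) (- (resolvent a z * resolvent a z)))
      = cscale (z - w) ((resolvent a w - resolvent a z) * resolvent a z)"
      using bound[OF z] unfolding eventually_at_filter
    proof eventually_elim
      case (elim w)
      have "resolvent a w - resolvent a z = cscale (z - w) (resolvent a w * resolvent a z)"
        using resolvent_identity[of w a z] elim z by simp
      then have "resolvent a w - resolvent a z - cscale (w - z) (- (resolvent a z * resolvent a z))
          = cscale (z - w) (resolvent a w * resolvent a z) - cscale (z - w) (resolvent a z * resolvent a z)"
        by (simp add: cscale.minus_right cscale.diff_left)
      also have "\<dots> = cscale (z - w) ((resolvent a w - resolvent a z) * resolvent a z)"
        by (simp only: left_diff_distrib cscale.diff_right)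
      finally show ?case by simp
    qed
    then have ev: "\<forall>\<^sub>F w in at z. norm ((resolvent a w - resolvent a z - cscale (w - z) (- (resolvent a z * resolvent a z))) /\<^sub>R norm (w - z))
      \<le> norm ((resolvent a w - resolvent a z) * resolvent a z)"
    proof eventually_elim
      case (elim w)
      show ?case unfolding elim by (simp add: norm_cscale divide_simps norm_minus_commute)
    qed
    show "((\<lambda>w. (resolvent a w - resolvent a z - cscale (w - z) (- (resolvent a z * resolvent a z))) /\<^sub>R norm (w - z)) \<longlongrightarrow> 0) (at z)"
      by (rule Lim_null_comparison[OF ev lim])
  qed
qed

text \<open>Provides the decay at infinity that \<open>grid_chain_exists\<close> asks for. Beyond
  \<open>2 * norm a\<close> the term \<open>a * R\<close> in \<open>z R = 1 + a R\<close> can be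
  absorbed, which gives \<open>norm R \<le> 2 / norm z\<close>; the same equation then bounds the
  difference.\<close>

lemma resolvent_asymp:
  assumes "norm z > 2 * norm a" 
  shows "norm (resolvent a z - cscale (1/z) 1) \<le> 2 * norm a / (norm z)\<^sup>2"
proof -
  have n: "norm z > norm a" "norm z > 0" "z \<noteq> 0"
    using assms norm_ge_zero[of a] by (linarith, linarith, auto)
  then have z: "z \<notin> spec a" using spec_norm_le by force
  let ?R = "resolvent a z"
  have eq: "cscale z ?R = 1 + a * ?R" using resolvent_mult(1)[OF z] by simp
  have "norm z * norm ?R = norm (1 + a * ?R)"
    using eq by (metis norm_cscale)
  also have "\<dots> \<le> 1 + norm (a * ?R)"
    using norm_triangle_ineq[of 1 "a * ?R"] by simp
  also have "norm (a * ?R) \<le> norm a * norm ?R" by (rule norm_mult_ineq)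
  also have "norm a * norm ?R \<le> (norm z / 2) * norm ?R"
    using assms by (intro mult_right_mono) auto
  finally have R: "norm ?R \<le> 2 / norm z" using n by (simp add: field_simps)
  have "?R - cscale (1/z) 1 = cscale (1/z) (cscale z ?R - 1)"
    using n by (simp add: cscale.diff_right cscale_cscale)
  also have "\<dots> = cscale (1/z) (a * ?R)" using eq by simp
  finally have "norm (?R - cscale (1/z) 1) = norm (a * ?R) / norm z"
    by (simp add: norm_cscale norm_divide)
  also have "\<dots> \<le> norm a * norm ?R / norm z"
    using n by (intro divide_right_mono norm_mult_ineq) auto
  also have "\<dots> \<le> norm a * (2 / norm z) / norm z"
    using R n by (intro divide_right_mono mult_left_mono) auto
  finally show ?thesis by (simp add: power2_eq_square field_simps)
qed


text \<open>The derivative is multiplication by an element of the algebra, which encodes complex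
  differentiability. Its continuity is included because primitives are found by differentiating
  under the integral sign.\<close>

definition C1_holo :: "complex set \<Rightarrow> (complex \<Rightarrow> 'a::complex_banach_algebra) \<Rightarrow> bool" where
  "C1_holo S F \<longleftrightarrow>
     (\<exists>F'. continuous_on S F' \<and> (\<forall>z\<in>S. (F has_derivative (\<lambda>h. cscale h (F' z))) (at z)))"

lemma C1_holo_subset: "C1_holo T F \<Longrightarrow> S \<subseteq> T \<Longrightarrow> C1_holo S F"
  unfolding C1_holo_def by (meson continuous_on_subset subsetD)

lemma C1_holo_continuous_on: "C1_holo S F \<Longrightarrow> continuous_on S F"
  unfolding C1_holo_def
  by (metis continuous_at_imp_continuous_on has_derivative_continuous)

lemma C1_holo_const: "C1_holo S (\<lambda>z. x)"
  unfolding C1_holo_def by (rule exI[of _ "\<lambda>_. 0"]) (simp add: cscale.zero_right)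

lemma C1_holo_resolvent: "S \<inter> spec a = {} \<Longrightarrow> C1_holo S (resolvent a)"
  unfolding C1_holo_def
  using resolvent_has_derivative
  by (intro exI[of _ "\<lambda>z. - (resolvent a z * resolvent a z)"])
    (auto intro!: continuous_intros continuous_on_subset[OF resolvent_continuous_on])

lemma C1_holo_cscale:
  assumes f: "f holomorphic_on S" and S: "open S" and F: "C1_holo S F"
  shows "C1_holo S (\<lambda>z. cscale (f z) (F z))"
proof -
  obtain F' where F': "continuous_on S F'"
    "\<And>z. z \<in> S \<Longrightarrow> (F has_derivative (\<lambda>h. cscale h (F' z))) (at z)"
    using F unfolding C1_holo_def by auto
  show ?thesis
    unfolding C1_holo_def
  proof (intro exI[of _ "\<lambda>z. cscale (f z) (F' z) + cscale (deriv f z) (F z)"] conjI ballI)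
    show "continuous_on S (\<lambda>z. cscale (f z) (F' z) + cscale (deriv f z) (F z))"
      by (intro continuous_intros F'(1) C1_holo_continuous_on[OF F]
          holomorphic_on_imp_continuous_on[OF f] holomorphic_on_imp_continuous_on[OF holomorphic_deriv[OF f S]])
    fix z assume z: "z \<in> S"
    have "(f has_derivative (*) (deriv f z)) (at z)"
      using holomorphic_derivI[OF f S z] by (simp add: has_field_derivative_def)
    from cscale.FDERIV[OF this F'(2)[OF z]]
    show "((\<lambda>z. cscale (f z) (F z)) has_derivative
        (\<lambda>h. cscale h (cscale (f z) (F' z) + cscale (deriv f z) (F z)))) (at z)"
      by (rule has_derivative_eq_rhs) (simp add: fun_eq_iff cscale_cscale cscale_add_right mult.commute)
  qed
qed

text \<open>\<open>P\<close> integrates \<open>F\<close> along the segment from a base point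
  \<open>c\<close>. Differentiation under the integral gives multiplication by the integral of
  \<open>G x t\<close> over \<open>t\<close>; since \<open>G x t\<close> is the
  \<open>t\<close>-derivative of \<open>t * F (c + t * (x - c))\<close>, this integral is
  \<open>F x\<close>.\<close>

lemma C1_holo_primitive:
  assumes F: "C1_holo S F" and S: "open S" "convex S"
  obtains P where "\<And>z. z \<in> S \<Longrightarrow> (P has_derivative (\<lambda>h. cscale h (F z))) (at z)"
proof (cases "S = {}")
  case False
  then obtain c where c: "c \<in> S" by auto
  obtain F' where F': "continuous_on S F'"
    "\<And>z. z \<in> S \<Longrightarrow> (F has_derivative (\<lambda>h. cscale h (F' z))) (at z)"
    using F unfolding C1_holo_def by auto
  have cF: "continuous_on S F" using F by (rule C1_holo_continuous_on)
  let ?l = "\<lambda>x t. c + of_real t * (x - c)"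
  have l: "?l x t \<in> S" if "x \<in> S" "t \<in> cbox 0 1" for x and t :: real
  proof -
    have "(1 - t) *\<^sub>R c + t *\<^sub>R x \<in> S"
      using that c S(2) by (intro convexD) auto
    then show ?thesis by (simp add: scaleR_conv_of_real algebra_simps)
  qed
  define G where "G x t = F (?l x t) + cscale (of_real t * (x - c)) (F' (?l x t))" for x t
  define P where "P x = integral (cbox 0 1) (\<lambda>t. cscale (x - c) (F (?l x t)))" for x
  have contG: "continuous_on (S \<times> cbox 0 1) (\<lambda>(x, t). G x t)"
    unfolding G_def split_beta
    by (intro continuous_intros continuous_on_compose2[OF cF] continuous_on_compose2[OF F'(1)])
      (use l in auto)
  have contGx: "continuous_on (cbox 0 1) (G x)" if "x \<in> S" for x
    unfolding G_def using that
    by (intro continuous_intros continuous_on_compose2[OF cF] continuous_on_compose2[OF F'(1)])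
      (use l in auto)
  have int: "(G x has_integral F x) (cbox 0 1)" if x: "x \<in> S" for x
  proof -
    have "(G x has_integral (1 *\<^sub>R F (?l x 1) - 0 *\<^sub>R F (?l x 0))) {0..1}"
    proof (rule fundamental_theorem_of_calculus)
      fix t :: real assume t: "t \<in> {0..1}"
      have "((\<lambda>t. ?l x t) has_vector_derivative (x - c)) (at t within {0..1})"
        by (auto intro!: derivative_eq_intros simp: has_vector_derivative_def scaleR_conv_of_real)
      then have d: "((\<lambda>t. ?l x t) has_derivative (\<lambda>h. h *\<^sub>R (x - c))) (at t within {0..1})"
        by (simp add: has_vector_derivative_def)
      have "((\<lambda>t. F (?l x t)) has_derivative (\<lambda>h. cscale (h *\<^sub>R (x - c)) (F' (?l x t)))) (at t within {0..1})"
        by (rule has_derivative_compose[OF d]) (use F'(2) l x t in auto)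
      then have d2: "((\<lambda>t. F (?l x t)) has_vector_derivative cscale (x - c) (F' (?l x t))) (at t within {0..1})"
        by (simp add: has_vector_derivative_def cscale_scaleR_left)
      have d1: "((\<lambda>t. t) has_real_derivative 1) (at t within {0..1})"
        by (rule DERIV_ident)
      have e: "of_real t * (x - c) = t *\<^sub>R (x - c)" by (simp add: scaleR_conv_of_real)
      show "((\<lambda>t. t *\<^sub>R F (?l x t)) has_vector_derivative G x t) (at t within {0..1})"
        using has_vector_derivative_scaleR[OF d1 d2]
        unfolding G_def e cscale_scaleR_left by (simp add: add.commute)
    qed simp
    then show ?thesis by simp
  qed
  have "(P has_derivative (\<lambda>h. cscale h (F x0))) (at x0)" if x0: "x0 \<in> S" for x0
  proof -
    have "(P has_derivative integral (cbox 0 1) (\<lambda>t. cscale.prod_left (G x0 t))) (at x0 within S)"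
      unfolding P_def
    proof (rule leibniz_rule[where U = S])
      fix x t assume x: "x \<in> S" and t: "t \<in> cbox 0 (1::real)"
      have d: "((\<lambda>x. ?l x t) has_derivative (\<lambda>h. of_real t * h)) (at x within S)"
        by (auto intro!: derivative_eq_intros)
      have "((\<lambda>x. F (?l x t)) has_derivative (\<lambda>h. cscale (of_real t * h) (F' (?l x t)))) (at x within S)"
        by (rule has_derivative_compose[OF d]) (use F'(2) l x t in auto)
      moreover have "((\<lambda>x. x - c) has_derivative (\<lambda>h. h)) (at x within S)"
        by (auto intro!: derivative_eq_intros)
      ultimately have "((\<lambda>x. cscale (x - c) (F (?l x t))) has_derivative
         (\<lambda>h. cscale (x - c) (cscale (of_real t * h) (F' (?l x t))) + cscale h (F (?l x t)))) (at x within S)"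
        using cscale.FDERIV by blast
      then show "((\<lambda>x. cscale (x - c) (F (?l x t))) has_derivative cscale.prod_left (G x t)) (at x within S)"
        by (rule has_derivative_eq_rhs)
          (simp add: fun_eq_iff G_def cscale_cscale cscale_add_right mult_ac)
    next
      fix x assume "x \<in> S"
      then show "(\<lambda>t. cscale (x - c) (F (?l x t))) integrable_on cbox 0 1"
        by (intro integrable_continuous continuous_intros continuous_on_compose2[OF cF])
          (use l in auto)
    next
      show "continuous_on (S \<times> cbox 0 1) (\<lambda>(x, t). cscale.prod_left (G x t))"
        using bounded_linear.continuous_on[OF cscale.bounded_linear_prod_left contG]
        by (simp add: split_beta)
    qed (use x0 S in auto)
    also have "integral (cbox 0 1) (\<lambda>t. cscale.prod_left (G x0 t)) = cscale.prod_left (integral (cbox 0 1) (G x0))"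
      using integral_linear[OF _ cscale.bounded_linear_prod_left, of "G x0"] int[OF x0]
      by (auto simp: o_def)
    also have "integral (cbox 0 1) (G x0) = F x0"
      using int[OF x0] by (rule integral_unique)
    finally show ?thesis
      using x0 S by (simp add: at_within_open[OF x0 S(1)])
  qed
  then show ?thesis using that by blast
qed (use that in blast)

section \<open>Integrals over segments and polygonal chains\<close>

definition seg_integral :: "(complex \<Rightarrow> 'a::complex_banach_algebra) \<Rightarrow> complex \<times> complex \<Rightarrow> 'a" where
  "seg_integral F e = integral {0..1} (\<lambda>t. cscale (snd e - fst e) (F (linepath (fst e) (snd e) t)))"

abbreviation segment_of :: "complex \<times> complex \<Rightarrow> complex set" where
  "segment_of e \<equiv> closed_segment (fst e) (snd e)"

text \<open>Lists of oriented edges, not closed paths: edges can be cancelled and regrouped freely,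
  and being a cycle is expressed by the values of integrals or by a balance of endpoints.\<close>

definition chain_integral :: "(complex \<Rightarrow> 'a::complex_banach_algebra) \<Rightarrow> (complex \<times> complex) list \<Rightarrow> 'a" where
  "chain_integral F E = (\<Sum>e\<leftarrow>E. seg_integral F e)"

definition chain_image :: "(complex \<times> complex) list \<Rightarrow> complex set" where
  "chain_image E = (\<Union>e\<in>set E. segment_of e)"

lemma compact_chain_image: "compact (chain_image E)"
  unfolding chain_image_def by (intro compact_UN) auto

lemma continuous_on_linepath_compose:
  assumes "continuous_on (closed_segment p q) F"
  shows "continuous_on {0..1} (\<lambda>t. F (linepath p q t))"
  using assms
  by (intro continuous_on_compose2[OF assms] continuous_intros) (auto simp: linepath_in_path)

lemma seg_has_integral:
  assumes "continuous_on (segment_of e) F"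
  shows "((\<lambda>t. cscale (snd e - fst e) (F (linepath (fst e) (snd e) t))) has_integral seg_integral F e) {0..1}"
  unfolding seg_integral_def
  by (intro integrable_integral integrable_continuous_interval continuous_intros
      continuous_on_linepath_compose assms)

text \<open>The derivative of a \<open>valid_path\<close> may be unbounded near its exceptional
  points. The fundamental theorem with a finite exceptional set yields integrability and the value
  at once.\<close>

lemma path_primitive_has_integral:
  fixes P F :: "complex \<Rightarrow> 'a::complex_banach_algebra"
  assumes P: "\<And>z. z \<in> S \<Longrightarrow> (P has_derivative (\<lambda>h. cscale h (F z))) (at z)"
    and g: "continuous_on {a..b} g" "g ` {a..b} \<subseteq> S" "finite D" "a \<le> b"
    and g': "\<And>t. t \<in> {a<..<b} - D \<Longrightarrow> (g has_vector_derivative g' t) (at t)"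
  shows "((\<lambda>t. cscale (g' t) (F (g t))) has_integral (P (g b) - P (g a))) {a..b}"
proof (rule fundamental_theorem_of_calculus_interior_strong[OF g(3,4)])
  fix t assume t: "t \<in> {a<..<b} - D"
  have "(g has_derivative (\<lambda>h. h *\<^sub>R g' t)) (at t)"
    using g'[OF t] by (simp add: has_vector_derivative_def)
  from has_derivative_compose[OF this, of P "\<lambda>h. cscale h (F (g t))"]
  have "((\<lambda>t. P (g t)) has_derivative (\<lambda>h. cscale (h *\<^sub>R g' t) (F (g t)))) (at t)"
    using P[of "g t"] g(2) t by (simp add: image_subset_iff)
  then show "((\<lambda>t. P (g t)) has_vector_derivative cscale (g' t) (F (g t))) (at t)"
    by (simp add: has_vector_derivative_def cscale_scaleR_left)
next
  have "continuous_on S P"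
    using P by (meson continuous_at_imp_continuous_on has_derivative_continuous)
  then show "continuous_on {a..b} (\<lambda>t. P (g t))"
    using g(1,2) by (rule continuous_on_compose2)
qed

lemma seg_integral_primitive:
  assumes P: "\<And>z. z \<in> S \<Longrightarrow> (P has_derivative (\<lambda>h. cscale h (F z))) (at z)"
    and e: "segment_of e \<subseteq> S"
  shows "seg_integral F e = P (snd e) - P (fst e)"
proof -
  have "((\<lambda>t. cscale (snd e - fst e) (F (linepath (fst e) (snd e) t))) has_integral
      (P (linepath (fst e) (snd e) 1) - P (linepath (fst e) (snd e) 0))) {0..1}"
    by (rule path_primitive_has_integral[OF P, of S _ _ _ "{}"])
      (use e in \<open>auto simp: linepath_in_path intro!: has_vector_derivative_linepath_within\<close>)
  then show ?thesis
    unfolding seg_integral_def by (simp add: integral_unique linepath_1' linepath_0')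
qed

text \<open>Valid even for functions without an integral, as both sides then take the same default
  value. Thus reversing a segment changes the sign of \<open>seg_integral\<close> for every
  \<open>F\<close>, also on grid edges where \<open>F\<close> is singular.\<close>

lemma integral_reflect_unit:
  fixes f :: "real \<Rightarrow> 'b::real_normed_vector"
  shows "integral {0..1} (\<lambda>t. f (1 - t)) = integral {0..1} f"
proof -
  have "((\<lambda>t. f (1 - t)) has_integral i) {0..1}" if "(f has_integral i) {0..1}"
    for f :: "real \<Rightarrow> 'b" and i
  proof -
    have "((\<lambda>t. f (- t)) has_integral i) {-1..0}"
      using that has_integral_reflect_real[where f = f and i = i and a = 0 and b = 1] by simp
    from has_integral_shift_real_ivl[OF this, of "-1"] show ?thesis by simp
  qed
  from this[of f] this[of "\<lambda>t. f (1 - t)"]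
  have "((\<lambda>t. f (1 - t)) has_integral i) {0..1} \<longleftrightarrow> (f has_integral i) {0..1}" for i
    by auto
  then show ?thesis unfolding integral_def integrable_on_def by simp
qed

lemma seg_integral_reverse: "seg_integral F (q, p) = - seg_integral F (p, q)"
proof -
  have "seg_integral F (q, p) = integral {0..1} (\<lambda>t. - cscale (q - p) (F (linepath p q (1 - t))))"
    unfolding seg_integral_def by (simp add: linepath_def algebra_simps cscale.diff_left)
  also have "\<dots> = - integral {0..1} (\<lambda>t. cscale (q - p) (F (linepath p q (1 - t))))"
    by (rule integral_neg)
  also have "integral {0..1} (\<lambda>t. cscale (q - p) (F (linepath p q (1 - t)))) = seg_integral F (p, q)"
    using integral_reflect_unit[of "\<lambda>t. cscale (q - p) (F (linepath p q t))"]
    unfolding seg_integral_def by simp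
  finally show ?thesis .
qed

section \<open>Paths and polygons\<close>

lemma alg_contour_integral_cscale:
  assumes "f contour_integrable_on g"
  shows "alg_contour_integral (\<lambda>z. cscale (f z) x) g = cscale (contour_integral g f) x"
proof -
  have "((\<lambda>t. f (g t) * vector_derivative g (at t within {0..1})) has_integral contour_integral g f) {0..1}"
    using has_contour_integral_integral[OF assms] by (simp add: has_contour_integral_def)
  from has_integral_linear[OF this cscale.bounded_linear_left]
  show ?thesis
    unfolding alg_contour_integral_def
    by (intro integral_unique) (simp add: o_def cscale_cscale mult.commute)
qed

lemma seg_integral_cscale:
  assumes "continuous_on (segment_of e) f"
  shows "seg_integral (\<lambda>z. cscale (f z) x) e = cscale (contour_integral (linepath (fst e) (snd e)) f) x"
proof -
  have "f contour_integrable_on linepath (fst e) (snd e)"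
    using assms by (rule contour_integrable_continuous_linepath)
  then have "((\<lambda>t. f (linepath (fst e) (snd e) t) * (snd e - fst e)) has_integral
      contour_integral (linepath (fst e) (snd e)) f) {0..1}"
    using has_contour_integral_integral has_contour_integral_linepath by blast
  from has_integral_linear[OF this cscale.bounded_linear_left]
  show ?thesis
    unfolding seg_integral_def
    by (intro integral_unique) (simp add: o_def cscale_cscale mult.commute)
qed

text \<open>Uniform continuity cuts the path into pieces that stay, with their chords, in balls
  inside \<open>S\<close>. A primitive on the ball gives piece and chord the same integral. The
  balls depend on \<open>g\<close> and \<open>S\<close> alone, so one polygon serves all
  \<open>F\<close>.\<close>

lemma path_polygon:
  assumes S: "open S" and g: "valid_path g" "path_image g \<subseteq> S"
  obtains E where "chain_image E \<subseteq> S"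
    "\<And>F::complex \<Rightarrow> 'a::complex_banach_algebra. C1_holo S F \<Longrightarrow> alg_contour_integral F g = chain_integral F E"
proof -
  have cont: "continuous_on {0..1} g"
    using valid_path_imp_path[OF g(1)] by (simp add: path_def)
  obtain D where D: "finite D" "g C1_differentiable_on ({0..1} - D)"
    using g(1) unfolding valid_path_def piecewise_C1_differentiable_on_def by auto
  obtain e where e: "e > 0" "(\<Union>x\<in>path_image g. ball x e) \<subseteq> S"
    using compact_subset_open_imp_ball_epsilon_subset[OF _ S g(2)]
      compact_path_image[OF valid_path_imp_path[OF g(1)]] by metis
  have "uniformly_continuous_on {0..1} g"
    using cont by (simp add: compact_uniformly_continuous)
  then obtain d where d: "d > 0" "\<And>s t. s \<in> {0..1} \<Longrightarrow> t \<in> {0..1} \<Longrightarrow> dist s t < d \<Longrightarrow> dist (g s) (g t) < e"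
    unfolding uniformly_continuous_on_def using e(1) by metis
  obtain n where n: "n > 0" "1 / real n < d"
    using d(1) by (metis nat_approx_posE zero_less_Suc)
  define c where "c i = real i / real n" for i
  have c01: "c i \<in> {0..1}" if "i \<le> n" for i using that n by (simp add: c_def)
  have c_le: "c i \<le> c (Suc i)" for i using n by (simp add: c_def divide_right_mono)
  have c_diff: "c (Suc i) - c i = 1 / real n" for i by (simp add: c_def diff_divide_distrib[symmetric])
  have gball: "g t \<in> ball (g (c i)) e" if "i < n" "t \<in> {c i..c (Suc i)}" for i t
  proof -
    have "dist (c i) t < d" using that(2) c_diff[of i] n(2) by (simp add: dist_real_def)
    moreover have "t \<in> {0..1}" using that c01[of i] c01[of "Suc i"] by simp
    ultimately show ?thesis using d(2)[of "c i" t] c01[of i] that by simp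
  qed
  have ballS: "ball (g (c i)) e \<subseteq> S" if "i < n" for i
    using e(2) imageI[OF c01[of i], of g] that unfolding path_image_def by (meson UN_least UN_subset_iff less_imp_le)
  define E where "E = map (\<lambda>i. (g (c i), g (c (Suc i)))) [0..<n]"
  have seg: "closed_segment (g (c i)) (g (c (Suc i))) \<subseteq> ball (g (c i)) e" if "i < n" for i
    using gball[OF that] c_le[of i] e(1) by (intro closed_segment_subset) auto
  have "chain_image E \<subseteq> S"
    unfolding chain_image_def E_def using seg ballS by fastforce
  moreover have "alg_contour_integral F g = chain_integral F E" if F: "C1_holo S F" for F :: "complex \<Rightarrow> 'a"
  proof -
    let ?f = "\<lambda>t. cscale (vector_derivative g (at t within {0..1})) (F (g t))"
    have piece: "(?f has_integral seg_integral F (g (c i), g (c (Suc i)))) {c i..c (Suc i)}" if i: "i < n" for i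
    proof -
      obtain P where P: "\<And>z. z \<in> ball (g (c i)) e \<Longrightarrow> (P has_derivative (\<lambda>h. cscale h (F z))) (at z)"
        using C1_holo_primitive[OF C1_holo_subset[OF F ballS[OF i]]] by auto
      have sub: "{c i..c (Suc i)} \<subseteq> {0..1}"
        using c01[of i] c01[of "Suc i"] i by auto
      have "(?f has_integral (P (g (c (Suc i))) - P (g (c i)))) {c i..c (Suc i)}"
      proof (rule path_primitive_has_integral[where S = "ball (g (c i)) e", OF P])
        fix t assume t: "t \<in> {c i<..<c (Suc i)} - D"
        then have "t \<in> {0<..<1}" using c01[of i] c01[of "Suc i"] i by auto
        then have int: "at t within {0..1} = at t" by (auto intro: at_within_Icc_at)
        have "g differentiable at t"
          using D(2) t \<open>t \<in> {0<..<1}\<close> by (auto simp: C1_differentiable_on_eq)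
        then show "(g has_vector_derivative vector_derivative g (at t within {0..1})) (at t)"
          unfolding int by (simp add: vector_derivative_works)
      qed (use D(1) c_le continuous_on_subset[OF cont sub] gball[OF i] in auto)
      moreover have "seg_integral F (g (c i), g (c (Suc i))) = P (g (c (Suc i))) - P (g (c i))"
        by (subst seg_integral_primitive[where S = "ball (g (c i)) e", OF P]) (use seg[OF i] in auto)
      ultimately show ?thesis by simp
    qed
    have "(?f has_integral (\<Sum>i<k. seg_integral F (g (c i), g (c (Suc i))))) {0..c k}" if "k \<le> n" for k
      using that
    proof (induction k)
      case 0
      then show ?case using has_integral_refl(2)[of ?f 0] by (simp add: c_def)
    next
      case (Suc k)
      have "0 \<le> c k" by (simp add: c_def)
      have "k \<le> n" "k < n" using Suc.prems by auto
      show ?case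
        using has_integral_combine[OF \<open>0 \<le> c k\<close> c_le Suc.IH[OF \<open>k \<le> n\<close>] piece[OF \<open>k < n\<close>]] by simp
    qed
    from this[of n] have "(?f has_integral (\<Sum>i<n. seg_integral F (g (c i), g (c (Suc i))))) {0..1}"
      using n by (simp add: c_def)
    moreover have "chain_integral F E = (\<Sum>i<n. seg_integral F (g (c i), g (c (Suc i))))"
      unfolding chain_integral_def E_def
      by (simp add: o_def interv_sum_list_conv_sum_set_nat atLeast0LessThan)
    ultimately show ?thesis
      unfolding alg_contour_integral_def by (simp add: integral_unique)
  qed
  ultimately show ?thesis using that by blast
qed

lemma chain_integral_append: "chain_integral F (E @ E') = chain_integral F E + chain_integral F E'"
  by (simp add: chain_integral_def)

lemma chain_image_append: "chain_image (E @ E') = chain_image E \<union> chain_image E'"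
  by (simp add: chain_image_def)

lemma paths_polygon:
  assumes S: "open S" and G: "\<forall>g\<in>set G. valid_path g \<and> path_image g \<subseteq> S"
  obtains E where "chain_image E \<subseteq> S"
    "\<And>F::complex \<Rightarrow> 'a::complex_banach_algebra.
       C1_holo S F \<Longrightarrow> (\<Sum>g\<leftarrow>G. alg_contour_integral F g) = chain_integral F E"
  using G
proof (induction G arbitrary: thesis)
  case Nil
  show ?case
    by (rule Nil.prems(1)[of "[]"]) (simp_all add: chain_image_def chain_integral_def)
next
  case (Cons g G)
  obtain E where E: "chain_image E \<subseteq> S"
    "\<And>F::complex \<Rightarrow> 'a. C1_holo S F \<Longrightarrow> (\<Sum>g\<leftarrow>G. alg_contour_integral F g) = chain_integral F E"
    using Cons.IH Cons.prems(2) by auto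
  have "valid_path g" "path_image g \<subseteq> S" using Cons.prems(2) by auto
  then obtain E' where E': "chain_image E' \<subseteq> S"
    "\<And>F::complex \<Rightarrow> 'a. C1_holo S F \<Longrightarrow> alg_contour_integral F g = chain_integral F E'"
    using path_polygon[OF S, where 'a = 'a] by blast
  show ?case
    by (rule Cons.prems(1)[of "E' @ E"])
      (use E E' in \<open>auto simp: chain_integral_append chain_image_append\<close>)
qed

text \<open>As for Euler circuits: if the first path is not closed, balance provides another one
  that starts where it ends; joining the two keeps the balance and all integrals and shortens the
  list.\<close>

lemma balanced_paths_imp_closed_paths:
  fixes G :: "(real \<Rightarrow> complex) list"
  assumes "\<forall>g\<in>set G. valid_path g \<and> path_image g \<subseteq> S"
    and "mset (map pathstart G) = mset (map pathfinish G)"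
  shows "\<exists>G'. (\<forall>g\<in>set G'. valid_path g \<and> pathfinish g = pathstart g \<and> path_image g \<subseteq> S) \<and>
    (\<forall>f. (\<forall>g\<in>set G. f contour_integrable_on g) \<longrightarrow>
       (\<forall>g\<in>set G'. f contour_integrable_on g) \<and>
       (\<Sum>g\<leftarrow>G'. contour_integral g f) = (\<Sum>g\<leftarrow>G. contour_integral g f))"
    (is "\<exists>G'. ?C G' \<and> ?I G G'")
  using assms
proof (induction "length G" arbitrary: G rule: less_induct)
  case less
  show ?case
  proof (cases G)
    case Nil
    then show ?thesis by (intro exI[of _ "[]"]) simp
  next
    case (Cons g H)
    have g: "valid_path g" "path_image g \<subseteq> S" using less.prems(1) Cons by auto
    show ?thesis
    proof (cases "pathfinish g = pathstart g")
      case True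
      then have "mset (map pathstart H) = mset (map pathfinish H)"
        using less.prems(2) Cons by simp
      then obtain H' where H': "?C H'" "?I H H'"
        using less.hyps[of H] less.prems(1) Cons by auto
      show ?thesis
        by (intro exI[of _ "g # H'"]) (use H' True g Cons in auto)
    next
      case False
      have "pathfinish g \<in># mset (map pathstart G)"
        unfolding less.prems(2) using Cons by simp
      then obtain h where h: "h \<in> set H" "pathstart h = pathfinish g"
        using False Cons by auto
      define H1 where "H1 = remove1 h H"
      have mH: "mset H = add_mset h (mset H1)" using h by (simp add: H1_def)
      have setH1: "set H = insert h (set H1)" using mH by (metis set_mset_add_mset_insert set_mset_mset)
      have hv: "valid_path h" "path_image h \<subseteq> S" using less.prems(1) Cons h by auto
      have len: "length ((g +++ h) # H1) < length G"
        using h Cons by (simp add: H1_def length_remove1) (metis Suc_pred length_pos_if_in_set lessI)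
      have mm: "mset (map f H) = add_mset (f h) (mset (map f H1))" for f :: "_ \<Rightarrow> complex"
        using mH by (metis image_mset_add_mset mset_map)
      have bal: "mset (map pathstart ((g +++ h) # H1)) = mset (map pathfinish ((g +++ h) # H1))"
        using less.prems(2) Cons h mm[of pathstart] mm[of pathfinish] by simp
      have val: "\<forall>k\<in>set ((g +++ h) # H1). valid_path k \<and> path_image k \<subseteq> S"
        using less.prems(1) Cons setH1 g hv h(2) path_image_join_subset[of g h]
        by (auto intro: valid_path_join)
      obtain G' where G': "?C G'" "?I ((g +++ h) # H1) G'"
        using less.hyps[OF len val bal] by auto
      have "?I G G'"
      proof (intro allI impI)
        fix f assume f: "\<forall>k\<in>set G. f contour_integrable_on k"
        then have fg: "f contour_integrable_on g" "f contour_integrable_on h"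
          "\<forall>k\<in>set H1. f contour_integrable_on k"
          using Cons setH1 by auto
        have "(\<Sum>k\<leftarrow>H. contour_integral k f) = contour_integral h f + (\<Sum>k\<leftarrow>H1. contour_integral k f)"
          using h by (simp add: H1_def sum_list_map_remove1)
        then have "(\<Sum>k\<leftarrow>((g +++ h) # H1). contour_integral k f) = (\<Sum>k\<leftarrow>G. contour_integral k f)"
          using Cons contour_integral_join[OF fg(1,2) g(1) hv(1)] by simp
        moreover have "\<forall>k\<in>set ((g +++ h) # H1). f contour_integrable_on k"
          using fg contour_integrable_joinI[OF fg(1,2) g(1) hv(1)] by simp
        ultimately show "(\<forall>k\<in>set G'. f contour_integrable_on k) \<and>
            (\<Sum>k\<leftarrow>G'. contour_integral k f) = (\<Sum>k\<leftarrow>G. contour_integral k f)"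
          using G'(2) by metis
      qed
      then show ?thesis using G'(1) by blast
    qed
  qed
qed

text \<open>Indicator functions of single points, taken as \<open>\<phi>\<close>, count edge ends
  minus edge starts there. In this form the balance of a grid chain is itself an antisymmetric edge
  sum, to which \<open>grid_chain_sum\<close> applies.\<close>

lemma balanced_mset_eq:
  fixes E :: "(complex \<times> complex) list"
  assumes "\<And>\<phi>::complex \<Rightarrow> int. (\<Sum>e\<leftarrow>E. \<phi> (snd e) - \<phi> (fst e)) = 0"
  shows "mset (map fst E) = mset (map snd E)"
proof (rule multiset_eqI)
  fix v
  have c: "int (count (mset (map g E)) v) = (\<Sum>e\<leftarrow>E. (if g e = v then 1 else 0))"
    for g :: "complex \<times> complex \<Rightarrow> complex"
    by (induction E) auto
  have "(\<Sum>e\<leftarrow>E. (if snd e = v then 1 else 0) - (if fst e = v then 1 else 0)) = (0::int)"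
    using assms[of "\<lambda>z. if z = v then 1 else 0"] .
  then have "int (count (mset (map snd E)) v) - int (count (mset (map fst E)) v) = 0"
    unfolding c by (simp add: sum_list_subtractf)
  then show "count (mset (map fst E)) v = count (mset (map snd E)) v" by simp
qed

section \<open>Grid contours\<close>

text \<open>Meant for edge weights: \<open>X p\<close> and \<open>X (s p)\<close> belong to opposite
  edges of the square \<open>p\<close>, and the hypotheses say that \<open>S\<close> contains each
  square with an edge of nonzero weight.\<close>

lemma sum_shift_support:
  fixes X :: "'i \<Rightarrow> 'b::comm_monoid_add"
  assumes "finite S" "bij s" "\<And>p. X p \<noteq> 0 \<Longrightarrow> p \<in> S" "\<And>p. X (s p) \<noteq> 0 \<Longrightarrow> p \<in> S"
  shows "(\<Sum>p\<in>S. X (s p)) = (\<Sum>p\<in>S. X p)"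
proof -
  have "(\<Sum>p\<in>S. X (s p)) = (\<Sum>p\<in>s ` S. X p)"
    using assms(2) by (subst sum.reindex) (auto intro: inj_on_subset[OF bij_is_inj])
  also have "\<dots> = (\<Sum>p\<in>{p. X p \<noteq> 0}. X p)"
  proof (rule sum.mono_neutral_right)
    show "{p. X p \<noteq> 0} \<subseteq> s ` S"
    proof
      fix q assume "q \<in> {p. X p \<noteq> 0}"
      moreover obtain p where "q = s p" using assms(2) by (metis bij_pointE)
      ultimately show "q \<in> s ` S" using assms(4)[of p] by auto
    qed
  qed (use assms(1) in auto)
  also have "\<dots> = (\<Sum>p\<in>S. X p)"
    using assms(1,3) by (intro sum.mono_neutral_left) auto
  finally show ?thesis .
qed

lemma sum_int_telescope:
  fixes g :: "int \<Rightarrow> 'b::ab_group_add"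
  shows "(\<Sum>j\<in>{a..<a + int n}. g (j + 1) - g j) = g (a + int n) - g a"
proof (induction n)
  case (Suc n)
  have "{a..<a + int (Suc n)} = insert (a + int n) {a..<a + int n}" by auto
  then show ?case using Suc by (simp add: algebra_simps)
qed simp

section \<open>Grid squares and sums of edge weights\<close>

definition grid_vertex :: "real \<Rightarrow> int \<Rightarrow> int \<Rightarrow> complex" where
  "grid_vertex d i j = Complex (d * of_int i) (d * of_int j)"

definition grid_square :: "real \<Rightarrow> int \<times> int \<Rightarrow> complex set" where
  "grid_square d p = cbox (grid_vertex d (fst p) (snd p)) (grid_vertex d (fst p + 1) (snd p + 1))"

definition hor_edge :: "real \<Rightarrow> int \<times> int \<Rightarrow> complex \<times> complex" where
  "hor_edge d p = (grid_vertex d (fst p) (snd p), grid_vertex d (fst p + 1) (snd p))"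

definition ver_edge :: "real \<Rightarrow> int \<times> int \<Rightarrow> complex \<times> complex" where
  "ver_edge d p = (grid_vertex d (fst p) (snd p), grid_vertex d (fst p) (snd p + 1))"

text \<open>Counterclockwise. The top and left edges are reversals, so that adjacent squares share
  the same edge up to \<open>prod.swap\<close>.\<close>

definition grid_boundary :: "real \<Rightarrow> int \<times> int \<Rightarrow> (complex \<times> complex) list" where
  "grid_boundary d p = [hor_edge d p, ver_edge d (fst p + 1, snd p),
     prod.swap (hor_edge d (fst p, snd p + 1)), prod.swap (ver_edge d p)]"

text \<open>Cochains on oriented edges. Cancellation is proved at this generality because it is
  applied to segment integrals, to their cut-offs and differences, and to
  \<open>\<phi> (snd e) - \<phi> (fst e)\<close>.\<close>

definition antisym_edge :: "(complex \<times> complex \<Rightarrow> 'b::ab_group_add) \<Rightarrow> bool" where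
  "antisym_edge w \<longleftrightarrow> (\<forall>p q. w (q, p) = - w (p, q))"

lemma antisym_edge_swap: "antisym_edge w \<Longrightarrow> w (prod.swap e) = - w e"
  unfolding antisym_edge_def by (metis swap_simp surj_pair)

lemma antisym_edge_if:
  assumes w: "antisym_edge w" and P: "\<And>e. P (prod.swap e) \<longleftrightarrow> P e"
  shows "antisym_edge (\<lambda>e. if P e then w e else 0)"
  unfolding antisym_edge_def
proof (intro allI)
  fix p q
  have "w (q, p) = - w (p, q)" "P (q, p) = P (p, q)"
    using antisym_edge_swap[OF w, of "(p, q)"] P[of "(p, q)"] by simp_all
  then show "(if P (q, p) then w (q, p) else 0) = - (if P (p, q) then w (p, q) else 0)"
    by simp
qed

lemma grid_boundary_sum:
  assumes "antisym_edge w"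
  shows "(\<Sum>e\<leftarrow>grid_boundary d p. w e) =
    (w (hor_edge d p) - w (hor_edge d (fst p, snd p + 1))) +
    (w (ver_edge d (fst p + 1, snd p)) - w (ver_edge d p))"
  by (simp add: grid_boundary_def antisym_edge_swap[OF assms] algebra_simps)

lemma grid_boundary_segment:
  assumes "d > 0" "e \<in> set (grid_boundary d p)"
  shows "segment_of e \<subseteq> grid_square d p"
  unfolding grid_square_def
  by (rule closed_segment_subset)
    (use assms in \<open>auto simp: grid_boundary_def hor_edge_def ver_edge_def grid_vertex_def in_cbox_complex_iff mult_left_mono\<close>)

text \<open>The sum of the square and a small ball is convex, open and still inside
  \<open>T\<close>, so \<open>F\<close> has a primitive there and the boundary sum
  telescopes.\<close>

lemma square_Cauchy:
  fixes F :: "complex \<Rightarrow> 'a::complex_banach_algebra"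
  assumes F: "C1_holo T F" and T: "open T" and sq: "grid_square d p \<subseteq> T" and d: "d > 0"
  shows "(\<Sum>e\<leftarrow>grid_boundary d p. seg_integral F e) = 0"
proof -
  have cpt: "compact (grid_square d p)" by (simp add: grid_square_def)
  obtain \<epsilon> where \<epsilon>: "\<epsilon> > 0" "(\<Union>x\<in>grid_square d p. ball x \<epsilon>) \<subseteq> T"
    using compact_subset_open_imp_ball_epsilon_subset[OF cpt T sq] by blast
  define V where "V = (\<Union>x\<in>grid_square d p. \<Union>y\<in>ball 0 \<epsilon>. {x + y})"
  have V: "open V" "convex V"
    unfolding V_def by (auto intro!: open_sums convex_sums simp: grid_square_def)
  have VT: "V \<subseteq> T"
  proof
    fix z assume "z \<in> V"
    then obtain x y where "x \<in> grid_square d p" "norm y < \<epsilon>" "z = x + y"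
      unfolding V_def by auto
    moreover then have "z \<in> ball x \<epsilon>" by (simp add: dist_norm)
    ultimately show "z \<in> T" using \<epsilon>(2) by blast
  qed
  have sqV: "grid_square d p \<subseteq> V" unfolding V_def using \<epsilon>(1) by force
  obtain P where P: "\<And>z. z \<in> V \<Longrightarrow> (P has_derivative (\<lambda>h. cscale h (F z))) (at z)"
    using C1_holo_primitive[OF C1_holo_subset[OF F VT] V] by blast
  have "seg_integral F e = P (snd e) - P (fst e)" if "e \<in> set (grid_boundary d p)" for e
    using seg_integral_primitive[where S = V, OF P, of e] grid_boundary_segment[OF d that] sqV by blast
  then have "(\<Sum>e\<leftarrow>grid_boundary d p. seg_integral F e) = (\<Sum>e\<leftarrow>grid_boundary d p. P (snd e) - P (fst e))"
    by (intro arg_cong[of _ _ sum_list] map_cong) auto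
  also have "\<dots> = 0"
    by (simp add: grid_boundary_def hor_edge_def ver_edge_def)
  finally show ?thesis .
qed

definition grid_chain :: "real \<Rightarrow> complex set \<Rightarrow> (int \<times> int) list \<Rightarrow> (complex \<times> complex) list" where
  "grid_chain d K L = filter (\<lambda>e. segment_of e \<inter> K = {}) (concat (map (grid_boundary d) L))"

lemma sum_list_concat_map: "(\<Sum>e\<leftarrow>concat (map g L). w e) = (\<Sum>p\<leftarrow>L. \<Sum>e\<leftarrow>g p. w e)"
  by (induction L) auto

text \<open>An edge meeting \<open>K\<close> bounds two squares meeting \<open>K\<close>, hence occurs in both directions;
  removing all such edges does not change the sum.\<close>

lemma grid_chain_sum:
  fixes w :: "complex \<times> complex \<Rightarrow> 'b::ab_group_add"
  assumes w: "antisym_edge w" and d: "d > 0"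
    and L: "distinct L" "set L = {p. grid_square d p \<inter> K \<noteq> {}}"
  shows "(\<Sum>e\<leftarrow>grid_chain d K L. w e) = (\<Sum>p\<in>set L. \<Sum>e\<leftarrow>grid_boundary d p. w e)"
proof -
  define u where "u e = (if segment_of e \<inter> K \<noteq> {} then w e else 0)" for e
  have u: "antisym_edge u"
    unfolding u_def by (rule antisym_edge_if[OF w]) (simp add: closed_segment_commute)
  have sub: "p \<in> set L" if "e \<in> set (grid_boundary d p)" "u e \<noteq> 0" for e p
    using grid_boundary_segment[OF d that(1)] that(2) unfolding L(2) by (auto simp: u_def split: if_splits)
  have u_swap: "u (prod.swap e) \<noteq> 0" if "u e \<noteq> 0" for e
    using that by (simp add: antisym_edge_swap[OF u])
  have mem: "u (hor_edge d p) \<noteq> 0 \<Longrightarrow> p \<in> set L"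
    "u (hor_edge d (fst p, snd p + 1)) \<noteq> 0 \<Longrightarrow> p \<in> set L"
    "u (ver_edge d p) \<noteq> 0 \<Longrightarrow> p \<in> set L"
    "u (ver_edge d (fst p + 1, snd p)) \<noteq> 0 \<Longrightarrow> p \<in> set L" for p
    using sub[of _ p] u_swap unfolding grid_boundary_def by (meson list.set_intros)+
  have split: "(\<Sum>e\<leftarrow>M. w e) = (\<Sum>e\<leftarrow>filter (\<lambda>e. segment_of e \<inter> K = {}) M. w e) + (\<Sum>e\<leftarrow>M. u e)" for M
    by (induction M) (auto simp: u_def algebra_simps)
  have dist: "(\<Sum>p\<leftarrow>L. h p) = (\<Sum>p\<in>set L. h p)" for h :: "_ \<Rightarrow> 'b"
    using L(1) by (simp add: sum_list_distinct_conv_sum_set)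
  have bij: "bij (\<lambda>p::int \<times> int. (fst p, snd p + 1))" "bij (\<lambda>p::int \<times> int. (fst p + 1, snd p))"
    by (rule bij_betw_byWitness[of _ "\<lambda>p. (fst p, snd p - 1)"]; force)
      (rule bij_betw_byWitness[of _ "\<lambda>p. (fst p - 1, snd p)"]; force)
  have "(\<Sum>e\<leftarrow>concat (map (grid_boundary d) L). u e) = (\<Sum>p\<in>set L. \<Sum>e\<leftarrow>grid_boundary d p. u e)"
    by (simp only: sum_list_concat_map dist)
  also have "\<dots> = ((\<Sum>p\<in>set L. u (hor_edge d p)) - (\<Sum>p\<in>set L. u (hor_edge d (fst p, snd p + 1)))) +
      ((\<Sum>p\<in>set L. u (ver_edge d (fst p + 1, snd p))) - (\<Sum>p\<in>set L. u (ver_edge d p)))"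
    by (simp only: grid_boundary_sum[OF u] sum.distrib sum_subtractf)
  also have "(\<Sum>p\<in>set L. u (hor_edge d (fst p, snd p + 1))) = (\<Sum>p\<in>set L. u (hor_edge d p))"
    by (rule sum_shift_support[where X = "\<lambda>p. u (hor_edge d p)", OF _ bij(1)])
      (use mem in auto)
  also have "(\<Sum>p\<in>set L. u (ver_edge d (fst p + 1, snd p))) = (\<Sum>p\<in>set L. u (ver_edge d p))"
    by (rule sum_shift_support[where X = "\<lambda>p. u (ver_edge d p)", OF _ bij(2)])
      (use mem in auto)
  finally have "(\<Sum>e\<leftarrow>concat (map (grid_boundary d) L). u e) = 0" by simp
  then have "(\<Sum>e\<leftarrow>grid_chain d K L. w e) = (\<Sum>e\<leftarrow>concat (map (grid_boundary d) L). w e)"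
    using split[of "concat (map (grid_boundary d) L)"] by (simp add: grid_chain_def)
  then show ?thesis by (simp only: sum_list_concat_map dist)
qed

text \<open>Half-open index ranges, because a square is named by its lower left corner: the squares
  fill the box of half-width \<open>N * d\<close> around 0.\<close>

definition grid_box :: "nat \<Rightarrow> (int \<times> int) set" where
  "grid_box N = {- int N..<int N} \<times> {- int N..<int N}"

text \<open>Horizontal edges telescope along columns and vertical edges along rows, which leaves the
  four sides of the box.\<close>

lemma grid_box_sum:
  fixes w :: "complex \<times> complex \<Rightarrow> 'b::ab_group_add"
  assumes w: "antisym_edge w"
  shows "(\<Sum>p\<in>grid_box N. \<Sum>e\<leftarrow>grid_boundary d p. w e) =
    (\<Sum>i\<in>{- int N..<int N}. w (hor_edge d (i, - int N)) - w (hor_edge d (i, int N))) +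
    (\<Sum>j\<in>{- int N..<int N}. w (ver_edge d (int N, j)) - w (ver_edge d (- int N, j)))"
proof -
  let ?I = "{- int N..<int N}"
  have tele: "(\<Sum>j\<in>?I. g (j + 1) - g j) = g (int N) - g (- int N)" for g :: "int \<Rightarrow> 'b"
    using sum_int_telescope[of g "- int N" "2 * N"] by simp
  have "(\<Sum>p\<in>grid_box N. \<Sum>e\<leftarrow>grid_boundary d p. w e) =
    (\<Sum>p\<in>?I \<times> ?I. w (hor_edge d p) - w (hor_edge d (fst p, snd p + 1))) +
    (\<Sum>p\<in>?I \<times> ?I. w (ver_edge d (fst p + 1, snd p)) - w (ver_edge d p))"
    unfolding grid_box_def by (simp only: grid_boundary_sum[OF w] sum.distrib)
  also have "(\<Sum>p\<in>?I \<times> ?I. w (hor_edge d p) - w (hor_edge d (fst p, snd p + 1))) =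
      (\<Sum>i\<in>?I. \<Sum>j\<in>?I. w (hor_edge d (i, j)) - w (hor_edge d (i, j + 1)))"
    by (simp add: sum.cartesian_product case_prod_beta)
  also have "\<dots> = (\<Sum>i\<in>?I. w (hor_edge d (i, - int N)) - w (hor_edge d (i, int N)))"
  proof (rule sum.cong[OF refl])
    fix i
    have "(\<Sum>j\<in>?I. w (hor_edge d (i, j)) - w (hor_edge d (i, j + 1))) =
        (\<Sum>j\<in>?I. - w (hor_edge d (i, j + 1)) - - w (hor_edge d (i, j)))"
      by simp
    also have "\<dots> = w (hor_edge d (i, - int N)) - w (hor_edge d (i, int N))"
      using tele[of "\<lambda>j. - w (hor_edge d (i, j))"] by simp
    finally show "(\<Sum>j\<in>?I. w (hor_edge d (i, j)) - w (hor_edge d (i, j + 1))) =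
        w (hor_edge d (i, - int N)) - w (hor_edge d (i, int N))" .
  qed
  also have "(\<Sum>p\<in>?I \<times> ?I. w (ver_edge d (fst p + 1, snd p)) - w (ver_edge d p)) =
      (\<Sum>i\<in>?I. \<Sum>j\<in>?I. w (ver_edge d (i + 1, j)) - w (ver_edge d (i, j)))"
    by (simp add: sum.cartesian_product case_prod_beta)
  also have "\<dots> = (\<Sum>j\<in>?I. \<Sum>i\<in>?I. w (ver_edge d (i + 1, j)) - w (ver_edge d (i, j)))"
    by (rule sum.swap)
  also have "\<dots> = (\<Sum>j\<in>?I. w (ver_edge d (int N, j)) - w (ver_edge d (- int N, j)))"
    by (rule sum.cong[OF refl]) (rule tele)
  finally show ?thesis .
qed

text \<open>Four sides of \<open>2 * N\<close> edges each.\<close>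

lemma grid_box_sum_norm:
  fixes w :: "complex \<times> complex \<Rightarrow> 'b::real_normed_vector"
  assumes w: "antisym_edge w"
    and h: "\<And>i. norm (w (hor_edge d (i, - int N))) \<le> c" "\<And>i. norm (w (hor_edge d (i, int N))) \<le> c"
    and v: "\<And>i. norm (w (ver_edge d (- int N, i))) \<le> c" "\<And>i. norm (w (ver_edge d (int N, i))) \<le> c"
  shows "norm (\<Sum>p\<in>grid_box N. \<Sum>e\<leftarrow>grid_boundary d p. w e) \<le> 8 * real N * c"
proof -
  have "norm (\<Sum>i\<in>{- int N..<int N}. w (hor_edge d (i, - int N)) - w (hor_edge d (i, int N)))
      \<le> (\<Sum>i\<in>{- int N..<int N}. 2 * c)"
    by (rule sum_norm_le) (use h norm_triangle_ineq4 in \<open>smt (verit)\<close>)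
  moreover have "norm (\<Sum>i\<in>{- int N..<int N}. w (ver_edge d (int N, i)) - w (ver_edge d (- int N, i)))
      \<le> (\<Sum>i\<in>{- int N..<int N}. 2 * c)"
    by (rule sum_norm_le) (use v norm_triangle_ineq4 in \<open>smt (verit)\<close>)
  ultimately show ?thesis
    unfolding grid_box_sum[OF w] by (intro order_trans[OF norm_triangle_ineq]) simp
qed

lemma antisym_edge_seg_integral: "antisym_edge (seg_integral F)"
  unfolding antisym_edge_def using seg_integral_reverse by blast

lemma seg_integral_bound:
  assumes "continuous_on (segment_of e) F" "\<And>z. z \<in> segment_of e \<Longrightarrow> norm (F z) \<le> B"
  shows "norm (seg_integral F e) \<le> norm (snd e - fst e) * B"
proof -
  have "norm (integral {0..1} (\<lambda>t. cscale (snd e - fst e) (F (linepath (fst e) (snd e) t))))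
      \<le> norm (snd e - fst e) * B * (1 - 0)"
    using assms
    by (intro integral_bound continuous_intros continuous_on_linepath_compose)
      (auto simp: norm_cscale linepath_in_path intro!: mult_left_mono)
  then show ?thesis by (simp add: seg_integral_def)
qed

lemma seg_integral_diff:
  assumes "continuous_on (segment_of e) F" "continuous_on (segment_of e) G"
  shows "seg_integral (\<lambda>z. F z - G z) e = seg_integral F e - seg_integral G e"
  using has_integral_diff[OF seg_has_integral[OF assms(1)] seg_has_integral[OF assms(2)]]
  unfolding seg_integral_def[of "\<lambda>z. F z - G z"]
  by (intro integral_unique) (simp add: cscale.diff_right)

lemma antisym_edge_diff:
  assumes "antisym_edge w" "antisym_edge u"
  shows "antisym_edge (\<lambda>e. w e - u e)"
  unfolding antisym_edge_def
proof (intro allI)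
  fix p q
  have "w (q, p) = - w (p, q)" "u (q, p) = - u (p, q)"
    using assms unfolding antisym_edge_def by blast+
  then show "w (q, p) - u (q, p) = - (w (p, q) - u (p, q))" by simp
qed

lemma hor_edge_Im: "z \<in> segment_of (hor_edge d p) \<Longrightarrow> Im z = d * of_int (snd p)"
  by (auto simp: hor_edge_def grid_vertex_def in_segment left_diff_distrib)

lemma ver_edge_Re: "z \<in> segment_of (ver_edge d p) \<Longrightarrow> Re z = d * of_int (fst p)"
  by (auto simp: ver_edge_def grid_vertex_def in_segment left_diff_distrib)

lemma edge_length:
  assumes "d > 0"
  shows "norm (snd (hor_edge d p) - fst (hor_edge d p)) = d"
    "norm (snd (ver_edge d p) - fst (ver_edge d p)) = d"
  using assms by (simp_all add: hor_edge_def ver_edge_def grid_vertex_def cmod_def distrib_left)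

text \<open>The value comes from the winding number of \<open>rectpath\<close>. The pole is the
  centre of a square, so no grid edge passes through it: 1/2 is not an integer.\<close>

lemma square_pole_sum:
  assumes d: "d > 0"
  shows "(\<Sum>e\<leftarrow>grid_boundary d (0, 0). seg_integral (\<lambda>z. cscale (1 / (z - Complex (d/2) (d/2))) x) e)
    = cscale (2 * pi * \<i>) x"
proof -
  define z0 where "z0 = Complex (d/2) (d/2)"
  define f where "f z = 1 / (z - z0)" for z
  define a1 a2 a3 a4 where a: "a1 = Complex 0 0" "a2 = Complex d 0" "a3 = Complex d d" "a4 = Complex 0 d"
  have b: "grid_boundary d (0, 0) = [(a1, a2), (a2, a3), (a3, a4), (a4, a1)]"
    by (simp add: grid_boundary_def hor_edge_def ver_edge_def grid_vertex_def a)
  have z0box: "z0 \<in> box a1 a3" using d by (simp add: in_box_complex_iff a z0_def)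
  have le: "Re a1 \<le> Re a3" "Im a1 \<le> Im a3" using d by (simp_all add: a)
  have odd: "d / 2 \<noteq> d * real_of_int k" for k
  proof
    assume "d / 2 = d * real_of_int k"
    then have "real_of_int (k * 2) = real_of_int 1" using d by (simp add: field_simps)
    then show False unfolding of_int_eq_iff by presburger
  qed
  have "z0 \<notin> segment_of (hor_edge d p)" "z0 \<notin> segment_of (ver_edge d p)" for p
    using odd hor_edge_Im[of z0 d p] ver_edge_Re[of z0 d p] by (auto simp: z0_def)
  then have notin: "z0 \<notin> segment_of e" if "e \<in> set (grid_boundary d (0, 0))" for e
    using that by (auto simp: grid_boundary_def closed_segment_commute)
  have cont: "continuous_on (segment_of e) f" if "e \<in> set (grid_boundary d (0, 0))" for e
    unfolding f_def using notin[OF that] by (intro continuous_intros) auto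
  then have int: "f contour_integrable_on linepath (fst e) (snd e)" if "e \<in> set (grid_boundary d (0, 0))" for e
    using that by (intro contour_integrable_continuous_linepath)
  have rp: "rectpath a1 a3 = linepath a1 a2 +++ linepath a2 a3 +++ linepath a3 a4 +++ linepath a4 a1"
    by (simp add: rectpath_def Let_def a)
  have "contour_integral (rectpath a1 a3) f = 2 * pi * \<i>"
  proof -
    have "z0 \<notin> path_image (rectpath a1 a3)"
      using z0box path_image_rectpath_cbox_minus_box[OF le] by simp
    then have "winding_number (rectpath a1 a3) z0 = 1 / (2 * pi * \<i>) * contour_integral (rectpath a1 a3) f"
      unfolding f_def by (intro winding_number_valid_path valid_path_rectpath)
    then show ?thesis
      using winding_number_rectpath[OF z0box] by (simp add: field_simps)
  qed
  also have "contour_integral (rectpath a1 a3) f =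
      (\<Sum>e\<leftarrow>grid_boundary d (0, 0). contour_integral (linepath (fst e) (snd e)) f)"
    using int[of "(a1, a2)"] int[of "(a2, a3)"] int[of "(a3, a4)"] int[of "(a4, a1)"]
    unfolding rp b by (simp add: contour_integrable_joinI valid_path_join)
  finally have "(\<Sum>e\<leftarrow>grid_boundary d (0, 0). contour_integral (linepath (fst e) (snd e)) f) = 2 * pi * \<i>" .
  moreover have "(\<Sum>e\<leftarrow>grid_boundary d (0, 0). seg_integral (\<lambda>z. cscale (f z) x) e) =
      (\<Sum>e\<leftarrow>grid_boundary d (0, 0). cscale (contour_integral (linepath (fst e) (snd e)) f) x)"
    using seg_integral_cscale[OF cont] by (intro arg_cong[of _ _ sum_list] map_cong) auto
  moreover have "\<dots> = cscale (\<Sum>e\<leftarrow>grid_boundary d (0, 0). contour_integral (linepath (fst e) (snd e)) f) x"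
    unfolding b by (simp add: cscale_add_left)
  ultimately show ?thesis by (simp add: f_def z0_def)
qed

lemma pole_box_sum:
  assumes d: "d > 0" and N: "N > 0"
  shows "(\<Sum>p\<in>grid_box N. \<Sum>e\<leftarrow>grid_boundary d p.
      seg_integral (\<lambda>z. cscale (1 / (z - Complex (d/2) (d/2))) x) e) = cscale (2 * pi * \<i>) x"
    (is "(\<Sum>p\<in>_. ?s p) = _")
proof -
  let ?z0 = "Complex (d/2) (d/2)"
  have "?s p = 0" if "p \<noteq> (0, 0)" for p
  proof (rule square_Cauchy[where T = "- {?z0}"])
    show "C1_holo (- {?z0}) (\<lambda>z. cscale (1 / (z - ?z0)) x)"
      by (intro C1_holo_cscale C1_holo_const holomorphic_intros) auto
    show "grid_square d p \<subseteq> - {?z0}"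
    proof -
      have "?z0 \<notin> grid_square d p"
      proof
        assume "?z0 \<in> grid_square d p"
        then have "d * of_int (fst p) \<le> d * (1/2)" "d * (1/2) \<le> d * (of_int (fst p) + 1)"
          "d * of_int (snd p) \<le> d * (1/2)" "d * (1/2) \<le> d * (of_int (snd p) + 1)"
          by (simp_all add: grid_square_def grid_vertex_def in_cbox_complex_iff)
        then have "of_int (fst p) \<le> (1/2::real)" "(1/2::real) \<le> of_int (fst p) + 1"
          "of_int (snd p) \<le> (1/2::real)" "(1/2::real) \<le> of_int (snd p) + 1"
          using d by (simp_all only: mult_le_cancel_left_pos)
        then have "fst p = 0" "snd p = 0" by linarith+
        then show False using that by (simp add: prod_eq_iff)
      qed
      then show ?thesis by auto
    qed
  qed (use d in auto)
  then have "(\<Sum>p\<in>grid_box N. ?s p) = (\<Sum>p\<in>{(0, 0)}. ?s p)"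
    using N by (intro sum.mono_neutral_right) (auto simp: grid_box_def)
  then show ?thesis using square_pole_sum[OF d, of x] by simp
qed

text \<open>On the sides of the \<open>N\<close>-th box, \<open>F\<close> differs from the model
  \<open>1 / (z - z0)\<close> times \<open>x\<close> by a term of order \<open>1 / N^2\<close>, and
  the perimeter is of order \<open>N\<close>. So the box sums differ by a term of order
  \<open>1 / N\<close>; as neither depends on \<open>N\<close>, they are equal. Edges meeting
  \<open>K\<close> get weight 0, which keeps the weights antisymmetric, and inner edges cancel
  anyway.\<close>

lemma box_sum_limit:
  fixes F :: "complex \<Rightarrow> 'a::complex_banach_algebra"
  assumes d: "d > 0" and K: "bounded K" and F: "C1_holo (- K) F"
    and asymp: "\<forall>\<^sub>F z in at_infinity. norm (F z - cscale (1 / z) x) \<le> C / (norm z)\<^sup>2"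
    and J: "\<And>N. N \<ge> N0 \<Longrightarrow> (\<Sum>p\<in>grid_box N. \<Sum>e\<leftarrow>grid_boundary d p.
        if segment_of e \<inter> K = {} then seg_integral F e else 0) = J"
  shows "J = cscale (2 * pi * \<i>) x"
proof -
  define z0 where "z0 = Complex (d/2) (d/2)"
  define w where "w e = (if segment_of e \<inter> K = {} then seg_integral F e else 0)" for e
  define u where "u = seg_integral (\<lambda>z. cscale (1 / (z - z0)) x)"
  have anti: "antisym_edge (\<lambda>e. w e - u e)"
  proof -
    have "antisym_edge w" unfolding w_def
      by (rule antisym_edge_if[OF antisym_edge_seg_integral]) (simp add: closed_segment_commute)
    moreover have "antisym_edge u" unfolding u_def by (rule antisym_edge_seg_integral)
    ultimately show ?thesis
      by (rule antisym_edge_diff)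
  qed
  obtain R1 where R1: "\<And>z. norm z \<ge> R1 \<Longrightarrow> norm (F z - cscale (1 / z) x) \<le> C / (norm z)\<^sup>2"
    using asymp unfolding eventually_at_infinity by auto
  obtain R2 where R2: "\<And>z. z \<in> K \<Longrightarrow> norm z \<le> R2"
    using K unfolding bounded_iff by auto
  \<comment> \<open>Beyond \<open>R\<close> the decay bound holds, \<open>K\<close> is left behind,
    and \<open>norm (z - z0) \<ge> norm z / 2\<close>.\<close>
  define R where "R = max (max R1 (R2 + 1)) (max (2 * norm z0) 1)"
  \<comment> \<open>The second summand pays for moving the pole from 0 to \<open>z0\<close>:
    \<open>1 / z\<close> and \<open>1 / (z - z0)\<close> differ by at most
    \<open>2 * norm z0 / (norm z)^2\<close>.\<close>
  define C' where "C' = C + 2 * norm z0 * norm x"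
  have big: "z \<notin> K \<and> z \<noteq> z0 \<and> norm (F z - cscale (1 / (z - z0)) x) \<le> C' / (norm z)\<^sup>2"
    if z: "norm z \<ge> R" for z
  proof -
    have z': "norm z \<ge> R1" "norm z \<ge> R2 + 1" "norm z \<ge> 2 * norm z0" "norm z \<ge> 1"
      using z by (auto simp: R_def)
    have "norm (z - z0) \<ge> norm z - norm z0" by (rule norm_triangle_ineq2)
    then have half: "norm (z - z0) \<ge> norm z / 2" using z' by simp
    have nz: "z \<noteq> 0" "z \<noteq> z0" using z' half by auto
    have "1 / z - 1 / (z - z0) = - z0 / (z * (z - z0))"
      using nz by (simp add: divide_simps)
    then have "norm (1 / z - 1 / (z - z0)) = norm z0 / (norm z * norm (z - z0))"
      by (simp add: norm_divide norm_mult)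
    also have "\<dots> \<le> norm z0 / (norm z * (norm z / 2))"
      using half z' nz by (intro divide_left_mono mult_left_mono) auto
    also have "\<dots> = 2 * norm z0 / (norm z)\<^sup>2" by (simp add: power2_eq_square)
    finally have s: "norm (cscale (1 / z - 1 / (z - z0)) x) \<le> 2 * norm z0 / (norm z)\<^sup>2 * norm x"
      unfolding norm_cscale by (intro mult_right_mono) auto
    have "F z - cscale (1 / (z - z0)) x = (F z - cscale (1 / z) x) + cscale (1 / z - 1 / (z - z0)) x"
      by (simp add: cscale.diff_left)
    then have "norm (F z - cscale (1 / (z - z0)) x)
        \<le> norm (F z - cscale (1 / z) x) + norm (cscale (1 / z - 1 / (z - z0)) x)"
      by (metis norm_triangle_ineq)
    also have "\<dots> \<le> C / (norm z)\<^sup>2 + 2 * norm z0 / (norm z)\<^sup>2 * norm x"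
      using R1[OF z'(1)] s by simp
    also have "\<dots> = C' / (norm z)\<^sup>2" by (simp add: C'_def add_divide_distrib)
    finally show ?thesis using nz R2[of z] z' by auto
  qed
  \<comment> \<open>\<open>C\<close> comes without a sign; the bound \<open>big\<close> at the
    single point \<open>R\<close> forces \<open>C'\<close> to be nonnegative.\<close>
  have C': "C' \<ge> 0"
  proof -
    have "norm (of_real R :: complex) \<ge> R" by simp
    from big[OF this] have "0 \<le> C' / R\<^sup>2" by (metis norm_ge_zero norm_of_real order_trans power2_abs)
    moreover have "R > 0" by (simp add: R_def)
    ultimately show ?thesis by (simp add: zero_le_divide_iff)
  qed
  have edge: "norm (w e - u e) \<le> d * (C' / (real N * d)\<^sup>2)"
    if e: "\<And>z. z \<in> segment_of e \<Longrightarrow> norm z \<ge> real N * d" "norm (snd e - fst e) = d"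
      and N: "real N * d \<ge> R" for e N
  proof -
    have R0: "R > 0" by (simp add: R_def)
    have out: "norm z \<ge> R" if "z \<in> segment_of e" for z
      using e(1)[OF that] N by simp
    have cont: "continuous_on (segment_of e) F"
      using big out by (intro continuous_on_subset[OF C1_holo_continuous_on[OF F]]) auto
    have cont2: "continuous_on (segment_of e) (\<lambda>z. cscale (1 / (z - z0)) x)"
      using big out by (intro continuous_intros) auto
    have "w e - u e = seg_integral (\<lambda>z. F z - cscale (1 / (z - z0)) x) e"
      using seg_integral_diff[OF cont cont2] big out by (auto simp: w_def u_def)
    also have "norm \<dots> \<le> norm (snd e - fst e) * (C' / (real N * d)\<^sup>2)"
    proof (rule seg_integral_bound)
      fix z assume z: "z \<in> segment_of e"
      have "norm (F z - cscale (1 / (z - z0)) x) \<le> C' / (norm z)\<^sup>2"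
        using big[OF out[OF z]] by simp
      also have "\<dots> \<le> C' / (real N * d)\<^sup>2"
      proof (rule divide_left_mono)
        have pos: "0 < real N * d" "0 < norm z" using N R0 e(1)[OF z] by linarith+
        then show "(real N * d)\<^sup>2 \<le> (norm z)\<^sup>2" using e(1)[OF z] by (intro power_mono) auto
        show "0 < (norm z)\<^sup>2 * (real N * d)\<^sup>2"
          by (rule mult_pos_pos; rule zero_less_power; rule pos)
      qed (rule C')
      finally show "norm (F z - cscale (1 / (z - z0)) x) \<le> C' / (real N * d)\<^sup>2" .
    qed (intro continuous_intros cont cont2)
    finally show ?thesis using e(2) by simp
  qed
  have est: "norm (J - cscale (2 * pi * \<i>) x) \<le> (8 * C' / d) * inverse (real N)"
    if N: "N \<ge> N0" "N > 0" "real N * d \<ge> R" for N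
  proof -
    have "J - cscale (2 * pi * \<i>) x = (\<Sum>p\<in>grid_box N. \<Sum>e\<leftarrow>grid_boundary d p. w e - u e)"
      using J[OF N(1)] pole_box_sum[OF d N(2), of x]
      by (simp add: w_def u_def z0_def sum_subtractf sum_list_subtractf)
    also have "norm \<dots> \<le> 8 * real N * (d * (C' / (real N * d)\<^sup>2))"
    proof (rule grid_box_sum_norm[OF anti])
      fix i :: int
      have h: "norm z \<ge> real N * d" if "z \<in> segment_of (hor_edge d (i, j))" "\<bar>j\<bar> = int N" for z j
      proof -
        have "\<bar>Im z\<bar> = d * real N"
          using hor_edge_Im[OF that(1)] that(2) d by (simp add: abs_mult flip: of_int_abs)
        then show ?thesis using abs_Im_le_cmod[of z] by (simp add: mult.commute)
      qed
      have v: "norm z \<ge> real N * d" if "z \<in> segment_of (ver_edge d (j, i))" "\<bar>j\<bar> = int N" for z j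
      proof -
        have "\<bar>Re z\<bar> = d * real N"
          using ver_edge_Re[OF that(1)] that(2) d by (simp add: abs_mult flip: of_int_abs)
        then show ?thesis using abs_Re_le_cmod[of z] by (simp add: mult.commute)
      qed
      show "norm (w (hor_edge d (i, - int N)) - u (hor_edge d (i, - int N))) \<le> d * (C' / (real N * d)\<^sup>2)"
        "norm (w (hor_edge d (i, int N)) - u (hor_edge d (i, int N))) \<le> d * (C' / (real N * d)\<^sup>2)"
        by (rule edge; use h N(3) edge_length[OF d] in force)+
      show "norm (w (ver_edge d (- int N, i)) - u (ver_edge d (- int N, i))) \<le> d * (C' / (real N * d)\<^sup>2)"
        "norm (w (ver_edge d (int N, i)) - u (ver_edge d (int N, i))) \<le> d * (C' / (real N * d)\<^sup>2)"
        by (rule edge; use v N(3) edge_length[OF d] in force)+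
    qed
    also have "\<dots> = (8 * C' / d) * inverse (real N)"
      using d N(2) by (simp add: power2_eq_square field_simps)
    finally show ?thesis .
  qed
  have "\<forall>\<^sub>F N in sequentially. R / d \<le> real N"
    using filterlim_real_sequentially unfolding filterlim_at_top by blast
  then have ev: "\<forall>\<^sub>F N in sequentially. norm (J - cscale (2 * pi * \<i>) x) \<le> (8 * C' / d) * inverse (real N)"
    using eventually_ge_at_top[of N0] eventually_gt_at_top[of 0]
  proof eventually_elim
    case (elim N)
    then show ?case using d by (intro est) (auto simp: field_simps)
  qed
  have "(\<lambda>N. (8 * C' / d) * inverse (real N)) \<longlonglongrightarrow> (8 * C' / d) * 0"
    by (intro tendsto_intros LIMSEQ_inverse_real_of_nat_add tendsto_inverse_0_at_top filterlim_real_sequentially)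
  then have "norm (J - cscale (2 * pi * \<i>) x) \<le> 0"
    using ev by (intro tendsto_lowerbound[where F = sequentially]) auto
  then show ?thesis by simp
qed

text \<open>\<open>E\<close> consists of the boundary edges of the squares meeting \<open>K\<close>,
  without the edges meeting \<open>K\<close>. A function holomorphic on \<open>W\<close> integrates
  to 0 over each of these squares. For a function holomorphic off \<open>K\<close> the squares
  missing \<open>K\<close> contribute 0, so the integral equals the sum over any large box, and
  \<open>box_sum_limit\<close> evaluates it.\<close>

theorem grid_chain_exists:
  fixes K W :: "complex set"
  assumes K: "compact K" and W: "open W" "K \<subseteq> W"
  obtains E where "chain_image E \<subseteq> W - K" "mset (map fst E) = mset (map snd E)"
    "\<And>F::complex \<Rightarrow> 'a::complex_banach_algebra. C1_holo W F \<Longrightarrow> chain_integral F E = 0"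
    "\<And>(F::complex \<Rightarrow> 'a) x C. C1_holo (- K) F \<Longrightarrow>
      \<forall>\<^sub>F z in at_infinity. norm (F z - cscale (1 / z) x) \<le> C / (norm z)\<^sup>2 \<Longrightarrow>
      chain_integral F E = cscale (2 * pi * \<i>) x"
proof -
  obtain \<epsilon> where \<epsilon>: "\<epsilon> > 0" "(\<Union>x\<in>K. ball x \<epsilon>) \<subseteq> W"
    using compact_subset_open_imp_ball_epsilon_subset[OF K W] by blast
  \<comment> \<open>Two points of a square differ by at most \<open>d\<close> in each coordinate,
    hence by at most \<open>2 * d < \<epsilon>\<close>.\<close>
  define d where "d = \<epsilon> / 3"
  have d: "d > 0" using \<epsilon>(1) by (simp add: d_def)
  define S where "S = {p. grid_square d p \<inter> K \<noteq> {}}"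
  have sqW: "grid_square d p \<subseteq> W" if p: "p \<in> S" for p
  proof
    fix z assume z: "z \<in> grid_square d p"
    obtain k where k: "k \<in> grid_square d p" "k \<in> K" using p by (auto simp: S_def)
    have "\<bar>Re (k - z)\<bar> \<le> d" "\<bar>Im (k - z)\<bar> \<le> d"
      using z k(1) by (auto simp: grid_square_def grid_vertex_def in_cbox_complex_iff algebra_simps)
    then have "dist k z < \<epsilon>"
      using cmod_le[of "k - z"] \<epsilon>(1) by (simp add: dist_norm d_def)
    then show "z \<in> W" using \<epsilon>(2) k(2) by force
  qed
  obtain R where R: "\<And>z. z \<in> K \<Longrightarrow> norm z \<le> R"
    using compact_imp_bounded[OF K] unfolding bounded_iff by auto
  \<comment> \<open>The corner index may lie one below the scaled coordinate of a point of the
    square; \<open>+ 2\<close> leaves room for this and for the strict upper bound.\<close>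
  define N0 where "N0 = nat \<lceil>\<bar>R\<bar> / d\<rceil> + 2"
  have SN0: "S \<subseteq> grid_box N0"
  proof
    fix p assume "p \<in> S"
    then obtain k where k: "k \<in> grid_square d p" "k \<in> K" by (auto simp: S_def)
    have "\<bar>Re k\<bar> \<le> \<bar>R\<bar>" "\<bar>Im k\<bar> \<le> \<bar>R\<bar>"
      using R[OF k(2)] abs_Re_le_cmod[of k] abs_Im_le_cmod[of k] by linarith+
    then have Rk: "Re k \<le> \<bar>R\<bar>" "- \<bar>R\<bar> \<le> Re k" "Im k \<le> \<bar>R\<bar>" "- \<bar>R\<bar> \<le> Im k"
      by linarith+
    define t where "t = \<bar>R\<bar> / d"
    have t: "d * t = \<bar>R\<bar>" "d * - t = - \<bar>R\<bar>" using d by (simp_all add: t_def)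
    have "d * of_int (fst p) \<le> Re k" "Re k \<le> d * (of_int (fst p) + 1)"
      "d * of_int (snd p) \<le> Im k" "Im k \<le> d * (of_int (snd p) + 1)"
      using k(1) by (simp_all add: grid_square_def grid_vertex_def in_cbox_complex_iff)
    then have "d * of_int (fst p) \<le> d * t" "d * - t \<le> d * (of_int (fst p) + 1)"
      "d * of_int (snd p) \<le> d * t" "d * - t \<le> d * (of_int (snd p) + 1)"
      unfolding t using Rk by linarith+
    then have "of_int (fst p) \<le> t" "- t \<le> of_int (fst p) + 1" "of_int (snd p) \<le> t" "- t \<le> of_int (snd p) + 1"
      using d by (simp_all only: mult_le_cancel_left_pos)
    moreover have "real N0 \<ge> t + 2" unfolding N0_def t_def[symmetric] by linarith
    ultimately have "fst p < int N0" "- int N0 \<le> fst p" "snd p < int N0" "- int N0 \<le> snd p"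
      by linarith+
    then show "p \<in> grid_box N0" by (simp add: grid_box_def mem_Times_iff)
  qed
  have fin: "finite (grid_box N)" for N by (simp add: grid_box_def)
  have "finite S" using SN0 fin finite_subset by blast
  then obtain L where L: "set L = S" "distinct L" using finite_distinct_list by blast
  define E where "E = grid_chain d K L"
  have E_sum: "(\<Sum>e\<leftarrow>E. w e) = (\<Sum>p\<in>S. \<Sum>e\<leftarrow>grid_boundary d p. w e)"
    if "antisym_edge w" for w :: "_ \<Rightarrow> 'b::ab_group_add"
    using grid_chain_sum[OF that d L(2), of K] L(1) by (simp add: E_def S_def)
  have E_disj: "segment_of e \<inter> K = {}" if "e \<in> set E" for e
    using that by (simp add: E_def grid_chain_def)
  show ?thesis
  proof (rule that[of E])
    show "chain_image E \<subseteq> W - K"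
    proof
      fix z assume "z \<in> chain_image E"
      then obtain e where e: "e \<in> set E" "z \<in> segment_of e" by (auto simp: chain_image_def)
      then obtain p where "p \<in> S" "e \<in> set (grid_boundary d p)"
        using L(1) by (auto simp: E_def grid_chain_def)
      then show "z \<in> W - K"
        using grid_boundary_segment[OF d] sqW E_disj[OF e(1)] e(2) by blast
    qed
    show "mset (map fst E) = mset (map snd E)"
    proof (rule balanced_mset_eq)
      fix \<phi> :: "complex \<Rightarrow> int"
      have "antisym_edge (\<lambda>e. \<phi> (snd e) - \<phi> (fst e))" by (simp add: antisym_edge_def)
      then have "(\<Sum>e\<leftarrow>E. \<phi> (snd e) - \<phi> (fst e)) = (\<Sum>p\<in>S. \<Sum>e\<leftarrow>grid_boundary d p. \<phi> (snd e) - \<phi> (fst e))"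
        by (rule E_sum)
      also have "\<dots> = 0"
        by (rule sum.neutral) (simp add: grid_boundary_def hor_edge_def ver_edge_def)
      finally show "(\<Sum>e\<leftarrow>E. \<phi> (snd e) - \<phi> (fst e)) = 0" .
    qed
  next
    fix F :: "complex \<Rightarrow> 'a" assume F: "C1_holo W F"
    have "chain_integral F E = (\<Sum>p\<in>S. \<Sum>e\<leftarrow>grid_boundary d p. seg_integral F e)"
      unfolding chain_integral_def by (rule E_sum[OF antisym_edge_seg_integral])
    also have "\<dots> = 0"
      using square_Cauchy[OF F W(1) sqW d] by (intro sum.neutral) blast
    finally show "chain_integral F E = 0" .
  next
    fix F :: "complex \<Rightarrow> 'a" and x C
    assume F: "C1_holo (- K) F" and asymp: "\<forall>\<^sub>F z in at_infinity. norm (F z - cscale (1 / z) x) \<le> C / (norm z)\<^sup>2"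
    \<comment> \<open>Agrees with \<open>seg_integral F\<close> on \<open>E\<close>, and has a
      controlled value on the box edges that run through \<open>K\<close>.\<close>
    define w where "w e = (if segment_of e \<inter> K = {} then seg_integral F e else 0)" for e
    have anti: "antisym_edge w" unfolding w_def
      by (rule antisym_edge_if[OF antisym_edge_seg_integral]) (simp add: closed_segment_commute)
    have "chain_integral F E = (\<Sum>e\<leftarrow>E. w e)"
      unfolding chain_integral_def using E_disj
      by (intro arg_cong[of _ _ sum_list] map_cong) (auto simp: w_def)
    also have "\<dots> = (\<Sum>p\<in>S. \<Sum>e\<leftarrow>grid_boundary d p. w e)" by (rule E_sum[OF anti])
    finally have eq: "chain_integral F E = (\<Sum>p\<in>S. \<Sum>e\<leftarrow>grid_boundary d p. w e)" .
    show "chain_integral F E = cscale (2 * pi * \<i>) x"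
    proof (rule box_sum_limit[OF d compact_imp_bounded[OF K] F asymp])
      fix N assume "N0 \<le> N"
      then have "S \<subseteq> grid_box N" using SN0 by (force simp: grid_box_def)
      moreover have "(\<Sum>e\<leftarrow>grid_boundary d p. w e) = 0" if p: "p \<notin> S" for p
      proof -
        have sq: "grid_square d p \<subseteq> - K" using p by (auto simp: S_def)
        have "(\<Sum>e\<leftarrow>grid_boundary d p. w e) = (\<Sum>e\<leftarrow>grid_boundary d p. seg_integral F e)"
        proof (intro arg_cong[of _ _ sum_list] map_cong refl)
          fix e assume "e \<in> set (grid_boundary d p)"
          then have "segment_of e \<inter> K = {}" using grid_boundary_segment[OF d] sq by blast
          then show "w e = seg_integral F e" by (simp add: w_def)
        qed
        also have "\<dots> = 0"
          using square_Cauchy[OF F _ sq d] K by (simp add: compact_imp_closed open_Compl)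
        finally show ?thesis .
      qed
      ultimately show "(\<Sum>p\<in>grid_box N. \<Sum>e\<leftarrow>grid_boundary d p.
          if segment_of e \<inter> K = {} then seg_integral F e else 0) = chain_integral F E"
        unfolding eq w_def[symmetric] by (intro sum.mono_neutral_right fin) auto
    qed
  qed
qed

section \<open>Cauchy's formula for chains\<close>

lemma continuous_on_resolvent [continuous_intros]:
  assumes "continuous_on S f" "\<And>x. x \<in> S \<Longrightarrow> f x \<notin> spec a"
  shows "continuous_on S (\<lambda>x. resolvent a (f x))"
  by (rule continuous_on_compose2[OF resolvent_continuous_on assms(1)]) (use assms(2) in auto)

lemma chain_integral_Nil [simp]: "chain_integral F [] = 0"
  and chain_integral_Cons [simp]: "chain_integral F (e # E) = seg_integral F e + chain_integral F E"
  by (simp_all add: chain_integral_def)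

lemma chain_image_Nil [simp]: "chain_image [] = {}"
  and chain_image_Cons [simp]: "chain_image (e # E) = segment_of e \<union> chain_image E"
  by (simp_all add: chain_image_def)

lemma seg_integral_cong:
  assumes "\<And>z. z \<in> segment_of e \<Longrightarrow> F z = G z"
  shows "seg_integral F e = seg_integral G e"
  unfolding seg_integral_def by (rule integral_cong) (simp add: assms linepath_in_path)

lemma chain_integral_cong:
  assumes "\<And>z. z \<in> chain_image E \<Longrightarrow> F z = G z"
  shows "chain_integral F E = chain_integral G E"
  using assms by (induction E) (auto intro!: arg_cong2[where f = plus] seg_integral_cong)

lemma seg_integral_linear:
  assumes T: "bounded_linear T" "\<And>c y. T (cscale c y) = cscale c (T y)"
    and F: "continuous_on (segment_of e) F"
  shows "seg_integral (\<lambda>z. T (F z)) e = T (seg_integral F e)"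
  using has_integral_linear[OF seg_has_integral[OF F] T(1)]
  unfolding seg_integral_def[of "\<lambda>z. T (F z)"]
  by (intro integral_unique) (simp add: o_def T(2))

lemma chain_integral_linear:
  assumes T: "bounded_linear T" "\<And>c y. T (cscale c y) = cscale c (T y)"
    and F: "continuous_on (chain_image E) F"
  shows "chain_integral (\<lambda>z. T (F z)) E = T (chain_integral F E)"
  using F
proof (induction E)
  case Nil
  then show ?case using bounded_linear.linear[OF T(1)] by (simp add: linear_0)
next
  case (Cons e E)
  then have "continuous_on (segment_of e) F" "continuous_on (chain_image E) F"
    by (auto intro: continuous_on_subset)
  then show ?case
    using Cons.IH seg_integral_linear[OF T] bounded_linear.linear[OF T(1)] by (simp add: linear_add)
qed

lemma chain_integral_cscale:
  "continuous_on (chain_image E) F \<Longrightarrow> chain_integral (\<lambda>z. cscale c (F z)) E = cscale c (chain_integral F E)"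
  by (rule chain_integral_linear[OF cscale.bounded_linear_right cscale_commute])

lemma chain_integral_mult_left:
  "continuous_on (chain_image E) F \<Longrightarrow> chain_integral (\<lambda>z. x * F z) E = x * chain_integral F E"
  by (rule chain_integral_linear[OF bounded_linear_mult_right cscale_mult_right])

lemma chain_integral_mult_right:
  "continuous_on (chain_image E) F \<Longrightarrow> chain_integral (\<lambda>z. F z * x) E = chain_integral F E * x"
  by (rule chain_integral_linear[OF bounded_linear_mult_left cscale_mult_left])

lemma seg_integral_add:
  assumes "continuous_on (segment_of e) F" "continuous_on (segment_of e) G"
  shows "seg_integral (\<lambda>z. F z + G z) e = seg_integral F e + seg_integral G e"
  using has_integral_add[OF seg_has_integral[OF assms(1)] seg_has_integral[OF assms(2)]]
  unfolding seg_integral_def[of "\<lambda>z. F z + G z"]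
  by (intro integral_unique) (simp add: cscale.add_right)

lemma chain_integral_add:
  assumes "continuous_on (chain_image E) F" "continuous_on (chain_image E) G"
  shows "chain_integral (\<lambda>z. F z + G z) E = chain_integral F E + chain_integral G E"
  using assms
proof (induction E)
  case (Cons e E)
  then have "continuous_on (segment_of e) F" "continuous_on (chain_image E) F"
    "continuous_on (segment_of e) G" "continuous_on (chain_image E) G"
    by (auto intro: continuous_on_subset)
  then show ?case using Cons.IH by (simp add: seg_integral_add)
qed simp

lemma chain_integral_diff:
  assumes "continuous_on (chain_image E) F" "continuous_on (chain_image E) G"
  shows "chain_integral (\<lambda>z. F z - G z) E = chain_integral F E - chain_integral G E"
proof -
  have "chain_integral (\<lambda>z. F z - G z + G z) E = chain_integral (\<lambda>z. F z - G z) E + chain_integral G E"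
    using assms by (intro chain_integral_add continuous_intros)
  then show ?thesis by simp
qed

lemma chain_integral_norm_bound:
  obtains L where "L \<ge> 0" "\<And>(F::complex \<Rightarrow> 'a::complex_banach_algebra) B. continuous_on (chain_image E) F \<Longrightarrow>
    (\<And>z. z \<in> chain_image E \<Longrightarrow> norm (F z) \<le> B) \<Longrightarrow> norm (chain_integral F E) \<le> L * B"
proof
  show "0 \<le> (\<Sum>e\<leftarrow>E. norm (snd e - fst e))" by (rule sum_list_nonneg) auto
  show "norm (chain_integral F E) \<le> (\<Sum>e\<leftarrow>E. norm (snd e - fst e)) * B"
    if "continuous_on (chain_image E) F" "\<And>z. z \<in> chain_image E \<Longrightarrow> norm (F z) \<le> B"
    for F :: "complex \<Rightarrow> 'a" and B
    using that
  proof (induction E)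
    case (Cons e E)
    then have "continuous_on (segment_of e) F" "continuous_on (chain_image E) F"
      by (auto intro: continuous_on_subset)
    then have "norm (seg_integral F e) \<le> norm (snd e - fst e) * B"
      "norm (chain_integral F E) \<le> (\<Sum>e\<leftarrow>E. norm (snd e - fst e)) * B"
      using Cons by (auto intro!: seg_integral_bound)
    then show ?case
      using norm_triangle_ineq[of "seg_integral F e" "chain_integral F E"] by (simp add: distrib_right)
  qed simp
qed

lemma continuous_on_seg_param:
  assumes "continuous_on (S \<times> segment_of e) (\<lambda>p. G (fst p) (snd p))"
  shows "continuous_on S (\<lambda>z. seg_integral (G z) e)"
proof -
  have l: "continuous_on (S \<times> cbox 0 1) (\<lambda>p. (fst p, linepath (fst e) (snd e) (snd p)))"
    unfolding linepath_def by (intro continuous_intros)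
  have "(\<lambda>p. (fst p, linepath (fst e) (snd e) (snd p))) ` (S \<times> cbox 0 1) \<subseteq> S \<times> segment_of e"
    by (auto simp: linepath_in_path)
  from continuous_on_compose2[OF assms l this]
  have "continuous_on (S \<times> cbox 0 1) (\<lambda>(z, t). cscale (snd e - fst e) (G z (linepath (fst e) (snd e) t)))"
    by (auto simp: split_beta intro!: continuous_intros)
  from integral_continuous_on_param[OF this] show ?thesis by (simp add: seg_integral_def)
qed

lemma continuous_on_chain_param:
  assumes "continuous_on (S \<times> chain_image E) (\<lambda>p. G (fst p) (snd p))"
  shows "continuous_on S (\<lambda>z. chain_integral (G z) E)"
  using assms
proof (induction E)
  case (Cons e E)
  then have "continuous_on (S \<times> segment_of e) (\<lambda>p. G (fst p) (snd p))"
    "continuous_on (S \<times> chain_image E) (\<lambda>p. G (fst p) (snd p))"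
    by (auto intro: continuous_on_subset)
  then show ?case using Cons.IH by (auto intro!: continuous_intros continuous_on_seg_param)
qed simp

lemma continuous_on_fst_section:
  assumes "continuous_on (S \<times> T) (\<lambda>p. G (fst p) (snd p))" "z \<in> S"
  shows "continuous_on T (G z)"
proof -
  have c: "continuous_on T (\<lambda>w. (z, w))" by (intro continuous_intros)
  have "(\<lambda>w. (z, w)) ` T \<subseteq> S \<times> T" using assms(2) by auto
  from continuous_on_compose2[OF assms(1) c this] show ?thesis by simp
qed

lemma continuous_on_prod_swap:
  assumes "continuous_on (S \<times> T) (\<lambda>p. G (fst p) (snd p))"
  shows "continuous_on (T \<times> S) (\<lambda>p. G (snd p) (fst p))"
proof -
  have c: "continuous_on (T \<times> S) (\<lambda>p. (snd p, fst p))" by (intro continuous_intros)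
  have "(\<lambda>p. (snd p, fst p)) ` (T \<times> S) \<subseteq> S \<times> T" by auto
  from continuous_on_compose2[OF assms(1) c this] show ?thesis by simp
qed

lemma seg_swap:
  assumes "continuous_on (segment_of e \<times> segment_of e') (\<lambda>p. G (fst p) (snd p))"
  shows "seg_integral (\<lambda>z. seg_integral (G z) e') e = seg_integral (\<lambda>w. seg_integral (\<lambda>z. G z w) e) e'"
proof -
  let ?l = "linepath (fst e) (snd e)" and ?l' = "linepath (fst e') (snd e')"
  let ?c = "snd e - fst e" and ?c' = "snd e' - fst e'"
  let ?H = "\<lambda>s t. cscale ?c (cscale ?c' (G (?l s) (?l' t)))"
  have l: "continuous_on ({0..1} \<times> {0..1}) (\<lambda>p. (?l (fst p), ?l' (snd p)))"
    unfolding linepath_def by (intro continuous_intros)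
  have "(\<lambda>p. (?l (fst p), ?l' (snd p))) ` ({0..1} \<times> {0..1}) \<subseteq> segment_of e \<times> segment_of e'"
    by (auto simp: linepath_in_path)
  from continuous_on_compose2[OF assms l this]
  have cG: "continuous_on ({0..1} \<times> {0..1}) (\<lambda>p. G (?l (fst p)) (?l' (snd p)))"
    by simp
  have cs: "continuous_on {0..1} (\<lambda>t. G (?l s) (?l' t))" if "s \<in> {0..1}" for s
    using continuous_on_fst_section[OF cG that] by simp
  have ct: "continuous_on {0..1} (\<lambda>s. G (?l s) (?l' t))" if "t \<in> {0..1}" for t
    using continuous_on_fst_section[OF continuous_on_prod_swap[OF cG] that] by simp
  have "seg_integral (\<lambda>z. seg_integral (G z) e') e = integral {0..1} (\<lambda>s. integral {0..1} (\<lambda>t. ?H s t))"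
    unfolding seg_integral_def
  proof (rule integral_cong)
    fix s :: real assume s: "s \<in> {0..1}"
    have "((\<lambda>t. cscale ?c' (G (?l s) (?l' t))) has_integral integral {0..1} (\<lambda>t. cscale ?c' (G (?l s) (?l' t)))) {0..1}"
      using cs[OF s] by (intro integrable_integral integrable_continuous_interval continuous_intros)
    from has_integral_linear[OF this cscale.bounded_linear_right[of ?c]]
    show "cscale ?c (integral {0..1} (\<lambda>t. cscale ?c' (G (?l s) (?l' t)))) = integral {0..1} (\<lambda>t. ?H s t)"
      by (simp add: integral_unique o_def)
  qed
  also have "\<dots> = integral {0..1} (\<lambda>t. integral {0..1} (\<lambda>s. ?H s t))"
  proof -
    have "continuous_on (cbox (0, 0) (1, 1)) (\<lambda>(s, t). ?H s t)"
      unfolding cbox_Pair_eq split_beta using cG by (auto intro!: continuous_intros)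
    from integral_swap_continuous[OF this] show ?thesis by simp
  qed
  also have "\<dots> = seg_integral (\<lambda>w. seg_integral (\<lambda>z. G z w) e) e'"
    unfolding seg_integral_def
  proof (rule integral_cong)
    fix t :: real assume t: "t \<in> {0..1}"
    have "((\<lambda>s. cscale ?c (G (?l s) (?l' t))) has_integral integral {0..1} (\<lambda>s. cscale ?c (G (?l s) (?l' t)))) {0..1}"
      using ct[OF t] by (intro integrable_integral integrable_continuous_interval continuous_intros)
    from has_integral_linear[OF this cscale.bounded_linear_right[of ?c']]
    show "integral {0..1} (\<lambda>s. ?H s t) = cscale ?c' (integral {0..1} (\<lambda>s. cscale ?c (G (?l s) (?l' t))))"
      by (simp add: integral_unique o_def cscale_commute[of ?c])
  qed
  finally show ?thesis .
qed

lemma seg_chain_swap: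
  assumes "continuous_on (segment_of e \<times> chain_image E) (\<lambda>p. G (fst p) (snd p))"
  shows "seg_integral (\<lambda>z. chain_integral (G z) E) e = chain_integral (\<lambda>w. seg_integral (\<lambda>z. G z w) e) E"
  using assms
proof (induction E)
  case Nil
  then show ?case by (simp add: seg_integral_def cscale.zero_right)
next
  case (Cons e' E)
  then have c: "continuous_on (segment_of e \<times> segment_of e') (\<lambda>p. G (fst p) (snd p))"
    "continuous_on (segment_of e \<times> chain_image E) (\<lambda>p. G (fst p) (snd p))"
    by (auto intro: continuous_on_subset)
  then show ?case
    using Cons.IH seg_swap[OF c(1)]
    by (simp add: seg_integral_add continuous_on_seg_param continuous_on_chain_param)
qed

lemma chain_swap:
  assumes "continuous_on (chain_image E \<times> chain_image E') (\<lambda>p. G (fst p) (snd p))"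
  shows "chain_integral (\<lambda>z. chain_integral (G z) E') E = chain_integral (\<lambda>w. chain_integral (\<lambda>z. G z w) E) E'"
  using assms
proof (induction E)
  case Nil
  \<comment> \<open>Pulling out a factor 0 shows that the zero function integrates to 0.\<close>
  have "chain_integral (\<lambda>w. 0::'a) E' = 0 * chain_integral (\<lambda>w. 0::'a) E'"
    by (subst chain_integral_mult_left[symmetric]) auto
  then show ?case by simp
next
  case (Cons e E)
  then have c: "continuous_on (segment_of e \<times> chain_image E') (\<lambda>p. G (fst p) (snd p))"
    "continuous_on (chain_image E \<times> chain_image E') (\<lambda>p. G (fst p) (snd p))"
    by (auto intro: continuous_on_subset)
  note c' = c[THEN continuous_on_prod_swap]
  show ?case
    using Cons.IH[OF c(2)] seg_chain_swap[OF c(1)]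
    by (simp add: chain_integral_add continuous_on_seg_param[OF c'(1)] continuous_on_chain_param[OF c'(2)])
qed

section \<open>Scalar chain integrals and scalar Cauchy formulas\<close>

definition cchain :: "(complex \<Rightarrow> complex) \<Rightarrow> (complex \<times> complex) list \<Rightarrow> complex" where
  "cchain f E = (\<Sum>e\<leftarrow>E. contour_integral (linepath (fst e) (snd e)) f)"

lemma chain_integral_cscale_left:
  assumes "continuous_on (chain_image E) f"
  shows "chain_integral (\<lambda>z. cscale (f z) x) E = cscale (cchain f E) x"
  using assms
proof (induction E)
  case (Cons e E)
  then have "continuous_on (segment_of e) f" "continuous_on (chain_image E) f"
    by (auto intro: continuous_on_subset)
  then show ?case using Cons.IH by (simp add: cchain_def seg_integral_cscale cscale_add_left)
qed (simp add: cchain_def cscale.zero_left)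

text \<open>Multiples of 1 embed the scalars in the algebra, so scalar integrals can be read off
  from the algebra-valued results on grid chains.\<close>

lemma cchain_eqI:
  assumes "continuous_on (chain_image E) f"
    and "chain_integral (\<lambda>z. cscale (f z) (1::'a::complex_banach_algebra)) E = cscale c 1"
  shows "cchain f E = c"
  using assms chain_integral_cscale_left[of E f "1::'a"] cscale_1_inject by metis

text \<open>The chain \<open>E\<close> behaves like a cycle in \<open>W - K\<close> with winding number 1 around the points
  of \<open>K\<close> and 0 outside \<open>W\<close>.\<close>

definition cauchy_chain :: "complex set \<Rightarrow> complex set \<Rightarrow> (complex \<times> complex) list \<Rightarrow> bool" where
  "cauchy_chain K W E \<longleftrightarrow> chain_image E \<subseteq> W - K \<and>
     (\<forall>h. h holomorphic_on W \<longrightarrow> cchain h E = 0) \<and>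
     (\<forall>f z. f holomorphic_on W \<longrightarrow> z \<in> K \<longrightarrow> cchain (\<lambda>\<zeta>. f \<zeta> / (\<zeta> - z)) E = 2 * pi * \<i> * f z)"

lemma cchain_add:
  assumes "continuous_on (chain_image E) f" "continuous_on (chain_image E) g"
  shows "cchain (\<lambda>z. f z + g z) E = cchain f E + cchain g E"
  using assms
proof (induction E)
  case (Cons e E)
  then have "continuous_on (segment_of e) f" "continuous_on (chain_image E) f"
    "continuous_on (segment_of e) g" "continuous_on (chain_image E) g"
    by (auto intro: continuous_on_subset)
  then show ?case
    using Cons.IH by (simp add: cchain_def contour_integral_add contour_integrable_continuous_linepath)
qed (simp add: cchain_def)

lemma cchain_cmult:
  assumes "continuous_on (chain_image E) f"
  shows "cchain (\<lambda>z. c * f z) E = c * cchain f E"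
  using assms
proof (induction E)
  case (Cons e E)
  then have "continuous_on (segment_of e) f" "continuous_on (chain_image E) f"
    by (auto intro: continuous_on_subset)
  then show ?case
    using Cons.IH
    by (simp add: cchain_def contour_integral_lmul contour_integrable_continuous_linepath distrib_left)
qed (simp add: cchain_def)

lemma cchain_cong:
  assumes "\<And>z. z \<in> chain_image E \<Longrightarrow> f z = g z"
  shows "cchain f E = cchain g E"
  using assms
proof (induction E)
  case (Cons e E)
  have "contour_integral (linepath (fst e) (snd e)) f = contour_integral (linepath (fst e) (snd e)) g"
    using Cons.prems by (intro contour_integral_cong) auto
  then show ?case using Cons by (simp add: cchain_def)
qed (simp add: cchain_def)

text \<open>Cauchy's formula: after the constant \<open>f z\<close> is split off, the difference
  quotient is holomorphic on \<open>W\<close> with its singularity removed, and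
  \<open>1 / (\<zeta> - z)\<close> is evaluated through its decay at infinity. The resolvent clause
  is conditional so that \<open>K\<close> may also be larger than a spectrum, such as
  \<open>closure W\<close>.\<close>

lemma cauchy_chain_exists:
  assumes K: "compact K" and W: "open W" "K \<subseteq> W"
  obtains E where "cauchy_chain K W E" "mset (map fst E) = mset (map snd E)"
    "\<And>a::'a::complex_banach_algebra. K = spec a \<Longrightarrow> chain_integral (resolvent a) E = cscale (2 * pi * \<i>) 1"
proof -
  obtain E where E: "chain_image E \<subseteq> W - K" "mset (map fst E) = mset (map snd E)"
    "\<And>F::complex \<Rightarrow> 'a. C1_holo W F \<Longrightarrow> chain_integral F E = 0"
    "\<And>(F::complex \<Rightarrow> 'a) x C. C1_holo (- K) F \<Longrightarrow>
      \<forall>\<^sub>F z in at_infinity. norm (F z - cscale (1 / z) x) \<le> C / (norm z)\<^sup>2 \<Longrightarrow>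
      chain_integral F E = cscale (2 * pi * \<i>) x"
    using grid_chain_exists[OF K W, where 'a = 'a] by blast
  have contW: "continuous_on (chain_image E) h" if "h holomorphic_on W" for h
    using holomorphic_on_imp_continuous_on[OF that] E(1) by (auto intro: continuous_on_subset)
  have zero: "cchain h E = 0" if h: "h holomorphic_on W" for h
    by (rule cchain_eqI[OF contW[OF h], where 'a = 'a])
      (simp add: E(3) C1_holo_cscale[OF h W(1) C1_holo_const] cscale.zero_left)
  have contp: "continuous_on (chain_image E) (\<lambda>\<zeta>. 1 / (\<zeta> - z))" if "z \<in> K" for z
    using that E(1) by (intro continuous_intros) auto
  have one: "cchain (\<lambda>\<zeta>. 1 / (\<zeta> - z)) E = 2 * pi * \<i>" if z: "z \<in> K" for z
  proof (rule cchain_eqI[OF contp[OF z], where 'a = 'a], rule E(4))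
    show "C1_holo (- K) (\<lambda>\<zeta>. cscale (1 / (\<zeta> - z)) (1::'a))"
      using z K by (intro C1_holo_cscale C1_holo_const holomorphic_intros)
        (auto simp: compact_imp_closed open_Compl)
    show "\<forall>\<^sub>F \<zeta> in at_infinity. norm (cscale (1 / (\<zeta> - z)) 1 - cscale (1 / \<zeta>) (1::'a)) \<le> 2 * norm z / (norm \<zeta>)\<^sup>2"
      unfolding eventually_at_infinity
    proof (intro exI[of _ "2 * norm z + 1"] allI impI)
      fix \<zeta> :: complex assume \<zeta>: "2 * norm z + 1 \<le> norm \<zeta>"
      have half: "norm (\<zeta> - z) \<ge> norm \<zeta> / 2"
        using norm_triangle_ineq2[of \<zeta> z] \<zeta> by simp
      have pos: "norm \<zeta> > 0" using \<zeta> norm_ge_zero[of z] by linarith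
      then have nz: "\<zeta> \<noteq> 0" "\<zeta> - z \<noteq> 0" using half by auto
      have "1 / (\<zeta> - z) - 1 / \<zeta> = z / (\<zeta> * (\<zeta> - z))"
        using nz by (simp add: divide_simps)
      then have "norm (cscale (1 / (\<zeta> - z)) 1 - cscale (1 / \<zeta>) (1::'a)) = norm z / (norm \<zeta> * norm (\<zeta> - z))"
        by (simp add: cscale.diff_left[symmetric] norm_cscale norm_divide norm_mult)
      also have "\<dots> \<le> norm z / (norm \<zeta> * (norm \<zeta> / 2))"
        using half pos nz by (intro divide_left_mono mult_left_mono mult_pos_pos) auto
      finally show "norm (cscale (1 / (\<zeta> - z)) 1 - cscale (1 / \<zeta>) (1::'a)) \<le> 2 * norm z / (norm \<zeta>)\<^sup>2"
        by (simp add: power2_eq_square mult.commute)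
    qed
  qed
  have formula: "cchain (\<lambda>\<zeta>. f \<zeta> / (\<zeta> - z)) E = 2 * pi * \<i> * f z" if f: "f holomorphic_on W" and z: "z \<in> K" for f z
  proof -
    let ?k = "\<lambda>\<zeta>. if \<zeta> = z then deriv f z else (f \<zeta> - f z) / (\<zeta> - z)"
    have k: "?k holomorphic_on W" by (rule pole_lemma_open[OF f W(1)])
    have "cchain (\<lambda>\<zeta>. f \<zeta> / (\<zeta> - z)) E = cchain (\<lambda>\<zeta>. ?k \<zeta> + f z * (1 / (\<zeta> - z))) E"
      using E(1) z by (intro cchain_cong) (auto simp: diff_divide_distrib)
    also have "\<dots> = cchain ?k E + f z * cchain (\<lambda>\<zeta>. 1 / (\<zeta> - z)) E"
      using cchain_add[OF contW[OF k] continuous_on_mult_left[OF contp[OF z]]] cchain_cmult[OF contp[OF z]]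
      by (simp only:)
    finally show ?thesis using zero[OF k] one[OF z] by simp
  qed
  show ?thesis
  proof (rule that[of E])
    show "cauchy_chain K W E" unfolding cauchy_chain_def using E(1) zero formula by blast
    show "chain_integral (resolvent a) E = cscale (2 * pi * \<i>) 1" if "K = spec a" for a :: 'a
    proof (rule E(4))
      show "C1_holo (- K) (resolvent a)" using that by (intro C1_holo_resolvent) auto
      show "\<forall>\<^sub>F z in at_infinity. norm (resolvent a z - cscale (1 / z) 1) \<le> 2 * norm a / (norm z)\<^sup>2"
        unfolding eventually_at_infinity
        by (rule exI[of _ "2 * norm a + 1"]) (auto intro!: resolvent_asymp)
    qed
  qed (rule E(2))
qed

section \<open>Change of chain and multiplicativity\<close>

definition calc_integral :: "'a::complex_banach_algebra \<Rightarrow> (complex \<Rightarrow> complex) \<Rightarrow> (complex \<times> complex) list \<Rightarrow> 'a" where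
  "calc_integral a f E = chain_integral (\<lambda>z. cscale (f z) (resolvent a z)) E"

text \<open>Write \<open>2 pi i f z\<close> as the integral of
  \<open>f \<zeta> / (\<zeta> - z)\<close> over \<open>E'\<close>, exchange the integrals and insert
  \<open>R z = R \<zeta> + (\<zeta> - z) R z R \<zeta>\<close>. The first term carries a scalar
  kernel that integrates to 0 over \<open>E\<close>; in the second the kernel cancels and the
  integrals separate.\<close>

lemma calc_integral_change_chain:
  assumes E: "chain_image E \<inter> spec a = {}" "chain_image E' \<inter> spec a = {}"
      "chain_image E \<inter> chain_image E' = {}"
    and f: "continuous_on (chain_image E) f" "continuous_on (chain_image E') f"
    and inner: "\<And>z. z \<in> chain_image E \<Longrightarrow> cchain (\<lambda>\<zeta>. f \<zeta> / (\<zeta> - z)) E' = 2 * pi * \<i> * f z"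
    and outer: "\<And>\<zeta>. \<zeta> \<in> chain_image E' \<Longrightarrow> cchain (\<lambda>z. 1 / (\<zeta> - z)) E = 0"
  shows "cscale (2 * pi * \<i>) (calc_integral a f E) = chain_integral (resolvent a) E * calc_integral a f E'"
proof -
  let ?R = "resolvent a"
  have R: "continuous_on (chain_image E) ?R" "continuous_on (chain_image E') ?R"
    using E by (auto intro!: continuous_intros)
  have fp: "continuous_on (chain_image E') (\<lambda>\<zeta>. f \<zeta> / (\<zeta> - z))" if "z \<in> chain_image E" for z
    using f E that by (intro continuous_intros) auto
  have "cscale (2 * pi * \<i>) (calc_integral a f E) = chain_integral (\<lambda>z. cscale (2 * pi * \<i>) (cscale (f z) (?R z))) E"
    unfolding calc_integral_def by (intro chain_integral_cscale[symmetric] continuous_intros f R)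
  also have "\<dots> = chain_integral (\<lambda>z. chain_integral (\<lambda>\<zeta>. cscale (f \<zeta> / (\<zeta> - z)) (?R z)) E') E"
    by (rule chain_integral_cong) (simp add: chain_integral_cscale_left[OF fp] inner cscale_cscale)
  also have "\<dots> = chain_integral (\<lambda>\<zeta>. chain_integral (\<lambda>z. cscale (f \<zeta> / (\<zeta> - z)) (?R z)) E) E'"
    by (rule chain_swap)
      (use E in \<open>auto intro!: continuous_intros continuous_on_compose2[OF f(2)]\<close>)
  also have "\<dots> = chain_integral (\<lambda>\<zeta>. chain_integral ?R E * cscale (f \<zeta>) (?R \<zeta>)) E'"
  proof (rule chain_integral_cong)
    fix \<zeta> assume \<zeta>: "\<zeta> \<in> chain_image E'"
    have cp: "continuous_on (chain_image E) (\<lambda>z. 1 / (\<zeta> - z))"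
      using \<zeta> E by (intro continuous_intros) auto
    have "chain_integral (\<lambda>z. cscale (f \<zeta> / (\<zeta> - z)) (?R z)) E =
        chain_integral (\<lambda>z. cscale (1 / (\<zeta> - z)) (cscale (f \<zeta>) (?R \<zeta>)) + ?R z * cscale (f \<zeta>) (?R \<zeta>)) E"
    proof (rule chain_integral_cong)
      fix z assume z: "z \<in> chain_image E"
      have "?R z = ?R \<zeta> + cscale (\<zeta> - z) (?R z * ?R \<zeta>)"
        using resolvent_identity[of z a \<zeta>] z \<zeta> E by (auto simp: diff_eq_eq add.commute)
      moreover have "\<zeta> - z \<noteq> 0" using z \<zeta> E by auto
      ultimately have "cscale (f \<zeta> / (\<zeta> - z)) (?R z)
          = cscale (f \<zeta> / (\<zeta> - z)) (?R \<zeta>) + cscale (f \<zeta> / (\<zeta> - z) * (\<zeta> - z)) (?R z * ?R \<zeta>)"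
        by (metis cscale_add_right cscale_cscale)
      then show "cscale (f \<zeta> / (\<zeta> - z)) (?R z) = cscale (1 / (\<zeta> - z)) (cscale (f \<zeta>) (?R \<zeta>)) + ?R z * cscale (f \<zeta>) (?R \<zeta>)"
        using \<open>\<zeta> - z \<noteq> 0\<close> by (simp add: cscale_cscale cscale_mult_right)
    qed
    also have "\<dots> = cscale (cchain (\<lambda>z. 1 / (\<zeta> - z)) E) (cscale (f \<zeta>) (?R \<zeta>)) + chain_integral ?R E * cscale (f \<zeta>) (?R \<zeta>)"
      by (subst chain_integral_add)
        (use cp R in \<open>auto intro!: continuous_intros simp: chain_integral_mult_right chain_integral_cscale_left\<close>)
    finally show "chain_integral (\<lambda>z. cscale (f \<zeta> / (\<zeta> - z)) (?R z)) E = chain_integral ?R E * cscale (f \<zeta>) (?R \<zeta>)"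
      using outer[OF \<zeta>] by (simp add: cscale.zero_left)
  qed
  also have "\<dots> = chain_integral ?R E * calc_integral a f E'"
    unfolding calc_integral_def by (intro chain_integral_mult_left continuous_intros f R)
  finally show ?thesis .
qed

text \<open>The classical argument with nested contours: dividing the resolvent identity by
  \<open>\<zeta> - z\<close> splits \<open>R z R \<zeta>\<close> into \<open>?A\<close>, evaluated
  by Cauchy's formula on the outer chain \<open>E'\<close>, and \<open>?B\<close>, which vanishes on
  integration over the inner chain \<open>E\<close>.\<close>

lemma calc_integral_mult:
  assumes E: "chain_image E \<inter> spec a = {}" "chain_image E' \<inter> spec a = {}"
      "chain_image E \<inter> chain_image E' = {}"
    and f: "continuous_on (chain_image E) f" and g: "continuous_on (chain_image E) g" "continuous_on (chain_image E') g"
    and inner: "\<And>z. z \<in> chain_image E \<Longrightarrow> cchain (\<lambda>\<zeta>. g \<zeta> / (\<zeta> - z)) E' = 2 * pi * \<i> * g z"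
    and outer: "\<And>\<zeta>. \<zeta> \<in> chain_image E' \<Longrightarrow> cchain (\<lambda>z. f z / (\<zeta> - z)) E = 0"
  shows "calc_integral a f E * calc_integral a g E' = cscale (2 * pi * \<i>) (calc_integral a (\<lambda>z. f z * g z) E)"
proof -
  let ?R = "resolvent a"
  have R: "continuous_on (chain_image E) ?R" "continuous_on (chain_image E') ?R"
    using E by (auto intro!: continuous_intros)
  have gp: "continuous_on (chain_image E') (\<lambda>\<zeta>. g \<zeta> / (\<zeta> - z))" if "z \<in> chain_image E" for z
    using g E that by (intro continuous_intros) auto
  have fp: "continuous_on (chain_image E) (\<lambda>z. f z / (\<zeta> - z))" if "\<zeta> \<in> chain_image E'" for \<zeta>
    using f E that by (intro continuous_intros) auto
  let ?A = "\<lambda>z \<zeta>. cscale (g \<zeta> / (\<zeta> - z)) (cscale (f z) (?R z))"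
  let ?B = "\<lambda>z \<zeta>. cscale (f z / (\<zeta> - z)) (cscale (g \<zeta>) (?R \<zeta>))"
  have contA: "continuous_on (chain_image E \<times> chain_image E') (\<lambda>p. ?A (fst p) (snd p))"
    and contB: "continuous_on (chain_image E \<times> chain_image E') (\<lambda>p. ?B (fst p) (snd p))"
    using E by (auto intro!: continuous_intros continuous_on_compose2[OF f] continuous_on_compose2[OF g(2)])
  have "calc_integral a f E * calc_integral a g E' =
      chain_integral (\<lambda>z. cscale (f z) (?R z) * calc_integral a g E') E"
    unfolding calc_integral_def[of a f] by (intro chain_integral_mult_right[symmetric] continuous_intros f R)
  also have "\<dots> = chain_integral (\<lambda>z. chain_integral (\<lambda>\<zeta>. cscale (f z) (?R z) * cscale (g \<zeta>) (?R \<zeta>)) E') E"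
    unfolding calc_integral_def
    by (rule chain_integral_cong, rule chain_integral_mult_left[symmetric], intro continuous_intros g R)
  also have "\<dots> = chain_integral (\<lambda>z. chain_integral (?A z) E' - chain_integral (?B z) E') E"
  proof (rule chain_integral_cong)
    fix z assume z: "z \<in> chain_image E"
    have "chain_integral (\<lambda>\<zeta>. cscale (f z) (?R z) * cscale (g \<zeta>) (?R \<zeta>)) E' = chain_integral (\<lambda>\<zeta>. ?A z \<zeta> - ?B z \<zeta>) E'"
    proof (rule chain_integral_cong)
      fix \<zeta> assume \<zeta>: "\<zeta> \<in> chain_image E'"
      have nz: "\<zeta> - z \<noteq> 0" using z \<zeta> E by auto
      have "?R z - ?R \<zeta> = cscale (\<zeta> - z) (?R z * ?R \<zeta>)"
        using z \<zeta> E by (intro resolvent_identity) auto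
      then have "cscale (f z * g \<zeta> / (\<zeta> - z)) (?R z - ?R \<zeta>) = cscale (f z * g \<zeta>) (?R z * ?R \<zeta>)"
        using nz by (simp add: cscale_cscale)
      then show "cscale (f z) (?R z) * cscale (g \<zeta>) (?R \<zeta>) = ?A z \<zeta> - ?B z \<zeta>"
        by (simp add: cscale_mult_left cscale_mult_right cscale_cscale cscale.diff_right mult_ac)
    qed
    also have "\<dots> = chain_integral (?A z) E' - chain_integral (?B z) E'"
      using continuous_on_fst_section[OF contA z] continuous_on_fst_section[OF contB z]
      by (rule chain_integral_diff)
    finally show "chain_integral (\<lambda>\<zeta>. cscale (f z) (?R z) * cscale (g \<zeta>) (?R \<zeta>)) E' = \<dots>" .
  qed
  also have "\<dots> = chain_integral (\<lambda>z. chain_integral (?A z) E') E - chain_integral (\<lambda>z. chain_integral (?B z) E') E"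
    using continuous_on_chain_param[OF contA] continuous_on_chain_param[OF contB]
    by (rule chain_integral_diff)
  also have "chain_integral (\<lambda>z. chain_integral (?B z) E') E = chain_integral (\<lambda>\<zeta>. chain_integral (\<lambda>z. ?B z \<zeta>) E) E'"
    by (rule chain_swap[OF contB])
  \<comment> \<open>Zero is written as a product so that \<open>chain_integral_mult_left\<close> can
    pull out the factor 0.\<close>
  also have "\<dots> = chain_integral (\<lambda>\<zeta>. 0 * 0) E'"
    by (rule chain_integral_cong) (simp add: chain_integral_cscale_left[OF fp] outer cscale.zero_left)
  also have "\<dots> = 0" by (subst chain_integral_mult_left) auto
  also have "chain_integral (\<lambda>z. chain_integral (?A z) E') E =
      chain_integral (\<lambda>z. cscale (2 * pi * \<i>) (cscale (f z * g z) (?R z))) E"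
    by (rule chain_integral_cong)
      (simp only: chain_integral_cscale_left[OF gp] inner, simp add: cscale_cscale mult_ac)
  also have "\<dots> = cscale (2 * pi * \<i>) (calc_integral a (\<lambda>z. f z * g z) E)"
    unfolding calc_integral_def by (intro chain_integral_cscale continuous_intros f g R)
  finally show ?thesis by simp
qed

section \<open>The functional calculus on chains\<close>

lemma cchain_pole_swap:
  assumes "w \<notin> chain_image E"
  shows "cchain (\<lambda>z. 1 / (w - z)) E = - cchain (\<lambda>z. 1 / (z - w)) E"
proof -
  have "continuous_on (chain_image E) (\<lambda>z. 1 / (z - w))"
    using assms by (intro continuous_intros) auto
  from cchain_cmult[OF this, of "-1"]
  have "cchain (\<lambda>z. - 1 * (1 / (z - w))) E = - cchain (\<lambda>z. 1 / (z - w)) E" by simp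
  moreover have "cchain (\<lambda>z. - 1 * (1 / (z - w))) E = cchain (\<lambda>z. 1 / (w - z)) E"
    using assms by (intro cchain_cong) (auto simp: divide_simps)
  ultimately show ?thesis by simp
qed

lemma cauchy_chain_outside:
  assumes "cauchy_chain K W E" "w \<notin> W" "f holomorphic_on W"
  shows "cchain (\<lambda>z. f z / (w - z)) E = 0"
proof -
  have "(\<lambda>z. f z / (w - z)) holomorphic_on W"
    using assms by (intro holomorphic_intros) auto
  then show ?thesis using assms(1) unfolding cauchy_chain_def by blast
qed

lemma cauchy_chain_image: "cauchy_chain K W E \<Longrightarrow> chain_image E \<subseteq> W - K"
  by (simp add: cauchy_chain_def)

lemma cauchy_chain_formula:
  "cauchy_chain K W E \<Longrightarrow> f holomorphic_on W \<Longrightarrow> z \<in> K \<Longrightarrow>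
    cchain (\<lambda>\<zeta>. f \<zeta> / (\<zeta> - z)) E = 2 * pi * \<i> * f z"
  by (simp add: cauchy_chain_def)

text \<open>The second conjunct, the calculus at the constant function 1, is the one algebra-valued
  fact carried along with the scalar formulas.\<close>

definition spectral_chain :: "'a::complex_banach_algebra \<Rightarrow> complex set \<Rightarrow> (complex \<times> complex) list \<Rightarrow> bool" where
  "spectral_chain a W E \<longleftrightarrow>
     cauchy_chain (spec a) W E \<and> chain_integral (resolvent a) E = cscale (2 * pi * \<i>) 1"

lemma spectral_chain_exists:
  assumes "open W" "spec a \<subseteq> W"
  obtains E where "spectral_chain a W E"
  using cauchy_chain_exists[OF compact_spec assms, where 'a = 'a] unfolding spectral_chain_def by metis

text \<open>\<open>K\<close> separates the chains: \<open>E\<close> runs inside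
  \<open>W \<subseteq> K\<close>, where the Cauchy formula of \<open>E'\<close> is valid, and
  \<open>E'\<close> runs off \<open>K\<close>, so that \<open>1 / (\<zeta> - z)\<close> is
  holomorphic in \<open>z\<close> on \<open>W\<close>.\<close>

lemma calc_integral_spectral_chain_eq:
  assumes E: "spectral_chain a W E" and E': "cauchy_chain K U E'"
    and sub: "spec a \<subseteq> W" "W \<subseteq> K" "K \<subseteq> U" and f: "f holomorphic_on U"
  shows "calc_integral a f E = calc_integral a f E'"
proof -
  have cE: "cauchy_chain (spec a) W E"
    and RE: "chain_integral (resolvent a) E = cscale (2 * pi * \<i>) 1"
    using E by (auto simp: spectral_chain_def)
  note im = cauchy_chain_image[OF cE] cauchy_chain_image[OF E']
  have cf: "continuous_on U f" using f by (rule holomorphic_on_imp_continuous_on)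
  have "cscale (2 * pi * \<i>) (calc_integral a f E) = chain_integral (resolvent a) E * calc_integral a f E'"
  proof (rule calc_integral_change_chain)
    show "cchain (\<lambda>\<zeta>. f \<zeta> / (\<zeta> - z)) E' = 2 * pi * \<i> * f z" if "z \<in> chain_image E" for z
      by (rule cauchy_chain_formula[OF E' f]) (use that im sub in blast)
    show "cchain (\<lambda>z. 1 / (\<zeta> - z)) E = 0" if "\<zeta> \<in> chain_image E'" for \<zeta>
      by (rule cauchy_chain_outside[OF cE]) (use that im sub in auto)
    show "continuous_on (chain_image E) f" "continuous_on (chain_image E') f"
      by (rule continuous_on_subset[OF cf]; use im sub in blast)+
  qed (use im sub in blast)+
  then show ?thesis
    unfolding RE cscale_1_mult by (rule cscale_left_inject[rotated]) simp
qed

text \<open>Both factors use the same chain, where the kernel would be singular. The second factor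
  is therefore moved to a chain \<open>E'\<close> around \<open>closure W\<close>, which leaves its
  value unchanged.\<close>

lemma calc_integral_spectral_chain_mult:
  assumes E: "spectral_chain a W E" and W: "open W" "compact (closure W)" "closure W \<subseteq> U" "spec a \<subseteq> W"
    and U: "open U" and f: "f holomorphic_on U" and g: "g holomorphic_on U"
  shows "calc_integral a f E * calc_integral a g E = cscale (2 * pi * \<i>) (calc_integral a (\<lambda>z. f z * g z) E)"
proof -
  obtain E' where E': "cauchy_chain (closure W) U E'"
    using cauchy_chain_exists[OF W(2) U W(3)] by metis
  have cE: "cauchy_chain (spec a) W E" using E by (auto simp: spectral_chain_def)
  have WU: "W \<subseteq> closure W" by (rule closure_subset)
  note im = cauchy_chain_image[OF cE] cauchy_chain_image[OF E']
  have cf: "continuous_on U f" "continuous_on U g" using f g holomorphic_on_imp_continuous_on by blast+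
  have "calc_integral a f E * calc_integral a g E' = cscale (2 * pi * \<i>) (calc_integral a (\<lambda>z. f z * g z) E)"
  proof (rule calc_integral_mult)
    show "cchain (\<lambda>\<zeta>. g \<zeta> / (\<zeta> - z)) E' = 2 * pi * \<i> * g z" if "z \<in> chain_image E" for z
      by (rule cauchy_chain_formula[OF E' g]) (use that im WU in blast)
    show "cchain (\<lambda>z. f z / (\<zeta> - z)) E = 0" if "\<zeta> \<in> chain_image E'" for \<zeta>
      by (rule cauchy_chain_outside[OF cE _ holomorphic_on_subset[OF f]])
        (use that im WU W(3) in blast)+
    show "continuous_on (chain_image E) f"
      by (rule continuous_on_subset[OF cf(1)]) (use im WU W in blast)
    show "continuous_on (chain_image E) g" "continuous_on (chain_image E') g"
      by (rule continuous_on_subset[OF cf(2)]; use im WU W in blast)+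
  qed (use im WU W in blast)+
  moreover have "calc_integral a g E = calc_integral a g E'"
    by (rule calc_integral_spectral_chain_eq[OF E E' W(4) WU W(3) g])
  ultimately show ?thesis by simp
qed

section \<open>Admissible cycles against spectral chains\<close>

lemma admissible_cycle_exists:
  fixes a :: "'a::complex_banach_algebra"
  assumes U: "open U" "spec a \<subseteq> U"
  obtains \<Gamma> where "admissible_cycle U (spec a) \<Gamma>"
proof -
  define K where "K = spec a"
  obtain E where E: "cauchy_chain K U E" "mset (map fst E) = mset (map snd E)"
    unfolding K_def using cauchy_chain_exists[OF compact_spec U, where 'a = 'a] by metis
  note im = cauchy_chain_image[OF E(1)]
  define G where "G = map (\<lambda>e. linepath (fst e) (snd e)) E"
  have "\<forall>g\<in>set G. valid_path g \<and> path_image g \<subseteq> U - K"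
    using im by (auto simp: G_def chain_image_def)
  moreover have "mset (map pathstart G) = mset (map pathfinish G)"
    using E(2) by (simp add: G_def o_def)
  ultimately obtain \<Gamma> where \<Gamma>: "\<forall>g\<in>set \<Gamma>. valid_path g \<and> pathfinish g = pathstart g \<and> path_image g \<subseteq> U - K"
    "\<And>f. (\<forall>g\<in>set G. f contour_integrable_on g) \<Longrightarrow> (\<Sum>g\<leftarrow>\<Gamma>. contour_integral g f) = (\<Sum>g\<leftarrow>G. contour_integral g f)"
    using balanced_paths_imp_closed_paths[of G "U - K"] by metis
  \<comment> \<open>All paths run in \<open>U - K\<close>. At any other point, whether in
    \<open>K\<close> or off \<open>U\<close>, the winding numbers are contour integrals, and
    regrouping edges into closed paths preserves their sum.\<close>
  have wn: "(\<Sum>g\<leftarrow>\<Gamma>. winding_number g z) = 1 / (2 * pi * \<i>) * cchain (\<lambda>\<zeta>. 1 / (\<zeta> - z)) E"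
    if z: "z \<notin> U - K" for z
  proof -
    have "(\<Sum>g\<leftarrow>\<Gamma>. winding_number g z) = (\<Sum>g\<leftarrow>\<Gamma>. 1 / (2 * pi * \<i>) * contour_integral g (\<lambda>\<zeta>. 1 / (\<zeta> - z)))"
      using \<Gamma>(1) z by (intro arg_cong[of _ _ sum_list] map_cong refl winding_number_valid_path) auto
    also have "\<dots> = 1 / (2 * pi * \<i>) * (\<Sum>g\<leftarrow>\<Gamma>. contour_integral g (\<lambda>\<zeta>. 1 / (\<zeta> - z)))"
      by (rule sum_list_const_mult)
    also have "(\<Sum>g\<leftarrow>\<Gamma>. contour_integral g (\<lambda>\<zeta>. 1 / (\<zeta> - z))) = (\<Sum>g\<leftarrow>G. contour_integral g (\<lambda>\<zeta>. 1 / (\<zeta> - z)))"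
    proof (rule \<Gamma>(2), rule ballI)
      fix g assume "g \<in> set G"
      then obtain e where e: "e \<in> set E" "g = linepath (fst e) (snd e)" by (auto simp: G_def)
      then have "z \<notin> segment_of e" using im z by (auto simp: chain_image_def)
      then show "(\<lambda>\<zeta>. 1 / (\<zeta> - z)) contour_integrable_on g"
        unfolding e(2) by (intro contour_integrable_continuous_linepath continuous_intros) auto
    qed
    also have "\<dots> = cchain (\<lambda>\<zeta>. 1 / (\<zeta> - z)) E" by (simp add: cchain_def G_def o_def)
    finally show ?thesis .
  qed
  have "admissible_cycle U K \<Gamma>"
    unfolding admissible_cycle_def
  proof (intro conjI ballI allI impI)
    show "(\<Sum>g\<leftarrow>\<Gamma>. winding_number g z) = 1" if "z \<in> K" for z
      using wn[of z] cauchy_chain_formula[OF E(1) holomorphic_on_const that, of 1] that by simp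
    show "(\<Sum>g\<leftarrow>\<Gamma>. winding_number g z) = 0" if "z \<notin> U" for z
      using wn[of z] cauchy_chain_outside[OF E(1) that holomorphic_on_const, of 1] that im
        cchain_pole_swap[of z E] by auto
  qed (use \<Gamma>(1) in auto)
  then show ?thesis using that unfolding K_def by blast
qed

text \<open>Off \<open>T\<close> the sum is continuous and integer-valued, so a level set is the
  preimage of a unit ball around an integer.\<close>

lemma open_winding_level:
  assumes \<Gamma>: "\<forall>\<gamma>\<in>set \<Gamma>. path \<gamma> \<and> pathfinish \<gamma> = pathstart \<gamma>"
    and T: "closed T" "(\<Union>\<gamma>\<in>set \<Gamma>. path_image \<gamma>) \<subseteq> T" and c: "c \<in> \<int>"
  shows "open {z. z \<notin> T \<and> (\<Sum>\<gamma>\<leftarrow>\<Gamma>. winding_number \<gamma> z) = c}"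
proof -
  let ?N = "\<lambda>z. \<Sum>\<gamma>\<leftarrow>\<Gamma>. winding_number \<gamma> z"
  have cont: "continuous_on (- T) ?N"
    using \<Gamma> T(2)
  proof (induction \<Gamma>)
    case (Cons \<gamma> \<Gamma>)
    have "continuous_on (- T) (winding_number \<gamma>)"
      using Cons.prems by (intro continuous_on_subset[OF continuous_on_winding_number[of \<gamma>]]) auto
    then show ?case using Cons by (auto intro!: continuous_intros)
  qed simp
  have int: "?N z \<in> \<int>" if "z \<notin> T" for z
    using \<Gamma> T(2)
  proof (induction \<Gamma>)
    case (Cons \<gamma> \<Gamma>)
    have "winding_number \<gamma> z \<in> \<int>"
      using Cons.prems that by (intro integer_winding_number) auto
    then show ?case using Cons by simp
  qed simp
  have "?N z = c \<longleftrightarrow> ?N z \<in> ball c 1" if "z \<notin> T" for z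
  proof
    assume "?N z \<in> ball c 1"
    moreover have "c - ?N z \<in> \<int>" using int[OF that] c by simp
    then obtain k where k: "c - ?N z = of_int k" by (auto elim: Ints_cases)
    ultimately have "norm (of_int k :: complex) < 1" by (simp add: dist_norm)
    then have "k = 0" by simp
    then show "?N z = c" using k by simp
  qed simp
  then have eq: "{z. z \<notin> T \<and> ?N z = c} = - T \<inter> ?N -` ball c 1" by auto
  show ?thesis unfolding eq using cont T(1) by (intro continuous_open_preimage) auto
qed

lemma winding_number_sum_zero_at_infinity:
  assumes "\<forall>\<gamma>\<in>set \<Gamma>. path \<gamma> \<and> pathfinish \<gamma> = pathstart \<gamma>"
  shows "\<exists>B. \<forall>z. norm z \<ge> B \<longrightarrow> (\<Sum>\<gamma>\<leftarrow>\<Gamma>. winding_number \<gamma> z) = 0"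
  using assms
proof (induction \<Gamma>)
  case (Cons \<gamma> \<Gamma>)
  obtain B where B: "\<And>z. norm z \<ge> B \<Longrightarrow> winding_number \<gamma> z = 0"
    using winding_number_zero_at_infinity[of \<gamma>] Cons.prems by auto
  obtain B' where B': "\<And>z. norm z \<ge> B' \<Longrightarrow> (\<Sum>\<gamma>\<leftarrow>\<Gamma>. winding_number \<gamma> z) = 0"
    using Cons by auto
  show ?case by (rule exI[of _ "max B B'"]) (simp add: B B')
qed simp

text \<open>A polygon \<open>E0\<close> near the cycle inherits its winding numbers. It is then
  compared with two chains that do not touch it: \<open>E1\<close>, close to the spectrum, yields
  the resolvent integral over \<open>E0\<close>; \<open>E2\<close>, beyond all points of nonzero
  winding number, yields the integral of \<open>f\<close>. \<open>E2\<close> also encloses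
  \<open>E\<close>.\<close>

lemma admissible_cycle_integral:
  fixes a :: "'a::complex_banach_algebra"
  assumes adm: "admissible_cycle U (spec a) \<Gamma>" and U: "open U" and f: "f holomorphic_on U"
    and E: "spectral_chain a W E"
    and W: "open W" "compact (closure W)" "closure W \<subseteq> U" "spec a \<subseteq> W"
  shows "(\<Sum>\<gamma>\<leftarrow>\<Gamma>. alg_contour_integral (\<lambda>z. cscale (f z) (resolvent a z)) \<gamma>) = calc_integral a f E"
proof -
  let ?N = "\<lambda>z. \<Sum>\<gamma>\<leftarrow>\<Gamma>. winding_number \<gamma> z"
  have \<Gamma>: "\<And>\<gamma>. \<gamma> \<in> set \<Gamma> \<Longrightarrow> valid_path \<gamma> \<and> pathfinish \<gamma> = pathstart \<gamma> \<and> path_image \<gamma> \<subseteq> U - spec a"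
    and N1: "\<And>z. z \<in> spec a \<Longrightarrow> ?N z = 1" and N0: "\<And>z. z \<notin> U \<Longrightarrow> ?N z = 0"
    using adm unfolding admissible_cycle_def by auto
  have \<Gamma>': "\<forall>\<gamma>\<in>set \<Gamma>. path \<gamma> \<and> pathfinish \<gamma> = pathstart \<gamma>" using \<Gamma> valid_path_imp_path by blast
  define Im where "Im = (\<Union>\<gamma>\<in>set \<Gamma>. path_image \<gamma>)"
  have Im: "compact Im" "Im \<subseteq> U - spec a"
    unfolding Im_def using \<Gamma> \<Gamma>' by (auto intro!: compact_UN compact_path_image)
  have oU: "open (U - spec a)" using U closed_spec by (rule open_Diff)
  obtain \<epsilon> where \<epsilon>: "\<epsilon> > 0" "(\<Union>x\<in>Im. cball x \<epsilon>) \<subseteq> U - spec a"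
    using compact_subset_open_imp_cball_epsilon_subset[OF Im(1) oU Im(2)] by metis
  \<comment> \<open>\<open>V\<close> is the open set in which the polygon is drawn, \<open>T\<close>
    a compact set around it that still avoids the spectrum. For \<open>z\<close> off
    \<open>T\<close> the kernel \<open>1 / (\<zeta> - z)\<close> is holomorphic on \<open>V\<close>,
    so cycle and polygon give it the same integral.\<close>
  define V where "V = (\<Union>x\<in>Im. ball x \<epsilon>)"
  define T where "T = (\<Union>x\<in>Im. \<Union>y\<in>cball 0 \<epsilon>. {x + y})"
  have V: "open V" "Im \<subseteq> V" using \<epsilon>(1) by (auto simp: V_def)
  have VT: "V \<subseteq> T"
  proof
    fix z assume "z \<in> V"
    then obtain x where "x \<in> Im" "dist x z < \<epsilon>" by (auto simp: V_def)
    then have "x \<in> Im" "z - x \<in> cball 0 \<epsilon>" "z = x + (z - x)"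
      by (auto simp: dist_norm norm_minus_commute)
    then show "z \<in> T" unfolding T_def by blast
  qed
  have TU: "T \<subseteq> U - spec a"
  proof
    fix z assume "z \<in> T"
    then obtain x y where "x \<in> Im" "y \<in> cball 0 \<epsilon>" "z = x + y" unfolding T_def by blast
    then have "x \<in> Im" "z \<in> cball x \<epsilon>" by (auto simp: dist_norm)
    then show "z \<in> U - spec a" using \<epsilon>(2) by blast
  qed
  have T: "compact T" "closed T"
    unfolding T_def using Im(1) by (auto intro!: compact_sums' compact_imp_closed)
  obtain E0 where E0: "chain_image E0 \<subseteq> V"
    "\<And>F::complex \<Rightarrow> 'a. C1_holo V F \<Longrightarrow> (\<Sum>\<gamma>\<leftarrow>\<Gamma>. alg_contour_integral F \<gamma>) = chain_integral F E0"
    using paths_polygon[OF V(1), of \<Gamma>, where 'a = 'a] \<Gamma> V(2) unfolding Im_def by blast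
  have wind: "cchain (\<lambda>\<zeta>. 1 / (\<zeta> - z)) E0 = 2 * pi * \<i> * ?N z" if z: "z \<notin> T" for z
  proof (rule cchain_eqI[where 'a = 'a])
    have zV: "z \<notin> V" using z VT by blast
    have hol: "(\<lambda>\<zeta>. 1 / (\<zeta> - z)) holomorphic_on V" using zV by (intro holomorphic_intros) auto
    show "continuous_on (chain_image E0) (\<lambda>\<zeta>. 1 / (\<zeta> - z))"
      using holomorphic_on_imp_continuous_on[OF hol] E0(1) by (rule continuous_on_subset)
    have "chain_integral (\<lambda>\<zeta>. cscale (1 / (\<zeta> - z)) (1::'a)) E0
        = (\<Sum>\<gamma>\<leftarrow>\<Gamma>. alg_contour_integral (\<lambda>\<zeta>. cscale (1 / (\<zeta> - z)) (1::'a)) \<gamma>)"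
      by (rule E0(2)[symmetric], rule C1_holo_cscale[OF hol V(1) C1_holo_const])
    also have "\<dots> = (\<Sum>\<gamma>\<leftarrow>\<Gamma>. cscale (2 * pi * \<i> * winding_number \<gamma> z) (1::'a))"
    proof (intro arg_cong[of _ _ sum_list] map_cong refl)
      fix \<gamma> assume \<gamma>: "\<gamma> \<in> set \<Gamma>"
      then have z\<gamma>: "z \<notin> path_image \<gamma>" using zV V(2) by (auto simp: Im_def)
      have "(\<lambda>\<zeta>. 1 / (\<zeta> - z)) contour_integrable_on \<gamma>"
        using \<Gamma>[OF \<gamma>] z\<gamma> by (intro contour_integrable_inversediff) auto
      then show "alg_contour_integral (\<lambda>\<zeta>. cscale (1 / (\<zeta> - z)) (1::'a)) \<gamma> = cscale (2 * pi * \<i> * winding_number \<gamma> z) 1"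
        using winding_number_valid_path[of \<gamma> z] \<Gamma>[OF \<gamma>] z\<gamma> by (simp add: alg_contour_integral_cscale)
    qed
    also have "\<dots> = cscale (2 * pi * \<i> * ?N z) (1::'a)"
      by (induction \<Gamma>) (simp_all add: cscale.zero_left distrib_left cscale_add_left)
    finally show "chain_integral (\<lambda>\<zeta>. cscale (1 / (\<zeta> - z)) (1::'a)) E0 = cscale (2 * pi * \<i> * ?N z) 1" .
  qed
  define A where "A c = {z. z \<notin> T \<and> ?N z = c}" for c
  have opA: "open (A c)" if "c \<in> \<int>" for c
    unfolding A_def using open_winding_level[OF \<Gamma>' T(2) _ that] VT V(2) by (auto simp: Im_def)
  have im0: "chain_image E0 \<subseteq> T" using E0(1) VT by blast
  \<comment> \<open>Change of chain for the constant function 1, with \<open>E1\<close> as inner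
    chain: the polygon winds once around each point of \<open>A 1\<close>, and it lies off
    \<open>A 1\<close>, where the kernel integrates to 0 over \<open>E1\<close>. Cancelling one
    factor \<open>2 pi i\<close> leaves the claim.\<close>
  have P: "chain_integral (resolvent a) E0 = cscale (2 * pi * \<i>) 1"
  proof -
    have sA: "spec a \<subseteq> A 1" using TU N1 by (auto simp: A_def)
    obtain E1 where E1: "spectral_chain a (A 1) E1"
      using spectral_chain_exists[OF opA sA] by auto
    then have cE1: "cauchy_chain (spec a) (A 1) E1"
      and RE1: "chain_integral (resolvent a) E1 = cscale (2 * pi * \<i>) 1"
      by (auto simp: spectral_chain_def)
    have im1: "chain_image E1 \<subseteq> A 1 - spec a" using cE1 by (rule cauchy_chain_image)
    have "cscale (2 * pi * \<i>) (calc_integral a (\<lambda>_. 1) E1) = chain_integral (resolvent a) E1 * calc_integral a (\<lambda>_. 1) E0"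
    proof (rule calc_integral_change_chain)
      show "cchain (\<lambda>\<zeta>. 1 / (\<zeta> - z)) E0 = 2 * pi * \<i> * 1" if "z \<in> chain_image E1" for z
        using wind[of z] that im1 by (auto simp: A_def)
      show "cchain (\<lambda>z. 1 / (\<zeta> - z)) E1 = 0" if "\<zeta> \<in> chain_image E0" for \<zeta>
        by (rule cauchy_chain_outside[OF cE1]) (use that im0 in \<open>auto simp: A_def\<close>)
    qed (use im0 im1 TU in \<open>auto simp: A_def\<close>)
    then have "cscale (2 * pi * \<i>) (cscale (2 * pi * \<i>) 1) = cscale (2 * pi * \<i>) (chain_integral (resolvent a) E0)"
      by (simp add: calc_integral_def RE1 cscale_1_mult)
    then show ?thesis by (rule cscale_left_inject[rotated, symmetric]) simp
  qed
  \<comment> \<open>\<open>- A 0\<close> consists of \<open>T\<close> and the points of nonzero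
    winding number. A chain off \<open>K\<close> thus lies where the kernel integrates to 0 over
    \<open>E0\<close>, and \<open>closure W\<close> is included so that the same chain encloses
    \<open>E\<close>.\<close>
  define K where "K = closure W \<union> - A 0"
  \<comment> \<open>Outside a large disc every point is off \<open>T\<close> and has winding number
    0.\<close>
  have "compact (- A 0)"
  proof -
    obtain B where B: "\<And>z. norm z \<ge> B \<Longrightarrow> ?N z = 0"
      using winding_number_sum_zero_at_infinity[OF \<Gamma>'] by auto
    obtain B' where B': "\<And>z. z \<in> T \<Longrightarrow> norm z \<le> B'"
      using compact_imp_bounded[OF T(1)] unfolding bounded_iff by auto
    have "norm z \<le> max B B'" if "z \<in> - A 0" for z
      using that B[of z] B'[of z] by (force simp: A_def)
    then have "bounded (- A 0)" unfolding bounded_iff by blast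
    moreover have "closed (- A 0)" using opA[of 0] by (simp add: closed_Compl)
    ultimately show ?thesis by (simp add: compact_eq_bounded_closed)
  qed
  then have K: "compact K" using W(2) by (simp add: K_def compact_Un)
  have KU: "K \<subseteq> U" using W(3) N0 TU by (auto simp: K_def A_def)
  obtain E2 where E2: "cauchy_chain K U E2"
    using cauchy_chain_exists[OF K U KU] by metis
  have im2: "chain_image E2 \<subseteq> U - K" using E2 by (rule cauchy_chain_image)
  have WK: "W \<subseteq> K" using closure_subset by (auto simp: K_def)
  have TK: "T \<subseteq> K" by (auto simp: K_def A_def)
  have "cscale (2 * pi * \<i>) (calc_integral a f E0) = chain_integral (resolvent a) E0 * calc_integral a f E2"
  proof (rule calc_integral_change_chain)
    show "cchain (\<lambda>\<zeta>. f \<zeta> / (\<zeta> - z)) E2 = 2 * pi * \<i> * f z" if "z \<in> chain_image E0" for z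
      by (rule cauchy_chain_formula[OF E2 f]) (use that im0 TK in blast)
    show "cchain (\<lambda>z. 1 / (\<zeta> - z)) E0 = 0" if "\<zeta> \<in> chain_image E2" for \<zeta>
    proof -
      have "\<zeta> \<in> A 0" "\<zeta> \<notin> T" using that im2 TK by (auto simp: K_def)
      then show ?thesis using wind[of \<zeta>] cchain_pole_swap[of \<zeta> E0] im0 by (auto simp: A_def)
    qed
    show "continuous_on (chain_image E0) f" "continuous_on (chain_image E2) f"
      by (rule continuous_on_subset[OF holomorphic_on_imp_continuous_on[OF f]]; use im0 im2 TU in blast)+
  qed (use im0 im2 TU TK WK W(4) in blast)+
  then have "calc_integral a f E0 = calc_integral a f E2"
    unfolding P cscale_1_mult by (rule cscale_left_inject[rotated]) simp
  also have "\<dots> = calc_integral a f E"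
    using calc_integral_spectral_chain_eq[OF E E2 W(4) WK KU f] by simp
  finally have eq: "calc_integral a f E0 = calc_integral a f E" .
  have "V \<subseteq> U - spec a" using VT TU by blast
  then have "C1_holo V (\<lambda>z. cscale (f z) (resolvent a z))"
    by (intro C1_holo_cscale C1_holo_resolvent V(1) holomorphic_on_subset[OF f]) auto
  then show ?thesis using E0(2) eq by (simp add: calc_integral_def)
qed

text \<open>An admissible cycle exists and all of them give this value, so the choice made by
  \<open>SOME\<close> is immaterial.\<close>

theorem hfc_spectral_chain:
  fixes a :: "'a::complex_banach_algebra"
  assumes U: "open U" and f: "f holomorphic_on U" and E: "spectral_chain a W E"
    and W: "open W" "compact (closure W)" "closure W \<subseteq> U" "spec a \<subseteq> W"
  shows "hfc U f a = cscale (1 / (2 * pi * \<i>)) (calc_integral a f E)"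
proof -
  have sU: "spec a \<subseteq> U" using W(3,4) closure_subset by blast
  let ?I = "\<lambda>\<Gamma>. cscale (1 / (2 * pi * \<i>))
      (\<Sum>\<gamma>\<leftarrow>\<Gamma>. alg_contour_integral (\<lambda>z. cscale (f z) (ba_inv (cscale z 1 - a))) \<gamma>)"
  have I: "?I \<Gamma> = cscale (1 / (2 * pi * \<i>)) (calc_integral a f E)" if "admissible_cycle U (spec a) \<Gamma>" for \<Gamma>
    using admissible_cycle_integral[OF that U f E W] by (simp add: resolvent_def)
  obtain \<Gamma> where \<Gamma>: "admissible_cycle U (spec a) \<Gamma>"
    using admissible_cycle_exists[OF U sU] by blast
  have "\<exists>\<Gamma>. admissible_cycle U (spec a) \<Gamma> \<and> hfc U f a = ?I \<Gamma>"
    unfolding hfc_def by (rule someI_ex) (use \<Gamma> in blast)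
  then show ?thesis using I by metis
qed

lemma hfc_power:
  fixes a :: "'a::complex_banach_algebra"
  assumes U: "open U" and f: "f holomorphic_on U" and E: "spectral_chain a W E"
    and W: "open W" "compact (closure W)" "closure W \<subseteq> U" "spec a \<subseteq> W"
  shows "hfc U f a ^ n = cscale (1 / (2 * pi * \<i>)) (calc_integral a (\<lambda>z. f z ^ n) E)"
proof (induction n)
  case 0
  \<comment> \<open>The zeroth power is the normalisation contained in
    \<open>spectral_chain\<close>.\<close>
  show ?case using E by (simp add: calc_integral_def spectral_chain_def cscale_cscale)
next
  case (Suc n)
  let ?c = "1 / (2 * pi * \<i>)"
  have "hfc U f a ^ Suc n = cscale ?c (calc_integral a f E) * cscale ?c (calc_integral a (\<lambda>z. f z ^ n) E)"
    using Suc hfc_spectral_chain[OF assms] by simp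
  also have "\<dots> = cscale (?c * ?c) (calc_integral a f E * calc_integral a (\<lambda>z. f z ^ n) E)"
    by (simp add: cscale_mult_left cscale_mult_right cscale_cscale)
  also have "calc_integral a f E * calc_integral a (\<lambda>z. f z ^ n) E
      = cscale (2 * pi * \<i>) (calc_integral a (\<lambda>z. f z * f z ^ n) E)"
    by (rule calc_integral_spectral_chain_mult[OF E W U f]) (intro holomorphic_intros f)
  also have "cscale (?c * ?c) (cscale (2 * pi * \<i>) x) = cscale ?c x" for x :: 'a
  proof -
    have "?c * ?c * (2 * pi * \<i>) = ?c" by simp
    then show ?thesis by (simp only: cscale_cscale)
  qed
  finally show ?case by (simp only: power_Suc)
qed

section \<open>The double integral\<close>

lemma Cpow_scaleR:
  "Cpow a b n = (\<Sum>k\<le>n. ((-1) ^ k * real (n choose k)) *\<^sub>R (a ^ (n - k) * b ^ k))"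
proof -
  have "(-1) ^ k * of_nat m = (of_real ((-1) ^ k * real m) :: 'a)" for k m by simp
  then show ?thesis unfolding Cpow_def by (simp add: scaleR_conv_of_real mult.assoc)
qed

lemma Cpow_0 [simp]: "Cpow a b 0 = 1"
  by (simp add: Cpow_def)

text \<open>Pascal's rule. This recursion, one more application of \<open>L_a - R_b\<close>, is what
  all later arguments use in place of the binomial sum.\<close>

lemma Cpow_Suc: "Cpow a b (Suc n) = a * Cpow a b n - Cpow a b n * b"
proof -
  define t where "t k = a ^ (Suc n - k) * b ^ k" for k
  define c where "c m k = (-1) ^ k * real (m choose k)" for m k
  have "Cpow a b (Suc n) = (\<Sum>k\<le>Suc n. c (Suc n) k *\<^sub>R t k)"
    by (simp add: Cpow_scaleR c_def t_def)
  also have "\<dots> = t 0 + (\<Sum>k\<le>n. c (Suc n) (Suc k) *\<^sub>R t (Suc k))"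
    by (simp add: sum.atMost_Suc_shift c_def del: sum.atMost_Suc)
  also have "(\<Sum>k\<le>n. c (Suc n) (Suc k) *\<^sub>R t (Suc k)) =
      (\<Sum>k\<le>n. c n (Suc k) *\<^sub>R t (Suc k)) - (\<Sum>k\<le>n. c n k *\<^sub>R t (Suc k))"
    unfolding sum_subtractf[symmetric]
    by (rule sum.cong) (simp_all add: c_def algebra_simps)
  also have "t 0 + ((\<Sum>k\<le>n. c n (Suc k) *\<^sub>R t (Suc k)) - (\<Sum>k\<le>n. c n k *\<^sub>R t (Suc k)))
      = (\<Sum>k\<le>Suc n. c n k *\<^sub>R t k) - (\<Sum>k\<le>n. c n k *\<^sub>R t (Suc k))"
    by (simp add: sum.atMost_Suc_shift c_def del: sum.atMost_Suc)
  \<comment> \<open>The top term drops out, since \<open>n choose Suc n\<close> is 0.\<close>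
  also have "(\<Sum>k\<le>Suc n. c n k *\<^sub>R t k) = a * Cpow a b n"
    by (simp add: c_def t_def Cpow_scaleR sum_distrib_left Suc_diff_le mult.assoc)
  also have "(\<Sum>k\<le>n. c n k *\<^sub>R t (Suc k)) = Cpow a b n * b"
    by (simp add: c_def t_def Cpow_scaleR sum_distrib_right mult.assoc power_commutes)
  finally show ?thesis .
qed

lemma norm_Cpow_le: "norm (Cpow a b n) \<le> (norm a + norm b) ^ n"
proof (induction n)
  case (Suc n)
  have "norm (Cpow a b (Suc n)) \<le> norm (a * Cpow a b n) + norm (Cpow a b n * b)"
    unfolding Cpow_Suc by (rule norm_triangle_ineq4)
  also have "\<dots> \<le> norm a * norm (Cpow a b n) + norm (Cpow a b n) * norm b"
    by (intro add_mono norm_mult_ineq)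
  also have "\<dots> = (norm a + norm b) * norm (Cpow a b n)" by (simp add: algebra_simps)
  also have "\<dots> \<le> (norm a + norm b) * (norm a + norm b) ^ n"
    using Suc by (intro mult_left_mono) auto
  finally show ?case by simp
qed simp

lemma rho_nonneg: "0 \<le> rho a b"
  unfolding rho_def by (rule le_Limsup) (simp_all add: real_root_ge_zero)

lemma rho_le: "rho a b \<le> ereal (norm a + norm b)"
  unfolding rho_def
proof (rule Limsup_bounded)
  show "\<forall>\<^sub>F n in sequentially. ereal (root n (norm (Cpow a b n))) \<le> ereal (norm a + norm b)"
    using eventually_gt_at_top[of 0]
  proof eventually_elim
    case (elim n)
    have "root n (norm (Cpow a b n)) \<le> root n ((norm a + norm b) ^ n)"
      using elim norm_Cpow_le by (intro real_root_le_mono)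
    also have "\<dots> = norm a + norm b" using elim by (simp add: real_root_power_cancel)
    finally show ?case by simp
  qed
qed

lemma rho_real:
  obtains r where "rho a b = ereal r" "r \<ge> 0"
  using rho_nonneg[of a b] rho_le[of a b] by (cases "rho a b") auto

lemma rho_zero_summable:
  assumes "rho a b = 0" "K \<ge> 0"
  shows "summable (\<lambda>n. norm (Cpow a b n) * K ^ n)"
proof -
  \<comment> \<open>Chosen so that \<open>d * K \<le> 1/2\<close>: eventually the norms are at most
    \<open>d ^ n\<close>, which leaves a geometric majorant. Here \<open>K + 1\<close> keeps the
    denominator positive.\<close>
  define d where "d = 1 / (2 * (K + 1))"
  have d: "d > 0" "d * K \<le> 1/2" using assms(2) by (simp_all add: d_def field_simps)
  have "limsup (\<lambda>n. ereal (root n (norm (Cpow a b n)))) < ereal d"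
    using assms(1) d(1) by (simp add: rho_def)
  then have "\<forall>\<^sub>F n in sequentially. ereal (root n (norm (Cpow a b n))) < ereal d"
    by (rule Limsup_lessD)
  then have "\<forall>\<^sub>F n in sequentially. norm (norm (Cpow a b n) * K ^ n) \<le> (1/2) ^ n"
    using eventually_gt_at_top[of 0]
  proof eventually_elim
    case (elim n)
    have "norm (Cpow a b n) = root n (norm (Cpow a b n)) ^ n"
      using elim by (simp add: real_root_pow_pos2)
    also have "\<dots> \<le> d ^ n" using elim by (intro power_mono) (auto simp: real_root_ge_zero)
    finally have "norm (Cpow a b n) * K ^ n \<le> d ^ n * K ^ n"
      using assms(2) by (intro mult_right_mono) auto
    also have "\<dots> \<le> (1/2) ^ n"
      unfolding power_mult_distrib[symmetric] using d assms(2) by (intro power_mono) auto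
    finally show ?case using assms(2) by simp
  qed
  then show ?thesis by (rule summable_comparison_test_ev) (simp add: summable_geometric)
qed

lemma norm_power_mult_le:
  fixes x y :: "'a::real_normed_algebra_1"
  shows "norm (x * y ^ n) \<le> norm x * norm y ^ n" "norm (y ^ n * x) \<le> norm x * norm y ^ n"
proof -
  show "norm (x * y ^ n) \<le> norm x * norm y ^ n"
    by (intro order_trans[OF norm_mult_ineq] mult_left_mono norm_power_ineq) auto
  show "norm (y ^ n * x) \<le> norm x * norm y ^ n"
    by (subst mult.commute[of "norm x"], intro order_trans[OF norm_mult_ineq] mult_right_mono norm_power_ineq) auto
qed

text \<open>With \<open>R\<close> the resolvent of \<open>b\<close> at \<open>z\<close>, the series of \<open>Cpow a b n * R ^ Suc n\<close> and of
  \<open>(-1) ^ n * R ^ Suc n * Cpow b a n\<close> telescope to a right and a left inverse of \<open>z - a\<close>.\<close>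

lemma spec_subset_if_rho_zero:
  assumes ab: "rho a b = 0" and ba: "rho b a = 0"
  shows "spec a \<subseteq> spec b"
proof (rule subsetI, rule ccontr)
  fix z assume za: "z \<in> spec a" and zb: "z \<notin> spec b"
  let ?R = "resolvent b z" and ?A = "cscale z 1 - a" and ?B = "cscale z 1 - b"
  have R: "?B * ?R = 1" "?R * ?B = 1"
    using resolvent_right[OF zb] resolvent_left[OF zb] by auto
  define s where "s n = Cpow a b n * ?R ^ n" for n
  have sums: "summable s"
    by (rule summable_comparison_test'[OF rho_zero_summable[OF ab norm_ge_zero[of ?R]], of 0])
      (simp add: s_def norm_power_mult_le)
  have "?A * (s n * ?R) = s n - s (Suc n)" for n
  proof -
    have "?A * Cpow a b n = Cpow a b n * ?B - Cpow a b (Suc n)"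
      by (simp add: Cpow_Suc algebra_simps cscale_1_mult mult_cscale_1)
    then have "?A * Cpow a b n * (?R * ?R ^ n) = Cpow a b n * (?B * ?R) * ?R ^ n - Cpow a b (Suc n) * ?R ^ Suc n"
      by (simp add: left_diff_distrib mult.assoc)
    then show ?thesis by (simp add: s_def R mult.assoc power_commutes)
  qed
  moreover have "(\<lambda>n. s n - s (Suc n)) sums (s 0 - 0)"
    by (rule telescope_sums'[OF summable_LIMSEQ_zero[OF sums]])
  ultimately have "(\<lambda>n. ?A * (s n * ?R)) sums 1" by (simp add: s_def)
  moreover have "(\<lambda>n. ?A * (s n * ?R)) sums (?A * (suminf s * ?R))"
    by (intro sums_mult sums_mult2 summable_sums sums)
  ultimately have right: "?A * (suminf s * ?R) = 1" using sums_unique2 by blast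
  define t where "t n = (-1) ^ n *\<^sub>R (?R ^ n * Cpow b a n)" for n
  have sumt: "summable t"
    by (rule summable_comparison_test'[OF rho_zero_summable[OF ba norm_ge_zero[of ?R]], of 0])
      (simp add: t_def norm_power_mult_le power_abs)
  have "(?R * t n) * ?A = t n - t (Suc n)" for n
  proof -
    have "Cpow b a n * ?A = ?B * Cpow b a n + Cpow b a (Suc n)"
      by (simp add: Cpow_Suc algebra_simps cscale_1_mult mult_cscale_1)
    then have "(?R ^ n * ?R) * (Cpow b a n * ?A) = ?R ^ n * (?R * ?B) * Cpow b a n + ?R ^ Suc n * Cpow b a (Suc n)"
      by (simp add: distrib_left mult.assoc power_Suc2 del: power_Suc)
    then show ?thesis by (simp add: t_def R mult.assoc power_commutes scaleR_add_right flip: mult.assoc)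
  qed
  moreover have "(\<lambda>n. t n - t (Suc n)) sums (t 0 - 0)"
    by (rule telescope_sums'[OF summable_LIMSEQ_zero[OF sumt]])
  ultimately have "(\<lambda>n. (?R * t n) * ?A) sums 1" by (simp add: t_def)
  moreover have "(\<lambda>n. (?R * t n) * ?A) sums ((?R * suminf t) * ?A)"
    by (intro sums_mult sums_mult2 summable_sums sumt)
  ultimately have left: "(?R * suminf t) * ?A = 1" using sums_unique2 by blast
  from ba_invertibleI[OF right left] za show False by (simp add: spec_def)
qed

text \<open>An empty spectrum would admit \<open>W = {}\<close>, where only the empty chain fits;
  its resolvent integral is 0 instead of \<open>2 pi i\<close>. Nonemptiness later ensures that the
  supremum is taken over a nonempty set.\<close>

lemma spec_nonempty: "spec (a::'a::complex_banach_algebra) \<noteq> {}"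
proof
  assume e: "spec a = {}"
  then obtain E where E: "spectral_chain a {} E" using spectral_chain_exists[of "{}" a] by auto
  then have "chain_image E = {}" unfolding spectral_chain_def cauchy_chain_def by auto
  then have "E = []" by (cases E) auto
  then have "cscale (2 * pi * \<i>) (1::'a) = cscale 0 1"
    using E by (simp add: spectral_chain_def cscale.zero_left)
  then show False unfolding cscale_1_inject by simp
qed

text \<open>The middle element \<open>x\<close> is a parameter so that a factor \<open>z - w\<close>
  of \<open>h\<close> can be traded for an application of \<open>L_a - R_b\<close> to
  \<open>x\<close>.\<close>

definition double_integral ::
    "'a::complex_banach_algebra \<Rightarrow> 'a \<Rightarrow> (complex \<Rightarrow> complex \<Rightarrow> complex) \<Rightarrow> 'a \<Rightarrow>
      (complex \<times> complex) list \<Rightarrow> (complex \<times> complex) list \<Rightarrow> 'a" where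
  "double_integral a b h x E E' =
     chain_integral (\<lambda>z. chain_integral (\<lambda>w. cscale (h z w) (resolvent a z * x * resolvent b w)) E') E"

context
  fixes a b :: "'a::complex_banach_algebra" and E E' :: "(complex \<times> complex) list"
  assumes disj: "chain_image E \<inter> spec a = {}" "chain_image E' \<inter> spec b = {}"
begin

lemma double_integrand_continuous:
  assumes "continuous_on (chain_image E \<times> chain_image E') (\<lambda>p. h (fst p) (snd p))"
  shows "continuous_on (chain_image E \<times> chain_image E')
    (\<lambda>p. cscale (h (fst p) (snd p)) (resolvent a (fst p) * x * resolvent b (snd p)))"
  using assms disj by (auto intro!: continuous_intros)

lemma double_integral_cong:
  assumes "\<And>z w. z \<in> chain_image E \<Longrightarrow> w \<in> chain_image E' \<Longrightarrow> h z w = h' z w"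
  shows "double_integral a b h x E E' = double_integral a b h' x E E'"
  unfolding double_integral_def
  by (rule chain_integral_cong, rule chain_integral_cong) (simp add: assms)

lemma double_integral_diff:
  assumes h: "continuous_on (chain_image E \<times> chain_image E') (\<lambda>p. h (fst p) (snd p))"
    and h': "continuous_on (chain_image E \<times> chain_image E') (\<lambda>p. h' (fst p) (snd p))"
  shows "double_integral a b (\<lambda>z w. h z w - h' z w) x E E'
    = double_integral a b h x E E' - double_integral a b h' x E E'"
proof -
  note c = double_integrand_continuous[OF h, of x] and c' = double_integrand_continuous[OF h', of x]
  have "double_integral a b (\<lambda>z w. h z w - h' z w) x E E' =
    chain_integral (\<lambda>z. chain_integral (\<lambda>w. cscale (h z w) (resolvent a z * x * resolvent b w)) E'
      - chain_integral (\<lambda>w. cscale (h' z w) (resolvent a z * x * resolvent b w)) E') E"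
    unfolding double_integral_def
  proof (rule chain_integral_cong)
    fix z assume z: "z \<in> chain_image E"
    show "chain_integral (\<lambda>w. cscale (h z w - h' z w) (resolvent a z * x * resolvent b w)) E' =
      chain_integral (\<lambda>w. cscale (h z w) (resolvent a z * x * resolvent b w)) E'
      - chain_integral (\<lambda>w. cscale (h' z w) (resolvent a z * x * resolvent b w)) E'"
      unfolding cscale.diff_left
      by (rule chain_integral_diff[OF continuous_on_fst_section[OF c z] continuous_on_fst_section[OF c' z]])
  qed
  also have "\<dots> = double_integral a b h x E E' - double_integral a b h' x E E'"
    unfolding double_integral_def
    by (rule chain_integral_diff[OF continuous_on_chain_param[OF c] continuous_on_chain_param[OF c']])
  finally show ?thesis .
qed

lemma double_integral_product:
  assumes f: "continuous_on (chain_image E) f" and g: "continuous_on (chain_image E') g"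
  shows "calc_integral a f E * calc_integral b g E' = double_integral a b (\<lambda>z w. f z * g w) 1 E E'"
proof -
  have R: "continuous_on (chain_image E) (resolvent a)" "continuous_on (chain_image E') (resolvent b)"
    using disj by (auto intro!: continuous_intros)
  have "calc_integral a f E * calc_integral b g E'
      = chain_integral (\<lambda>z. cscale (f z) (resolvent a z) * calc_integral b g E') E"
    unfolding calc_integral_def[of a] by (intro chain_integral_mult_right[symmetric] continuous_intros f R)
  also have "\<dots> = chain_integral (\<lambda>z. chain_integral (\<lambda>w. cscale (f z) (resolvent a z) * cscale (g w) (resolvent b w)) E') E"
    unfolding calc_integral_def
    by (rule chain_integral_cong, rule chain_integral_mult_left[symmetric], intro continuous_intros g R)
  finally show ?thesis
    by (simp add: double_integral_def cscale_mult_left cscale_mult_right cscale_cscale mult.commute)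
qed

text \<open>The correction terms \<open>x R\<^sub>b\<close> and \<open>R\<^sub>a x\<close> in the expansion of \<open>(z - w) R\<^sub>a x R\<^sub>b\<close> each depend on
  one variable only, so integrating over the other variable kills them.\<close>

lemma double_integral_shift:
  assumes h: "continuous_on (chain_image E \<times> chain_image E') (\<lambda>p. h (fst p) (snd p))"
    and h1: "\<And>w. w \<in> chain_image E' \<Longrightarrow> cchain (\<lambda>z. h z w) E = 0"
    and h2: "\<And>z. z \<in> chain_image E \<Longrightarrow> cchain (\<lambda>w. h z w) E' = 0"
  shows "double_integral a b (\<lambda>z w. (z - w) * h z w) x E E' = double_integral a b h (a * x - x * b) E E'"
proof -
  let ?Ra = "resolvent a" and ?Rb = "resolvent b"
  let ?A = "\<lambda>z w. cscale (h z w) (?Ra z * (a * x - x * b) * ?Rb w)"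
  let ?B = "\<lambda>z w. cscale (h z w) (x * ?Rb w)"
  let ?C = "\<lambda>z w. cscale (h z w) (?Ra z * x)"
  note cA = double_integrand_continuous[OF h, of "a * x - x * b"]
  have cB: "continuous_on (chain_image E \<times> chain_image E') (\<lambda>p. ?B (fst p) (snd p))"
    and cC: "continuous_on (chain_image E \<times> chain_image E') (\<lambda>p. ?C (fst p) (snd p))"
    using h disj by (auto intro!: continuous_intros)
  have eq: "cscale ((z - w) * h z w) (?Ra z * x * ?Rb w) = ?A z w + (?B z w - ?C z w)"
    if z: "z \<in> chain_image E" and w: "w \<in> chain_image E'" for z w
  proof -
    have "z \<notin> spec a" "w \<notin> spec b" using z w disj by auto
    then have "?Ra z * a = cscale z (?Ra z) - 1" "b * ?Rb w = cscale w (?Rb w) - 1"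
      by (auto intro: resolvent_mult)
    moreover have "?Ra z * (a * x - x * b) * ?Rb w = (?Ra z * a) * x * ?Rb w - ?Ra z * x * (b * ?Rb w)"
      by (simp add: algebra_simps)
    ultimately have "?Ra z * (a * x - x * b) * ?Rb w
        = cscale (z - w) (?Ra z * x * ?Rb w) - x * ?Rb w + ?Ra z * x"
      by (simp add: left_diff_distrib right_diff_distrib cscale_mult_left cscale_mult_right cscale.diff_left)
    then have "cscale (z - w) (?Ra z * x * ?Rb w) = ?Ra z * (a * x - x * b) * ?Rb w + (x * ?Rb w - ?Ra z * x)"
      by (simp add: algebra_simps)
    then have "cscale (h z w) (cscale (z - w) (?Ra z * x * ?Rb w)) = ?A z w + (?B z w - ?C z w)"
      by (simp only: cscale.add_right cscale.diff_right)
    then show ?thesis by (simp add: cscale_cscale mult.commute)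
  qed
  have "double_integral a b (\<lambda>z w. (z - w) * h z w) x E E' =
    chain_integral (\<lambda>z. chain_integral (?A z) E' + chain_integral (?B z) E') E"
    unfolding double_integral_def
  proof (rule chain_integral_cong)
    fix z assume z: "z \<in> chain_image E"
    note s = continuous_on_fst_section[OF cA z] continuous_on_fst_section[OF cB z] continuous_on_fst_section[OF cC z]
    have "chain_integral (\<lambda>w. cscale ((z - w) * h z w) (?Ra z * x * ?Rb w)) E'
        = chain_integral (\<lambda>w. ?A z w + (?B z w - ?C z w)) E'"
      by (rule chain_integral_cong) (rule eq[OF z])
    also have "\<dots> = chain_integral (?A z) E' + (chain_integral (?B z) E' - chain_integral (?C z) E')"
      by (simp only: chain_integral_add[OF s(1) continuous_on_diff[OF s(2,3)]] chain_integral_diff[OF s(2,3)])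
    also have "chain_integral (?C z) E' = 0"
      using chain_integral_cscale_left[OF continuous_on_fst_section[OF h z]] h2[OF z]
      by (simp add: cscale.zero_left)
    finally show "chain_integral (\<lambda>w. cscale ((z - w) * h z w) (?Ra z * x * ?Rb w)) E' =
      chain_integral (?A z) E' + chain_integral (?B z) E'" by simp
  qed
  also have "\<dots> = chain_integral (\<lambda>z. chain_integral (?A z) E') E + chain_integral (\<lambda>z. chain_integral (?B z) E') E"
    by (rule chain_integral_add[OF continuous_on_chain_param[OF cA] continuous_on_chain_param[OF cB]])
  also have "chain_integral (\<lambda>z. chain_integral (?B z) E') E = chain_integral (\<lambda>w. chain_integral (\<lambda>z. ?B z w) E) E'"
    by (rule chain_swap[OF cB])
  also have "\<dots> = chain_integral (\<lambda>w. 0 * 0) E'"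
  proof (rule chain_integral_cong)
    fix w assume w: "w \<in> chain_image E'"
    show "chain_integral (\<lambda>z. ?B z w) E = 0 * 0"
      using chain_integral_cscale_left[OF continuous_on_fst_section[OF continuous_on_prod_swap[OF h] w]] h1[OF w]
      by (simp add: cscale.zero_left)
  qed
  also have "\<dots> = 0" by (subst chain_integral_mult_left) auto
  finally show ?thesis by (simp add: double_integral_def)
qed

text \<open>The constant depends on the chains and on bounds for the resolvents on them. Being
  uniform in \<open>h\<close> and \<open>x\<close>, it stays fixed when \<open>h\<close> is an
  \<open>n\<close>-th power and disappears under \<open>n\<close>-th roots.\<close>

lemma double_integral_bound:
  obtains C where "C \<ge> 0"
    "\<And>h x B. continuous_on (chain_image E \<times> chain_image E') (\<lambda>p. h (fst p) (snd p)) \<Longrightarrow> 0 \<le> B \<Longrightarrow>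
      (\<And>z w. z \<in> chain_image E \<Longrightarrow> w \<in> chain_image E' \<Longrightarrow> norm (h z w) \<le> B) \<Longrightarrow>
      norm (double_integral a b h x E E') \<le> C * B * norm x"
proof -
  obtain L where L: "L \<ge> 0" "\<And>(F::complex \<Rightarrow> 'a) B. continuous_on (chain_image E) F \<Longrightarrow>
    (\<And>z. z \<in> chain_image E \<Longrightarrow> norm (F z) \<le> B) \<Longrightarrow> norm (chain_integral F E) \<le> L * B"
    using chain_integral_norm_bound[of E, where 'a = 'a] by blast
  obtain L' where L': "L' \<ge> 0" "\<And>(F::complex \<Rightarrow> 'a) B. continuous_on (chain_image E') F \<Longrightarrow>
    (\<And>z. z \<in> chain_image E' \<Longrightarrow> norm (F z) \<le> B) \<Longrightarrow> norm (chain_integral F E') \<le> L' * B"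
    using chain_integral_norm_bound[of E', where 'a = 'a] by blast
  have "bounded (resolvent a ` chain_image E)" "bounded (resolvent b ` chain_image E')"
    by (intro compact_imp_bounded compact_continuous_image compact_chain_image continuous_intros; use disj in auto)+
  then obtain A A' where A: "A > 0" "\<And>z. z \<in> chain_image E \<Longrightarrow> norm (resolvent a z) \<le> A"
    and A': "A' > 0" "\<And>w. w \<in> chain_image E' \<Longrightarrow> norm (resolvent b w) \<le> A'"
    unfolding bounded_pos by auto
  show ?thesis
  proof (rule that[of "L * L' * A * A'"])
    show "0 \<le> L * L' * A * A'" using L(1) L'(1) A(1) A'(1) by simp
    fix h :: "complex \<Rightarrow> complex \<Rightarrow> complex" and x :: 'a and B :: real
    assume h: "continuous_on (chain_image E \<times> chain_image E') (\<lambda>p. h (fst p) (snd p))" and "0 \<le> B"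
      and B: "\<And>z w. z \<in> chain_image E \<Longrightarrow> w \<in> chain_image E' \<Longrightarrow> norm (h z w) \<le> B"
    note c = double_integrand_continuous[OF h, of x]
    have "norm (double_integral a b h x E E') \<le> L * (L' * (B * (A * norm x * A')))"
      unfolding double_integral_def
    proof (rule L(2)[OF continuous_on_chain_param[OF c]])
      fix z assume z: "z \<in> chain_image E"
      show "norm (chain_integral (\<lambda>w. cscale (h z w) (resolvent a z * x * resolvent b w)) E')
          \<le> L' * (B * (A * norm x * A'))"
      proof (rule L'(2)[OF continuous_on_fst_section[OF c z]])
        fix w assume w: "w \<in> chain_image E'"
        have "norm (resolvent a z * x * resolvent b w) \<le> norm (resolvent a z) * norm x * norm (resolvent b w)"
          by (intro order_trans[OF norm_mult_ineq] mult_right_mono norm_mult_ineq) auto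
        also have "\<dots> \<le> A * norm x * A'"
          using A A' z w by (intro mult_mono) auto
        finally show "norm (cscale (h z w) (resolvent a z * x * resolvent b w)) \<le> B * (A * norm x * A')"
          unfolding norm_cscale using B[OF z w] \<open>0 \<le> B\<close> by (intro mult_mono) auto
      qed
    qed
    then show "norm (double_integral a b h x E E') \<le> L * L' * A * A' * B * norm x"
      by (simp add: mult_ac)
  qed
qed

end

section \<open>Difference quotients and the main estimate\<close>

definition diff_quot :: "(complex \<Rightarrow> complex) \<Rightarrow> complex \<Rightarrow> complex \<Rightarrow> complex" where
  "diff_quot f z w = (if z = w then deriv f w else (f z - f w) / (z - w))"

lemma diff_quot_commute: "diff_quot f z w = diff_quot f w z"
  using minus_divide_divide[of "f z - f w" "z - w"] by (simp add: diff_quot_def)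

lemma diff_quot_mult: "(z - w) * diff_quot f z w = f z - f w"
  by (simp add: diff_quot_def)

lemma diff_quot_holomorphic:
  assumes "f holomorphic_on U" "open U"
  shows "(\<lambda>z. diff_quot f z w) holomorphic_on U" "(\<lambda>w. diff_quot f z w) holomorphic_on U"
proof -
  show 1: "(\<lambda>z. diff_quot f z w) holomorphic_on U" for w
    unfolding diff_quot_def by (rule pole_lemma_open[OF assms])
  show "(\<lambda>w. diff_quot f z w) holomorphic_on U"
    using 1[of z] by (simp add: diff_quot_commute[of f z])
qed

text \<open>Near a diagonal point \<open>(c, c)\<close> the mean value inequality is applied to
  \<open>f u - deriv f c * u\<close> on a ball where \<open>deriv f\<close> is within
  \<open>e / 2\<close> of \<open>deriv f c\<close>; dividing by \<open>z - w\<close> gives the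
  estimate uniformly in both variables.\<close>

lemma diff_quot_continuous:
  assumes f: "f holomorphic_on U" and U: "open U"
  shows "continuous_on (U \<times> U) (\<lambda>p. diff_quot f (fst p) (snd p))"
proof (rule continuous_at_imp_continuous_on, rule ballI)
  fix p assume p: "p \<in> U \<times> U"
  have cf: "continuous_on U f" using f by (rule holomorphic_on_imp_continuous_on)
  show "isCont (\<lambda>p. diff_quot f (fst p) (snd p)) p"
  proof (cases "fst p = snd p")
    case False
    define V where "V = {q. fst q \<noteq> (snd q :: complex)} \<inter> (U \<times> U)"
    have V: "open V" "p \<in> V"
      unfolding V_def using U p False
      by (auto intro!: open_Int open_Collect_neq open_Times continuous_intros)
    have "continuous_on V (\<lambda>q. (f (fst q) - f (snd q)) / (fst q - snd q))"
      by (intro continuous_intros continuous_on_compose2[OF cf]) (auto simp: V_def)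
    then have "continuous_on V (\<lambda>q. diff_quot f (fst q) (snd q))"
      by (rule continuous_on_eq) (auto simp: diff_quot_def V_def)
    then show ?thesis using V continuous_on_eq_continuous_at by blast
  next
    case True
    define c where "c = fst p"
    have pc: "p = (c, c)" and c: "c \<in> U" using True p by (auto simp: c_def prod_eq_iff mem_Times_iff)
    have "isCont (deriv f) c"
      using holomorphic_on_imp_continuous_on[OF holomorphic_deriv[OF f U]] U c
        continuous_on_eq_continuous_at by blast
    show ?thesis
      unfolding pc continuous_at_eps_delta
    proof (intro allI impI)
      fix e :: real assume e: "e > 0"
      obtain d1 where d1: "d1 > 0" "\<And>z. dist z c < d1 \<Longrightarrow> dist (deriv f z) (deriv f c) < e / 2"
        using \<open>isCont (deriv f) c\<close> e unfolding continuous_at_eps_delta by (meson half_gt_zero)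
      obtain d2 where d2: "d2 > 0" "ball c d2 \<subseteq> U" using U c open_contains_ball by blast
      define d where "d = min d1 d2"
      have d: "d > 0" using d1 d2 by (simp add: d_def)
      have sub: "ball c d \<subseteq> U" using d2 by (auto simp: d_def)
      have near: "norm (deriv f z - deriv f c) \<le> e / 2" if "z \<in> ball c d" for z
        using d1(2)[of z] that by (simp add: d_def dist_norm norm_minus_commute dist_commute)
      have q: "norm (diff_quot f z w - deriv f c) \<le> e / 2" if z: "z \<in> ball c d" and w: "w \<in> ball c d" for z w
      proof (cases "z = w")
        case True
        then show ?thesis using near[OF w] by (simp add: diff_quot_def)
      next
        case False
        have "norm ((f z - deriv f c * z) - (f w - deriv f c * w)) \<le> e / 2 * norm (z - w)"
        proof (rule field_differentiable_bound[OF convex_ball _ near z w])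
          fix u assume u: "u \<in> ball c d"
          have "(f has_field_derivative deriv f u) (at u within ball c d)"
            using holomorphic_derivI[OF f U] sub u by (blast intro: has_field_derivative_at_within)
          then show "((\<lambda>z. f z - deriv f c * z) has_field_derivative deriv f u - deriv f c) (at u within ball c d)"
            by (auto intro!: derivative_eq_intros)
        qed
        moreover have "(f z - deriv f c * z) - (f w - deriv f c * w) = (z - w) * (diff_quot f z w - deriv f c)"
          by (simp add: right_diff_distrib diff_quot_mult) (simp add: algebra_simps)
        ultimately show ?thesis using False by (simp add: norm_mult mult.commute)
      qed
      show "\<exists>d>0. \<forall>x. dist x (c, c) < d \<longrightarrow>
          dist (diff_quot f (fst x) (snd x)) (diff_quot f (fst (c, c)) (snd (c, c))) < e"
      proof (intro exI[of _ d] conjI allI impI d)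
        fix x :: "complex \<times> complex" assume x: "dist x (c, c) < d"
        have "fst x \<in> ball c d" "snd x \<in> ball c d"
          using x dist_fst_le[of x "(c, c)"] dist_snd_le[of x "(c, c)"] by (auto simp: dist_commute)
        from q[OF this] show "dist (diff_quot f (fst x) (snd x)) (diff_quot f (fst (c, c)) (snd (c, c))) < e"
          using e by (simp add: dist_norm diff_quot_def[of f c c])
      qed
    qed
  qed
qed

section \<open>Contours close to the spectra and the norm estimate\<close>

lemma compact_neighbourhood:
  fixes K U :: "complex set"
  assumes K: "compact K" and U: "open U" "K \<subseteq> U" and e: "e > 0"
  obtains W where "open W" "K \<subseteq> W" "compact (closure W)" "closure W \<subseteq> U"
    "\<And>z. z \<in> W \<Longrightarrow> \<exists>x\<in>K. dist x z < e"
proof -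
  obtain d where d: "d > 0" "(\<Union>x\<in>K. cball x d) \<subseteq> U"
    using compact_subset_open_imp_cball_epsilon_subset[OF K U] by metis
  define r where "r = min d e"
  have r: "r > 0" "r \<le> d" "r \<le> e" using d e by (auto simp: r_def)
  define W where "W = (\<Union>x\<in>K. ball x r)"
  define T where "T = (\<Union>x\<in>K. \<Union>y\<in>cball 0 r. {x + y})"
  have T: "compact T" unfolding T_def using K by (intro compact_sums') auto
  have "W \<subseteq> T"
  proof
    fix z assume "z \<in> W"
    then obtain x where "x \<in> K" "dist x z < r" by (auto simp: W_def)
    then have "x \<in> K" "z - x \<in> cball 0 r" "z = x + (z - x)"
      by (auto simp: dist_norm norm_minus_commute)
    then show "z \<in> T" unfolding T_def by blast
  qed
  then have cl: "closure W \<subseteq> T" using T by (intro closure_minimal compact_imp_closed)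
  have "T \<subseteq> U"
  proof
    fix z assume "z \<in> T"
    then obtain x y where "x \<in> K" "y \<in> cball 0 r" "z = x + y" unfolding T_def by blast
    then have "x \<in> K" "z \<in> cball x d" using r by (auto simp: dist_norm)
    then show "z \<in> U" using d(2) by blast
  qed
  show ?thesis
  proof (rule that[of W])
    show "compact (closure W)"
      using compact_Int_closed[OF T closed_closure, of W] cl by (simp add: inf.absorb2)
    show "\<exists>x\<in>K. dist x z < e" if "z \<in> W" for z
      using that r by (force simp: W_def)
  qed (use cl \<open>T \<subseteq> U\<close> r in \<open>auto simp: W_def\<close>)
qed

text \<open>A strict bound on the compact product of the spectra persists on a product of
  neighbourhoods, and the chains are drawn there. They are fixed before \<open>n\<close>, hence so
  is \<open>C\<close>.\<close>

lemma Cpow_hfc_bound: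
  fixes a b :: "'a::complex_banach_algebra"
  assumes U: "open U" "spec a \<union> spec b \<subseteq> U" and f: "f holomorphic_on U"
    and M: "\<And>z w. z \<in> spec a \<Longrightarrow> w \<in> spec b \<Longrightarrow> norm (diff_quot f z w) < M" and M0: "M > 0"
  obtains C where "C > 0"
    "\<And>n. norm (Cpow (hfc U f a) (hfc U f b) n) \<le> C * M ^ n * norm (Cpow a b n)"
proof -
  let ?q = "diff_quot f"
  have qc: "continuous_on (U \<times> U) (\<lambda>p. ?q (fst p) (snd p))"
    by (rule diff_quot_continuous[OF f U(1)])
  define O1 where "O1 = (U \<times> U) \<inter> (\<lambda>p. ?q (fst p) (snd p)) -` ball 0 M"
  have O1: "open O1" unfolding O1_def using qc U(1) by (intro continuous_open_preimage open_Times) auto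
  have "spec a \<times> spec b \<subseteq> O1" using M U(2) by (auto simp: O1_def)
  then obtain e where e: "e > 0" "(\<Union>p\<in>spec a \<times> spec b. ball p e) \<subseteq> O1"
    using compact_subset_open_imp_ball_epsilon_subset[OF compact_Times[OF compact_spec compact_spec] O1] by metis
  have sU: "spec a \<subseteq> U" "spec b \<subseteq> U" using U(2) by auto
  \<comment> \<open>Two deviations below \<open>e / 2\<close> in the coordinates stay below
    \<open>e\<close> in the product metric.\<close>
  have e2: "e / 2 > 0" using e by simp
  obtain W where W: "open W" "spec a \<subseteq> W" "compact (closure W)" "closure W \<subseteq> U"
    "\<And>z. z \<in> W \<Longrightarrow> \<exists>x\<in>spec a. dist x z < e / 2"
    using compact_neighbourhood[OF compact_spec U(1) sU(1) e2] by blast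
  obtain W' where W': "open W'" "spec b \<subseteq> W'" "compact (closure W')" "closure W' \<subseteq> U"
    "\<And>z. z \<in> W' \<Longrightarrow> \<exists>x\<in>spec b. dist x z < e / 2"
    using compact_neighbourhood[OF compact_spec U(1) sU(2) e2] by blast
  have q_less: "norm (?q z w) \<le> M" if z: "z \<in> W" and w: "w \<in> W'" for z w
  proof -
    obtain x y where xy: "x \<in> spec a" "dist x z < e / 2" "y \<in> spec b" "dist y w < e / 2"
      using W(5)[OF z] W'(5)[OF w] by blast
    have "dist (x, y) (z, w) \<le> dist x z + dist y w"
      unfolding dist_Pair_Pair by (rule sqrt_sum_squares_le_sum) auto
    then have "(z, w) \<in> ball (x, y) e" using xy by simp
    then have "(z, w) \<in> O1" using e(2) xy by blast
    then show ?thesis by (simp add: O1_def)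
  qed
  obtain E where E: "spectral_chain a W E" using spectral_chain_exists[OF W(1,2)] .
  obtain E' where E': "spectral_chain b W' E'" using spectral_chain_exists[OF W'(1,2)] .
  have cE: "cauchy_chain (spec a) W E" and cE': "cauchy_chain (spec b) W' E'"
    using E E' by (auto simp: spectral_chain_def)
  have im: "chain_image E \<subseteq> W - spec a" "chain_image E' \<subseteq> W' - spec b"
    using cauchy_chain_image[OF cE] cauchy_chain_image[OF cE'] .
  have WU: "W \<subseteq> U" "W' \<subseteq> U" using W(4) W'(4) closure_subset by blast+
  have disj: "chain_image E \<inter> spec a = {}" "chain_image E' \<inter> spec b = {}" using im by auto
  let ?P = "chain_image E \<times> chain_image E'"
  have PU: "?P \<subseteq> U \<times> U" using im WU by auto
  have cf: "continuous_on U f" using f by (rule holomorphic_on_imp_continuous_on)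
  have cf12: "continuous_on ?P (\<lambda>p. f (fst p))" "continuous_on ?P (\<lambda>p. f (snd p))"
    using PU by (auto intro!: continuous_on_compose2[OF cf] continuous_intros)
  have cq: "continuous_on ?P (\<lambda>p. ?q (fst p) (snd p))"
    using qc PU by (rule continuous_on_subset)
  let ?I = "\<lambda>h x. double_integral a b h x E E'"
  let ?c = "1 / (2 * pi * \<i>)"
  \<comment> \<open>Each factor \<open>z - w\<close> becomes one step of the \<open>Cpow\<close>
    recursion. The exponent \<open>m\<close> of the quotient is kept separate from \<open>n\<close>,
    so that the induction lowers only the power of \<open>z - w\<close>.\<close>
  have shift: "?I (\<lambda>z w. (z - w) ^ n * ?q z w ^ m) (Cpow a b k) = ?I (\<lambda>z w. ?q z w ^ m) (Cpow a b (k + n))" for n m k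
  proof (induction n arbitrary: k)
    case (Suc n)
    let ?h = "\<lambda>z w. (z - w) ^ n * ?q z w ^ m"
    have "?I (\<lambda>z w. (z - w) * ?h z w) (Cpow a b k) = ?I ?h (a * Cpow a b k - Cpow a b k * b)"
    proof (rule double_integral_shift[OF disj])
      show "continuous_on ?P (\<lambda>p. ?h (fst p) (snd p))" by (intro continuous_intros cq)
      show "cchain (\<lambda>z. ?h z w) E = 0" for w
      proof -
        have "(\<lambda>z. ?h z w) holomorphic_on W"
          by (intro holomorphic_intros holomorphic_on_subset[OF diff_quot_holomorphic(1)[OF f U(1)] WU(1)])
        then show ?thesis using cE unfolding cauchy_chain_def by blast
      qed
      show "cchain (\<lambda>w. ?h z w) E' = 0" for z
      proof -
        have "(\<lambda>w. ?h z w) holomorphic_on W'"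
          by (intro holomorphic_intros holomorphic_on_subset[OF diff_quot_holomorphic(2)[OF f U(1)] WU(2)])
        then show ?thesis using cE' unfolding cauchy_chain_def by blast
      qed
    qed
    also have "\<dots> = ?I (\<lambda>z w. ?q z w ^ m) (Cpow a b (Suc k + n))"
      unfolding Cpow_Suc[symmetric] by (rule Suc.IH)
    finally show ?case by (simp add: mult.assoc)
  qed simp
  let ?fa = "hfc U f a" and ?fb = "hfc U f b"
  \<comment> \<open>The outer powers \<open>m\<close> and \<open>k\<close> make the induction work:
    the recursion for \<open>Cpow\<close> puts one further factor \<open>?fa\<close> on the left or
    \<open>?fb\<close> on the right.\<close>
  have Cpow_eq: "?fa ^ m * Cpow ?fa ?fb n * ?fb ^ k
      = cscale (?c * ?c) (?I (\<lambda>z w. f z ^ m * (f z - f w) ^ n * f w ^ k) 1)" for m n k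
  proof (induction n arbitrary: m k)
    case 0
    have c: "continuous_on (chain_image E) (\<lambda>z. f z ^ m)" "continuous_on (chain_image E') (\<lambda>w. f w ^ k)"
      by (intro continuous_intros continuous_on_subset[OF cf]; use im WU in blast)+
    have "?fa ^ m * ?fb ^ k = cscale ?c (calc_integral a (\<lambda>z. f z ^ m) E) * cscale ?c (calc_integral b (\<lambda>w. f w ^ k) E')"
      using hfc_power[OF U(1) f E W(1,3,4,2)] hfc_power[OF U(1) f E' W'(1,3,4,2)] by simp
    also have "\<dots> = cscale (?c * ?c) (calc_integral a (\<lambda>z. f z ^ m) E * calc_integral b (\<lambda>w. f w ^ k) E')"
      by (simp only: cscale_mult_left cscale_mult_right cscale_cscale)
    also have "calc_integral a (\<lambda>z. f z ^ m) E * calc_integral b (\<lambda>w. f w ^ k) E'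
        = ?I (\<lambda>z w. f z ^ m * f w ^ k) 1"
      by (rule double_integral_product[OF disj c])
    finally show ?case by simp
  next
    case (Suc n)
    let ?h1 = "\<lambda>z w. f z ^ Suc m * (f z - f w) ^ n * f w ^ k"
    let ?h2 = "\<lambda>z w. f z ^ m * (f z - f w) ^ n * f w ^ Suc k"
    have "?fa ^ m * Cpow ?fa ?fb (Suc n) * ?fb ^ k
        = ?fa ^ Suc m * Cpow ?fa ?fb n * ?fb ^ k - ?fa ^ m * Cpow ?fa ?fb n * ?fb ^ Suc k"
      by (simp add: Cpow_Suc right_diff_distrib left_diff_distrib mult.assoc power_commutes)
        (metis mult.assoc power_commutes)
    also have "\<dots> = cscale (?c * ?c) (?I ?h1 1) - cscale (?c * ?c) (?I ?h2 1)"
      by (simp only: Suc.IH)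
    also have "\<dots> = cscale (?c * ?c) (?I ?h1 1 - ?I ?h2 1)" by (rule cscale.diff_right[symmetric])
    also have "?I ?h1 1 - ?I ?h2 1 = ?I (\<lambda>z w. ?h1 z w - ?h2 z w) 1"
      by (rule double_integral_diff[OF disj, symmetric]; intro continuous_intros cf12)
    also have "\<dots> = ?I (\<lambda>z w. f z ^ m * (f z - f w) ^ Suc n * f w ^ k) 1"
      by (rule double_integral_cong[OF disj]) (simp add: algebra_simps)
    finally show ?case .
  qed
  obtain C where C: "C \<ge> 0" "\<And>h x B. continuous_on ?P (\<lambda>p. h (fst p) (snd p)) \<Longrightarrow> 0 \<le> B \<Longrightarrow>
      (\<And>z w. z \<in> chain_image E \<Longrightarrow> w \<in> chain_image E' \<Longrightarrow> norm (h z w) \<le> B) \<Longrightarrow>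
      norm (?I h x) \<le> C * B * norm x"
    using double_integral_bound[OF disj] by blast
  show ?thesis
  \<comment> \<open>Adding 1 makes the constant positive, so that its \<open>n\<close>-th roots tend
    to 1.\<close>
  proof (rule that[of "norm (?c * ?c) * C + 1"])
    show "0 < norm (?c * ?c) * C + 1" using C(1) by (simp add: add_nonneg_pos)
    fix n
    have "Cpow ?fa ?fb n = cscale (?c * ?c) (?I (\<lambda>z w. (f z - f w) ^ n) 1)"
      using Cpow_eq[of 0 n 0] by simp
    also have "?I (\<lambda>z w. (f z - f w) ^ n) 1 = ?I (\<lambda>z w. (z - w) ^ n * ?q z w ^ n) 1"
      by (rule double_integral_cong[OF disj]) (simp add: diff_quot_mult flip: power_mult_distrib)
    also have "\<dots> = ?I (\<lambda>z w. ?q z w ^ n) (Cpow a b n)"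
      using shift[of n n 0] by simp
    finally have "norm (Cpow ?fa ?fb n) = norm (?c * ?c) * norm (?I (\<lambda>z w. ?q z w ^ n) (Cpow a b n))"
      by (simp only: norm_cscale)
    also have "\<dots> \<le> norm (?c * ?c) * (C * M ^ n * norm (Cpow a b n))"
    proof (intro mult_left_mono C(2))
      show "norm (?q z w ^ n) \<le> M ^ n" if "z \<in> chain_image E" "w \<in> chain_image E'" for z w
        unfolding norm_power using q_less that im by (intro power_mono) auto
    qed (use M0 in \<open>auto intro!: continuous_intros cq\<close>)
    also have "\<dots> = norm (?c * ?c) * C * (M ^ n * norm (Cpow a b n))" by (simp only: mult.assoc)
    also have "\<dots> \<le> (norm (?c * ?c) * C + 1) * (M ^ n * norm (Cpow a b n))"
      using M0 by (intro mult_right_mono) auto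
    finally show "norm (Cpow ?fa ?fb n) \<le> (norm (?c * ?c) * C + 1) * M ^ n * norm (Cpow a b n)"
      by (simp only: mult.assoc)
  qed
qed

text \<open>\<open>root n C\<close> tends to 1, and a convergent factor with positive finite limit
  can be taken out of a limsup.\<close>

lemma rho_le_scaled:
  assumes "C > 0" "M > 0" and le: "\<And>n. norm (Cpow x y n) \<le> C * M ^ n * norm (Cpow a b n)"
  shows "rho x y \<le> ereal M * rho a b"
proof -
  let ?v = "\<lambda>n. ereal (root n (norm (Cpow a b n)))"
  have "(\<lambda>n. M * root n C) \<longlonglongrightarrow> M * 1"
    using assms by (intro tendsto_intros LIMSEQ_root_const)
  then have "(\<lambda>n. ereal (M * root n C)) \<longlonglongrightarrow> ereal M" by simp
  then have lim: "limsup (\<lambda>n. ereal (M * root n C) * ?v n) = ereal M * limsup ?v"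
    using assms by (intro ereal_limsup_lim_mult) auto
  have "rho x y \<le> limsup (\<lambda>n. ereal (M * root n C) * ?v n)"
    unfolding rho_def
  proof (rule Limsup_mono)
    show "\<forall>\<^sub>F n in sequentially. ereal (root n (norm (Cpow x y n))) \<le> ereal (M * root n C) * ?v n"
      using eventually_gt_at_top[of 0]
    proof eventually_elim
      case (elim n)
      have "root n (norm (Cpow x y n)) \<le> root n (C * M ^ n * norm (Cpow a b n))"
        using elim le by (intro real_root_le_mono)
      also have "\<dots> = M * root n C * root n (norm (Cpow a b n))"
        using elim assms by (simp add: real_root_mult real_root_power_cancel)
      finally show ?case by simp
    qed
  qed
  then show ?thesis unfolding lim rho_def .
qed

text \<open>An abbreviation, so that facts about it are literally facts about the set displayed in
  the final theorem.\<close>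

abbreviation quotient_set :: "(complex \<Rightarrow> complex) \<Rightarrow> complex set \<Rightarrow> complex set \<Rightarrow> real set" where
  "quotient_set f K L \<equiv> \<Union>w\<in>L. {norm ((f z - f w) / (z - w)) | z. z \<in> K \<and> z \<noteq> w} \<union> {norm (deriv f w)}"

lemma diff_quot_in_quotient_set:
  "z \<in> K \<Longrightarrow> w \<in> L \<Longrightarrow> norm (diff_quot f z w) \<in> quotient_set f K L"
  by (auto simp: diff_quot_def)

text \<open>Continuity on the compact set \<open>K \<times> L\<close> bounds the quotients. The
  derivatives need a bound of their own, because a point of \<open>L\<close> outside
  \<open>K\<close> has no diagonal pair in \<open>K \<times> L\<close>.\<close>

lemma bdd_above_quotient_set:
  assumes U: "open U" "K \<union> L \<subseteq> U" and f: "f holomorphic_on U" and K: "compact K" "compact L"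
  shows "bdd_above (quotient_set f K L)"
proof -
  have "compact ((\<lambda>p. diff_quot f (fst p) (snd p)) ` (K \<times> L))"
    using U K by (intro compact_continuous_image compact_Times
        continuous_on_subset[OF diff_quot_continuous[OF f U(1)]]) auto
  from compact_imp_bounded[OF this]
  obtain B1 where B1: "\<And>z w. z \<in> K \<Longrightarrow> w \<in> L \<Longrightarrow> norm (diff_quot f z w) \<le> B1"
    unfolding bounded_iff by auto
  have "compact (deriv f ` L)"
    using U K by (intro compact_continuous_image
        continuous_on_subset[OF holomorphic_on_imp_continuous_on[OF holomorphic_deriv[OF f U(1)]]]) auto
  from compact_imp_bounded[OF this]
  obtain B2 where B2: "\<And>w. w \<in> L \<Longrightarrow> norm (deriv f w) \<le> B2"
    unfolding bounded_iff by auto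
  show ?thesis
  proof (rule bdd_aboveI[of _ "max B1 B2"])
    fix x assume "x \<in> quotient_set f K L"
    then obtain w where w: "w \<in> L" and
      "(\<exists>z. z \<in> K \<and> z \<noteq> w \<and> x = norm ((f z - f w) / (z - w))) \<or> x = norm (deriv f w)"
      by blast
    then show "x \<le> max B1 B2"
      using B1[OF _ w] B2[OF w] by (force simp: diff_quot_def split: if_splits)
  qed
qed

text \<open>The supremum \<open>M\<close> bounds the quotients only weakly, while
  \<open>Cpow_hfc_bound\<close> wants a strict and positive bound; so \<open>M + \<epsilon>\<close>
  is used and \<open>\<epsilon>\<close> removed at the end, with finite \<open>rho\<close> allowing
  real arithmetic.\<close>

lemma rho_hfc_le:
  fixes a b :: "'a::complex_banach_algebra"
  assumes U: "open U" "spec a \<union> spec b \<subseteq> U" and f: "f holomorphic_on U"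
  shows "rho (hfc U f a) (hfc U f b) \<le> ereal (Sup (quotient_set f (spec a) (spec b))) * rho a b"
proof -
  let ?X = "quotient_set f (spec a) (spec b)"
  define M where "M = Sup ?X"
  have bdd: "bdd_above ?X" by (rule bdd_above_quotient_set[OF U f compact_spec compact_spec])
  \<comment> \<open>One point of the spectrum suffices for \<open>M \<ge> 0\<close>, as its
    derivative term belongs to the set.\<close>
  obtain w0 where "w0 \<in> spec b" using spec_nonempty[of b] by blast
  then have "norm (deriv f w0) \<in> ?X" by blast
  then have "norm (deriv f w0) \<le> M" unfolding M_def using bdd by (rule cSup_upper)
  then have M0: "M \<ge> 0" using norm_ge_zero[of "deriv f w0"] by linarith
  have M: "norm (diff_quot f z w) \<le> M" if "z \<in> spec a" "w \<in> spec b" for z w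
    unfolding M_def using diff_quot_in_quotient_set[OF that] bdd by (rule cSup_upper)
  obtain r where r: "rho a b = ereal r" "r \<ge> 0" by (rule rho_real)
  obtain s where s: "rho (hfc U f a) (hfc U f b) = ereal s" "s \<ge> 0" by (rule rho_real)
  have le: "s \<le> (M + \<epsilon>) * r" if "\<epsilon> > 0" for \<epsilon>
  proof -
    have less: "norm (diff_quot f z w) < M + \<epsilon>" if "z \<in> spec a" "w \<in> spec b" for z w
      using M[OF that] \<open>\<epsilon> > 0\<close> by linarith
    have pos: "M + \<epsilon> > 0" using M0 that by linarith
    obtain C where "C > 0" "\<And>n. norm (Cpow (hfc U f a) (hfc U f b) n) \<le> C * (M + \<epsilon>) ^ n * norm (Cpow a b n)"
      using Cpow_hfc_bound[OF U f less pos] by blast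
    then have "rho (hfc U f a) (hfc U f b) \<le> ereal (M + \<epsilon>) * rho a b"
      using M0 that by (intro rho_le_scaled) auto
    then show ?thesis by (simp add: r s)
  qed
  have "s \<le> M * r"
  proof (rule field_le_epsilon)
    fix e :: real assume e: "e > 0"
    \<comment> \<open>Division by \<open>r + 1\<close> keeps the excess below \<open>e\<close> and
      covers \<open>r = 0\<close>.\<close>
    have "s \<le> (M + e / (r + 1)) * r" using e r by (intro le) simp
    also have "\<dots> = M * r + e * (r / (r + 1))" by (simp add: algebra_simps)
    also have "\<dots> \<le> M * r + e * 1" using e r by (intro add_left_mono mult_left_mono) auto
    finally show "s \<le> M * r + e" by simp
  qed
  then show ?thesis by (simp add: r s M_def)
qed

theorem theorem2p1:
  fixes a b :: "'a::complex_banach_algebra"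
    and f :: "complex \<Rightarrow> complex" and U :: "complex set"
  assumes "open U" and "spec a \<union> spec b \<subseteq> U" and "f holomorphic_on U"
  shows "bdd_above (\<Union>w\<in>spec b.
            {norm ((f z - f w) / (z - w)) | z. z \<in> spec a \<and> z \<noteq> w} \<union> {norm (deriv f w)})
    \<and> rho (hfc U f a) (hfc U f b)
        \<le> ereal (Sup (\<Union>w\<in>spec b.
            {norm ((f z - f w) / (z - w)) | z. z \<in> spec a \<and> z \<noteq> w} \<union> {norm (deriv f w)}))
          * rho a b
    \<and> (\<forall>V g. d_rho a b = 0 \<and> open V \<and> spec a \<subseteq> V \<and> g holomorphic_on V
          \<longrightarrow> d_rho (hfc V g a) (hfc V g b) = 0)"
proof (intro conjI allI impI)
  show "bdd_above (quotient_set f (spec a) (spec b))"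
    by (rule bdd_above_quotient_set[OF assms compact_spec compact_spec])
  show "rho (hfc U f a) (hfc U f b) \<le> ereal (Sup (quotient_set f (spec a) (spec b))) * rho a b"
    by (rule rho_hfc_le[OF assms])
  fix V g assume asm: "d_rho a b = 0 \<and> open V \<and> spec a \<subseteq> V \<and> g holomorphic_on V"
  then have V: "open V" "spec a \<subseteq> V" and g: "g holomorphic_on V" by auto
  have "rho a b \<le> 0" "rho b a \<le> 0"
    using asm by (auto simp: d_rho_def max_def split: if_splits)
  then have z: "rho a b = 0" "rho b a = 0"
    using rho_nonneg[of a b] rho_nonneg[of b a] by auto
  \<comment> \<open>Vanishing of both radii gives \<open>spec b \<subseteq> spec a\<close>, so
    \<open>V\<close> contains both spectra and the estimate applies in either order.\<close>
  have sub: "spec a \<union> spec b \<subseteq> V" "spec b \<union> spec a \<subseteq> V"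
    using spec_subset_if_rho_zero[OF z(2,1)] V(2) by auto
  have "rho (hfc V g a) (hfc V g b) \<le> 0" "rho (hfc V g b) (hfc V g a) \<le> 0"
    using rho_hfc_le[OF V(1) sub(1) g] rho_hfc_le[OF V(1) sub(2) g] by (simp_all add: z)
  then show "d_rho (hfc V g a) (hfc V g b) = 0"
    using rho_nonneg[of "hfc V g a" "hfc V g b"] rho_nonneg[of "hfc V g b" "hfc V g a"]
    by (simp add: d_rho_def)
qed

end
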